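(* Let $\nu>1$ and let $F$ be an almost smooth circle map with a flat spot $U$, with critical exponent $(\nu,\nu)$ and irrational rotation number. Then the set ${\bf S}^1\setminus\bigcup_{i=0}^{\infty}F^{-i}(U)$ has zero Lebesgue measure. Moreover, if the rotation number of $F$ is of bounded type, then the Hausdorff dimension of the non-wandering set of $F$ is strictly less than $1$.
   Context: An almost smooth map with a flat spot is a continuous, weakly order-preserving, degree one circle endomorphism $F:{\bf S}^1\to{\bf S}^1$ for which there is an open arc $U$ (the flat spot) such that: (1) $F(U)$ is one point; (2) the restriction of $F$ to ${\bf S}^1\setminus\overline{U}$ is a $C^2$-diffeomorphism onto its image; (3) if $f$ is a lifting of $F$ to the real line and $(a,b)$ is a lift of $U$, then on some right-sided neighborhood of $b$ one has $f(x)=h_r((x-b)^{p_r})$ with $p_r\ge 1$, where $h_r$ extends as a $C^2$-diffeomorphism to a full neighborhood of the relevant endpoint, and analogously on some left-sided neighborhood of $a$ one has $f(x)=h_l((a-x)^{p_l})$ with $p_l\geq 1$. The pair $(p_l,p_r)$ is the critical exponent. The rotation number is $\rho(F)=\lim_{n\to\infty} f^n(x)/n \pmod 1$, which exists and does not depend on $x$. Let $q_n$ denote the closest return times (the denominators of the continued fraction convergents) of $\rho(F)$. The rotation number is of bounded type if the ratios $q_n/q_{n-1}$ are uniformly bounded. *)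

theory Defs
  imports "HOL-Analysis.Analysis"
begin

section \<open>The circle and lifts\<close>

text \<open>The circle is the unit circle in the complex plane, with the real line as universal
  cover; \<^term>\<open>circ_proj x = circ_proj y\<close> iff \<^term>\<open>x - y\<close> is an integer.  A circle map is a
  function on \<^typ>\<open>complex\<close> of which only the values on the circle matter.\<close>

abbreviation circle :: "complex set" where
  "circle \<equiv> sphere 0 1"

definition circ_proj :: "real \<Rightarrow> complex" where
  "circ_proj x = cis (2 * pi * x)"

definition is_lift :: "(real \<Rightarrow> real) \<Rightarrow> (complex \<Rightarrow> complex) \<Rightarrow> bool" where
  "is_lift f F \<longleftrightarrow> continuous_on UNIV f \<and> (\<forall>x. circ_proj (f x) = F (circ_proj x))"

text \<open>Any two lifts differ by a constant integer, so it does not matter which one is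
  monotone and of degree one.\<close>

definition monotone_degree_one :: "(complex \<Rightarrow> complex) \<Rightarrow> bool" where
  "monotone_degree_one F \<longleftrightarrow>
     F ` circle \<subseteq> circle \<and> continuous_on circle F \<and>
     (\<exists>f. is_lift f F \<and> mono f \<and> (\<forall>x. f (x + 1) = f x + 1))"

text \<open>\<^term>\<open>{a<..<b}\<close> is a lift of the open arc \<open>U\<close>.\<close>

definition lifts_arc :: "real \<Rightarrow> real \<Rightarrow> complex set \<Rightarrow> bool" where
  "lifts_arc a b U \<longleftrightarrow> a < b \<and> b < a + 1 \<and> U = circ_proj ` {a<..<b}"

text \<open>Arc length, normalised to total mass one.\<close>

definition circle_lebesgue :: "complex measure" where
  "circle_lebesgue = distr (restrict_space lborel {0..<1}) borel circ_proj"


section \<open>Almost smooth maps with a flat spot\<close>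

definition C2_on :: "(real \<Rightarrow> real) \<Rightarrow> real set \<Rightarrow> bool" where
  "C2_on f S \<longleftrightarrow>
     (\<exists>f' f''. (\<forall>x\<in>S. (f has_real_derivative f' x) (at x)) \<and>
               (\<forall>x\<in>S. (f' has_real_derivative f'' x) (at x)) \<and>
               continuous_on S f'')"

text \<open>\<open>C\<^sup>2\<close>-diffeomorphism of an open set \<open>S\<close> onto its image.\<close>

definition C2_diffeo_on :: "(real \<Rightarrow> real) \<Rightarrow> real set \<Rightarrow> bool" where
  "C2_diffeo_on f S \<longleftrightarrow>
     open S \<and> inj_on f S \<and> C2_on f S \<and>
     open (f ` S) \<and> C2_on (the_inv_into S f) (f ` S)"

text \<open>The complement of the closure of \<open>U\<close> lifts to \<^term>\<open>{b<..<a + 1}\<close>, on which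
  \<^const>\<open>circ_proj\<close> is a chart; smoothness of the circle map there is smoothness of the lift.
  Injectivity of the lift there also gives injectivity on the circle, since a monotone lift
  that is constant on the interval from \<open>a\<close> to \<open>b\<close> maps \<^term>\<open>{b<..<a + 1}\<close>
  into \<^term>\<open>{f b<..<f b + 1}\<close> once it is injective.\<close>

definition almost_smooth_flat_spot ::
  "(complex \<Rightarrow> complex) \<Rightarrow> complex set \<Rightarrow> real \<Rightarrow> real \<Rightarrow> bool" where
  "almost_smooth_flat_spot F U pl pr \<longleftrightarrow>
     monotone_degree_one F \<and>
     (\<exists>a b. lifts_arc a b U) \<and>
     (\<exists>c. F ` U = {c}) \<and>
     pl \<ge> 1 \<and> pr \<ge> 1 \<and>
     (\<forall>f a b. is_lift f F \<and> lifts_arc a b U \<longrightarrow>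
        C2_diffeo_on f {b<..<a + 1} \<and>
        (\<exists>h e. e > 0 \<and> C2_diffeo_on h {-e<..<e} \<and>
               (\<forall>\<^sub>F x in at_right b. f x = h ((x - b) powr pr))) \<and>
        (\<exists>h e. e > 0 \<and> C2_diffeo_on h {-e<..<e} \<and>
               (\<forall>\<^sub>F x in at_left a. f x = h ((a - x) powr pl))))"


section \<open>Rotation number and bounded type\<close>

text \<open>The representative in \<^term>\<open>{0..<1::real}\<close> of the rotation number modulo one.\<close>

definition rotation_number :: "(complex \<Rightarrow> complex) \<Rightarrow> real" where
  "rotation_number F =
     (THE r. \<forall>f x. is_lift f F \<longrightarrow>
        (\<exists>L. (\<lambda>n. (f ^^ n) x / real n) \<longlonglongrightarrow> L \<and> r = frac L))"

text \<open>Continued fraction expansion of an irrational number: complete quotients, partial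
  quotients, and denominators \<open>q\<^sub>n\<close> of the convergents.\<close>

fun cf_tail :: "real \<Rightarrow> nat \<Rightarrow> real" where
  "cf_tail r 0 = r"
| "cf_tail r (Suc n) = 1 / frac (cf_tail r n)"

definition cf_digit :: "real \<Rightarrow> nat \<Rightarrow> int" where
  "cf_digit r n = \<lfloor>cf_tail r n\<rfloor>"

fun cf_denom :: "real \<Rightarrow> nat \<Rightarrow> int" where
  "cf_denom r 0 = 1"
| "cf_denom r (Suc 0) = cf_digit r 1"
| "cf_denom r (Suc (Suc n)) =
     cf_digit r (Suc (Suc n)) * cf_denom r (Suc n) + cf_denom r n"

definition bounded_type :: "real \<Rightarrow> bool" where
  "bounded_type r \<longleftrightarrow>
     (\<exists>C. \<forall>n\<ge>1. real_of_int (cf_denom r n) / real_of_int (cf_denom r (n - 1)) \<le> C)"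


section \<open>Non-wandering set and Hausdorff dimension\<close>

definition nonwandering :: "(complex \<Rightarrow> complex) \<Rightarrow> complex set" where
  "nonwandering F =
     {z \<in> circle. \<forall>V. openin (top_of_set circle) V \<and> z \<in> V \<longrightarrow>
                      (\<exists>n\<ge>1. (F ^^ n) ` V \<inter> V \<noteq> {})}"

text \<open>\<open>(diam X)\<^sup>s\<close> with the conventions that the empty set contributes \<open>0\<close> and that
  \<open>0\<^sup>0 = 1\<close> for nonempty \<open>X\<close>; note that \<^term>\<open>0 powr 0 = (0::real)\<close>.\<close>

definition diam_pow :: "real \<Rightarrow> 'a::metric_space set \<Rightarrow> ennreal" where
  "diam_pow s X =
     (if X = {} then 0 else if s = 0 then 1 else ennreal (diameter X powr s))"

definition hausdorff_measure :: "real \<Rightarrow> 'a::metric_space set \<Rightarrow> ennreal" where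
  "hausdorff_measure s A =
     (SUP d\<in>{0<..}. INF X\<in>{X :: nat \<Rightarrow> 'a set.
          A \<subseteq> (\<Union>i. X i) \<and> (\<forall>i. bounded (X i) \<and> diameter (X i) \<le> d)}.
        \<Sum>i. diam_pow s (X i))"

text \<open>On subsets of the circle the Euclidean metric of the plane is used; it is bi-Lipschitz
  equivalent to arc length and hence gives the same dimension.\<close>

definition hausdorff_dim :: "'a::metric_space set \<Rightarrow> ennreal" where
  "hausdorff_dim A = Inf {ennreal s | s. s \<ge> 0 \<and> hausdorff_measure s A = 0}"

end

theory Submission
  imports Defs
begin

text \<open>Let \<open>f\<close> be a lift of \<open>F\<close>, constant on \<open>[a, b]\<close>. For adjacent intervals \<open>L\<close>, \<open>M\<close>, \<open>R\<close> with union
  \<open>T\<close>, consider the cross-ratio \<open>|L| |R| / (|L \<union> M| |M \<union> R|)\<close>. If \<open>M\<close> avoids the flat spot, then \<open>f\<close>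
  multiplies it by at most \<open>exp (C |T|)\<close>: power laws and collapsing a part of \<open>L\<close> or \<open>R\<close> decrease it,
  and \<open>C\<^sup>2\<close> diffeomorphisms distort it by such a factor. Along orbits of intervals of bounded
  multiplicity the lengths have bounded sum, so that cross-ratios which are bounded below at some time
  are bounded below at all earlier times.

  Let \<open>M = (b, e)\<close> be short compared with a scale \<open>q\<^sub>n\<^sub>+\<^sub>1\<close> of the rotation. The shortest of its images
  up to that time has longer ones on both sides nearby, so pulling back gives room of size
  comparable to \<open>|M|\<close> beyond \<open>e\<close>. On the other side \<open>M\<close> has the flat spot itself, which is large. Pulling back
  once more shows that a preimage of \<open>U\<close> is not small compared with the gaps next to it, as long as
  its order is at most a multiple of the time scale belonging to these gaps.

  Hence the survivor set has gaps of definite relative size near each of its points at arbitrarily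
  small scales, so it is a null set by Vitali's theorem. For bounded type, the first preimage of \<open>U\<close> in every
  gap of the dynamical partition occupies a definite proportion of it; splitting all gaps in this way
  makes the sum of the \<open>s\<close>-th powers of their lengths contract for \<open>s\<close> close to \<open>1\<close>.\<close>

section \<open>Cross-ratios\<close>

text \<open>The control is one-sided: \<open>f\<close> can crush a cross-ratio to 0, but can
  increase it only by a controlled factor. Information therefore travels backwards in time, from a
  late moment at which the geometry is known. Only the images of \<open>M\<close> have to avoid the
  flat spot; the outer intervals may run across it and enter solely through their lengths.

  Combinatorial position is measured by the monotone semiconjugacy \<open>h\<close> to the rotation.
  The preimages of the flat spot sit at the heights \<open>p - m * \<rho>\<close>, pairwise distinct
  because \<open>\<rho>\<close> is irrational, so that questions about the order and the
  multiplicity of intervals become questions about orbits of the rotation. Closeness in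
  \<open>h\<close> alone does not bound distances on the line: smallness of a gap comes from the
  summability of the lengths of all preimages, and smallness of its distance to a point from the
  comparison of both lengths.

  Every estimate is proved on one side only; the other side follows by conjugation with x to -x,
  under which the axioms of the dynamical locale are invariant.\<close>

definition cr :: "real \<Rightarrow> real \<Rightarrow> real \<Rightarrow> real \<Rightarrow> real" where
  "cr a b c d = ((b - a) * (d - c)) / ((c - a) * (d - b))"

lemma cr_nonneg: "a \<le> b \<Longrightarrow> b \<le> c \<Longrightarrow> c \<le> d \<Longrightarrow> 0 \<le> cr a b c d"
  unfolding cr_def by (intro divide_nonneg_nonneg mult_nonneg_nonneg) auto

lemma cr_uminus: "cr (-d) (-c) (-b) (-a) = cr a b c d"
proof -
  have "(- c - - d) * (- a - - b) = (b - a) * (d - c)"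
    "(- b - - d) * (- a - - c) = (c - a) * (d - b)"
    by (simp_all add: algebra_simps)
  then show ?thesis by (simp only: cr_def)
qed

lemma cr_add: "cr (a + t) (b + t) (c + t) (d + t) = cr a b c d"
  by (simp add: cr_def)

lemma frac_mono_left:
  fixes l l' m :: real
  assumes "0 \<le> l" "l \<le> l'" "0 < m"
  shows "l / (l + m) \<le> l' / (l' + m)"
  using assms by (simp add: divide_simps) (simp add: algebra_simps mult_left_mono)

lemma cr_eq: "cr a b c d = ((b - a) / (c - a)) * ((d - c) / (d - b))"
  by (simp add: cr_def)

text \<open>Each factor in \<open>cr_eq\<close> has the form l / (l + m) and grows with l. This
  absorbs the parts of the outer intervals that lie in the flat spot and are cut off.\<close>

lemma cr_mono:
  assumes "a' \<le> a" "a \<le> b" "b < c" "c \<le> d" "d \<le> d'"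
  shows "cr a b c d \<le> cr a' b c d'"
proof -
  have "(b - a) / (c - a) \<le> (b - a') / (c - a')"
    using frac_mono_left[of "b - a" "b - a'" "c - b"] assms by simp
  moreover have "(d - c) / (d - b) \<le> (d' - c) / (d' - b)"
    using frac_mono_left[of "d - c" "d' - c" "c - b"] assms by simp
  ultimately show ?thesis unfolding cr_eq
    using assms by (intro mult_mono) auto
qed

text \<open>Dropping one factor turns a lower bound for the cross-ratio into space on one chosen
  side of the middle interval.\<close>

lemma cr_le_left:
  assumes "a \<le> b" "b < c" "c \<le> d"
  shows "cr a b c d \<le> (b - a) / (c - a)"
proof -
  have "(d - c) / (d - b) \<le> 1" using assms by simp
  then have "((b - a) / (c - a)) * ((d - c) / (d - b)) \<le> ((b - a) / (c - a)) * 1"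
    using assms by (intro mult_left_mono) auto
  then show ?thesis by (simp add: cr_eq)
qed

lemma cr_le_right:
  assumes "a \<le> b" "b < c" "c \<le> d"
  shows "cr a b c d \<le> (d - c) / (d - b)"
proof -
  have "(b - a) / (c - a) \<le> 1" using assms by simp
  then have "((b - a) / (c - a)) * ((d - c) / (d - b)) \<le> 1 * ((d - c) / (d - b))"
    using assms by (intro mult_right_mono) auto
  then show ?thesis by (simp add: cr_eq)
qed

text \<open>The outer intervals may be degenerate, the middle one may not, so no denominator
  vanishes on the right. The exponent is linear in the total length in order that iteration produces
  the sum of the lengths of the images.\<close>

definition cr_distortion :: "(real \<Rightarrow> real) \<Rightarrow> real set \<Rightarrow> real \<Rightarrow> bool" where
  "cr_distortion g S C \<longleftrightarrow>
     (\<forall>a\<in>S. \<forall>b\<in>S. \<forall>c\<in>S. \<forall>d\<in>S. a \<le> b \<and> b < c \<and> c \<le> d \<longrightarrow>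
        cr (g a) (g b) (g c) (g d) \<le> exp (C * (d - a)) * cr a b c d)"

lemma cr_distortionD:
  assumes "cr_distortion g S C" "a \<in> S" "b \<in> S" "c \<in> S" "d \<in> S" "a \<le> b" "b < c" "c \<le> d"
  shows "cr (g a) (g b) (g c) (g d) \<le> exp (C * (d - a)) * cr a b c d"
  using assms unfolding cr_distortion_def by blast

section \<open>Power maps do not increase cross-ratios\<close>

lemma sinh_ratio_mono:
  fixes \<nu> u v :: real
  assumes "\<nu> \<ge> 1" "0 < u" "u \<le> v"
  shows "sinh (\<nu> * u) * sinh v \<le> sinh (\<nu> * v) * sinh u"
proof -
  \<comment> \<open>This is the numerator of the derivative of
    \<open>sinh (\<nu> * t) / sinh t\<close>; it vanishes at 0 and has a nonnegative derivative on
    the right of 0.\<close>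
  define \<psi> where "\<psi> = (\<lambda>t. \<nu> * cosh (\<nu> * t) * sinh t - sinh (\<nu> * t) * cosh t)"
  have d\<psi>: "(\<psi> has_real_derivative ((\<nu>\<^sup>2 - 1) * sinh (\<nu> * t) * sinh t)) (at t)" for t
    unfolding \<psi>_def
    by (auto intro!: derivative_eq_intros simp: algebra_simps power2_eq_square)
  have \<psi>: "\<psi> t \<ge> 0" if "t \<ge> 0" for t
  proof -
    have "\<psi> 0 \<le> \<psi> t"
    proof (rule DERIV_nonneg_imp_nondecreasing[OF that])
      fix x :: real assume "0 \<le> x" "x \<le> t"
      moreover have "\<nu>\<^sup>2 - 1 \<ge> 0" using assms by simp
      ultimately show "\<exists>y. (\<psi> has_real_derivative y) (at x) \<and> 0 \<le> y"
        using d\<psi>[of x] assms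
        by (intro exI[of _ "(\<nu>\<^sup>2 - 1) * sinh (\<nu> * x) * sinh x"] conjI mult_nonneg_nonneg) auto
    qed
    then show ?thesis by (simp add: \<psi>_def)
  qed
  have "sinh (\<nu> * u) / sinh u \<le> sinh (\<nu> * v) / sinh v"
  proof (rule DERIV_nonneg_imp_nondecreasing[OF assms(3)])
    fix x :: real assume x: "u \<le> x" "x \<le> v"
    then have "sinh x > 0" using assms by simp
    then have "((\<lambda>t. sinh (\<nu> * t) / sinh t) has_real_derivative (\<psi> x / (sinh x)\<^sup>2)) (at x)"
      unfolding \<psi>_def
      by (auto intro!: derivative_eq_intros simp: algebra_simps power2_eq_square)
    moreover have "\<psi> x / (sinh x)\<^sup>2 \<ge> 0" using \<psi>[of x] x assms by simp
    ultimately show "\<exists>y. ((\<lambda>t. sinh (\<nu> * t) / sinh t) has_real_derivative y) (at x) \<and> 0 \<le> y"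
      by blast
  qed
  moreover have "sinh u > 0" "sinh v > 0" using assms by auto
  ultimately show ?thesis by (simp add: divide_simps mult.commute)
qed

lemma exp_diff_sinh: "exp t - exp s = 2 * exp ((s + t) / 2) * sinh ((t - s) / (2::real))"
  by (simp add: sinh_field_def algebra_simps flip: exp_add) (simp add: field_simps)

text \<open>In the logarithmic coordinate the exponential prefactors of numerator and denominator
  both have total exponent (p + q + r + s) / 2 and cancel.\<close>

lemma cr_exp:
  "cr (exp p) (exp q) (exp r) (exp s) =
    (sinh ((q - p) / 2) * sinh ((s - r) / 2)) / (sinh ((r - p) / 2) * sinh ((s - q) / 2))"
proof -
  have "2 * exp ((p + q) / 2) * (2 * exp ((r + s) / 2)) =
    2 * exp ((p + r) / 2) * (2 * exp ((q + s) / (2::real)))"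
    by (simp add: field_simps flip: exp_add)
  then have *: "(exp q - exp p) * (exp s - exp r) =
      (2 * exp ((p + r) / 2) * (2 * exp ((q + s) / 2))) * (sinh ((q - p) / 2) * sinh ((s - r) / 2))"
    "(exp r - exp p) * (exp s - exp q) =
      (2 * exp ((p + r) / 2) * (2 * exp ((q + s) / 2))) * (sinh ((r - p) / 2) * sinh ((s - q) / 2))"
    unfolding exp_diff_sinh[of q p] exp_diff_sinh[of s r] exp_diff_sinh[of r p] exp_diff_sinh[of s q]
    by (simp_all add: algebra_simps)
  show ?thesis unfolding cr_def * by simp
qed

text \<open>In the logarithmic coordinate the power map is multiplication by \<open>\<nu>\<close>.
  The cross-ratio is thus multiplied by a quotient of values of the increasing function G, taken at
  half the logarithmic lengths of L and R above and of their unions with M below.\<close>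

lemma cr_powr_pos:
  fixes \<nu> :: real
  assumes "\<nu> \<ge> 1" "0 < a" "a \<le> b" "b < c" "c \<le> d"
  shows "cr (a powr \<nu>) (b powr \<nu>) (c powr \<nu>) (d powr \<nu>) \<le> cr a b c d"
proof (cases "a = b \<or> c = d")
  case True then show ?thesis by (auto simp: cr_def)
next
  case False
  define p q r s where "p = ln a" "q = ln b" "r = ln c" "s = ln d"
  have o: "p < q" "q < r" "r < s" using assms False unfolding p_q_r_s_def by auto
  have e: "a = exp p" "b = exp q" "c = exp r" "d = exp s"
    using assms unfolding p_q_r_s_def by auto
  define G where "G = (\<lambda>u. sinh (\<nu> * u) / sinh u)"
  have G: "G u \<le> G v" if "0 < u" "u \<le> v" for u v
    using sinh_ratio_mono[OF assms(1) that] that unfolding G_def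
    by (simp add: divide_simps mult.commute)
  have Gpos: "G u > 0" if "0 < u" for u
    using that assms unfolding G_def by auto
  have sG: "sinh (\<nu> * u) = G u * sinh u" if "0 < u" for u
    using that unfolding G_def by simp
  have sn: "sinh ((\<nu> * x - \<nu> * y) / 2) = G ((x - y) / 2) * sinh ((x - y) / 2)" if "y < x" for x y
    using sG[of "(x - y) / 2"] that by (simp add: right_diff_distrib)
  have "cr (a powr \<nu>) (b powr \<nu>) (c powr \<nu>) (d powr \<nu>) =
     (G ((q - p) / 2) * G ((s - r) / 2)) / (G ((r - p) / 2) * G ((s - q) / 2)) * cr a b c d"
    unfolding e exp_powr_real mult.commute[of _ \<nu>] cr_exp using o by (simp add: sn ac_simps)
  moreover have "(G ((q - p) / 2) * G ((s - r) / 2)) / (G ((r - p) / 2) * G ((s - q) / 2)) \<le> 1"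
    using o Gpos by (simp add: divide_le_eq_1) (intro disjI1 conjI mult_pos_pos mult_mono G; simp add: less_imp_le)
  moreover have "cr a b c d \<ge> 0" using assms by (intro cr_nonneg) auto
  ultimately show ?thesis
    by (metis mult_left_le_one_le mult_right_mono mult_1)
qed

text \<open>The critical point \<open>a = 0\<close> has no logarithm and is reached by a limit from
  the right.\<close>

lemma cr_powr:
  fixes \<nu> :: real
  assumes \<nu>: "\<nu> \<ge> 1" and o: "0 \<le> a" "a \<le> b" "b < c" "c \<le> d"
  shows "cr (a powr \<nu>) (b powr \<nu>) (c powr \<nu>) (d powr \<nu>) \<le> cr a b c d"
proof (cases "a = b \<or> 0 < a")
  case True then show ?thesis using cr_powr_pos[OF \<nu> _ o(2-4)] by (auto simp: cr_def)
next
  case False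
  then have a: "a = 0" "0 < b" using o by auto
  have pw: "x powr \<nu> < y powr \<nu>" if "0 \<le> x" "x < y" for x y
    using that \<nu> by (intro powr_less_mono2) auto
  have l0: "((\<lambda>t. t powr \<nu>) \<longlongrightarrow> 0 powr \<nu>) (at_right 0)"
    using \<nu> by (intro tendsto_powr2 tendsto_intros) (auto simp: eventually_at_filter)
  have "((\<lambda>t. cr (t powr \<nu>) (b powr \<nu>) (c powr \<nu>) (d powr \<nu>)) \<longlongrightarrow>
      cr (0 powr \<nu>) (b powr \<nu>) (c powr \<nu>) (d powr \<nu>)) (at_right 0)"
    unfolding cr_def using pw[of 0 c] pw[of b d] a o
    by (intro tendsto_divide tendsto_mult tendsto_diff tendsto_const l0) auto
  moreover have "((\<lambda>t. cr t b c d) \<longlongrightarrow> cr 0 b c d) (at_right 0)"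
    unfolding cr_def using a o by (intro tendsto_intros) auto
  moreover have "\<forall>\<^sub>F t in at_right 0. cr (t powr \<nu>) (b powr \<nu>) (c powr \<nu>) (d powr \<nu>) \<le> cr t b c d"
    using eventually_at_right_less[of 0] eventually_at_right_real[OF a(2)]
    by eventually_elim (use \<nu> o in \<open>auto intro!: cr_powr_pos\<close>)
  ultimately show ?thesis unfolding a by (intro tendsto_le[OF _ _ _]) auto
qed

section \<open>Distortion of smooth diffeomorphisms\<close>

lemma cr_distortion_log_lipschitz:
  fixes g g' :: "real \<Rightarrow> real"
  assumes d: "\<And>x. x \<in> {u..v} \<Longrightarrow> (g has_real_derivative g' x) (at x)"
    and pos: "\<And>x. x \<in> {u..v} \<Longrightarrow> 0 < g' x"
    and lip: "\<And>x y. x \<in> {u..v} \<Longrightarrow> y \<in> {u..v} \<Longrightarrow> g' x \<le> exp (C * \<bar>x - y\<bar>) * g' y"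
    and "C \<ge> 0"
  shows "cr_distortion g {u..v} (2 * C)"
  unfolding cr_distortion_def
proof (intro ballI impI)
  fix a b c e assume S: "a \<in> {u..v}" "b \<in> {u..v}" "c \<in> {u..v}" "e \<in> {u..v}"
    and o: "a \<le> b \<and> b < c \<and> c \<le> e"
  have mvt: "\<exists>z. x \<le> z \<and> z \<le> y \<and> g y - g x = g' z * (y - x)" if "u \<le> x" "x \<le> y" "y \<le> v" for x y
  proof (cases "x = y")
    case True then show ?thesis by auto
  next
    case False
    then have "x < y" using that by simp
    from MVT2[OF this, of g g'] d that obtain z where "x < z" "z < y" "g y - g x = (y - x) * g' z"
      by (metis atLeastAtMost_iff order_trans)
    then show ?thesis by (intro exI[of _ z]) auto
  qed
  obtain z1 where z1: "a \<le> z1" "z1 \<le> b" "g b - g a = g' z1 * (b - a)" using mvt[of a b] S o by auto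
  obtain z2 where z2: "c \<le> z2" "z2 \<le> e" "g e - g c = g' z2 * (e - c)" using mvt[of c e] S o by auto
  obtain z3 where z3: "a \<le> z3" "z3 \<le> c" "g c - g a = g' z3 * (c - a)" using mvt[of a c] S o by auto
  obtain z4 where z4: "b \<le> z4" "z4 \<le> e" "g e - g b = g' z4 * (e - b)" using mvt[of b e] S o by auto
  have bd: "g' x / g' y \<le> exp (C * (e - a))" if "a \<le> x" "x \<le> e" "a \<le> y" "y \<le> e" for x y
  proof -
    have "g' x \<le> exp (C * \<bar>x - y\<bar>) * g' y" using that S by (intro lip) auto
    also have "\<dots> \<le> exp (C * (e - a)) * g' y"
      using that S pos[of y] \<open>C \<ge> 0\<close> by (intro mult_right_mono) (auto intro!: mult_left_mono)
    finally show ?thesis using pos[of y] that S by (simp add: divide_le_eq)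
  qed
  have P: "0 < g' z1" "0 < g' z2" "0 < g' z3" "0 < g' z4"
    using z1 z2 z3 z4 S o by (auto intro!: pos)
  \<comment> \<open>The four mean values pair into two quotients of derivatives at points at most
    \<open>e - a\<close> apart; each costs one factor \<open>exp (C * (e - a))\<close>, whence the 2
    in the statement.\<close>
  have "cr (g a) (g b) (g c) (g e) = (g' z1 / g' z3) * (g' z2 / g' z4) * cr a b c e"
    unfolding cr_def z1(3) z2(3) z3(3) z4(3) by (simp add: ac_simps)
  also have "\<dots> \<le> (exp (C * (e - a)) * exp (C * (e - a))) * cr a b c e"
    using z1 z2 z3 z4 P S o
    by (intro mult_right_mono mult_mono bd cr_nonneg) (auto intro: order_trans)
  also have "exp (C * (e - a)) * exp (C * (e - a)) = exp (2 * C * (e - a))"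
    by (simp flip: exp_add)
  finally show "cr (g a) (g b) (g c) (g e) \<le> exp (2 * C * (e - a)) * cr a b c e" .
qed

text \<open>The inverse is differentiable, so the derivative has no zero and is bounded away from 0
  on a compact interval. A Lipschitz constant of the derivative divided by that lower bound serves
  for its logarithm. Absolute values are taken because the orientation of \<open>g\<close> is not
  prescribed.\<close>

lemma C2_diffeo_derivative:
  assumes "C2_diffeo_on g S" "{u..v} \<subseteq> S"
  obtains g' C m M where "C \<ge> 0" "0 < m"
    "\<And>x. x \<in> {u..v} \<Longrightarrow> (g has_real_derivative g' x) (at x)"
    "\<And>x. x \<in> {u..v} \<Longrightarrow> m \<le> \<bar>g' x\<bar> \<and> \<bar>g' x\<bar> \<le> M"
    "\<And>x y. x \<in> {u..v} \<Longrightarrow> y \<in> {u..v} \<Longrightarrow> \<bar>g' x\<bar> \<le> exp (C * \<bar>x - y\<bar>) * \<bar>g' y\<bar>"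
proof (cases "u \<le> v")
  case False
  then show ?thesis using that[of 0 1] by auto
next
  case True
  from assms(1) have inj: "inj_on g S" and "open S" and opg: "open (g ` S)"
    and C2: "C2_on g S" "C2_on (the_inv_into S g) (g ` S)"
    unfolding C2_diffeo_on_def by auto
  obtain g' g'' where g': "\<And>x. x \<in> S \<Longrightarrow> (g has_real_derivative g' x) (at x)"
    and g'': "\<And>x. x \<in> S \<Longrightarrow> (g' has_real_derivative g'' x) (at x)" "continuous_on S g''"
    using C2(1) unfolding C2_on_def by blast
  obtain k' where k': "\<And>y. y \<in> g ` S \<Longrightarrow> (the_inv_into S g has_real_derivative k' y) (at y)"
    using C2(2) unfolding C2_on_def by blast
  have nz: "g' x \<noteq> 0" if "x \<in> S" for x
  proof -
    have "(the_inv_into S g \<circ> g has_real_derivative k' (g x) * g' x) (at x)"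
      using k' g' that by (intro DERIV_chain) auto
    moreover have "(the_inv_into S g \<circ> g has_real_derivative 1) (at x)"
    proof (rule has_field_derivative_transform_within_open[of "\<lambda>x. x" _ _ S])
      show "((\<lambda>x. x) has_real_derivative 1) (at x)" by simp
    qed (use \<open>open S\<close> that inj in \<open>auto simp: the_inv_into_f_f\<close>)
    ultimately have "k' (g x) * g' x = 1" by (rule DERIV_unique)
    then show ?thesis by auto
  qed
  have dg': "(g' has_real_derivative g'' x) (at x within {u..v})" if "x \<in> {u..v}" for x
    using g''(1) that assms(2) by (meson has_field_derivative_at_within subsetD)
  then have cg': "continuous_on {u..v} (\<lambda>x. \<bar>g' x\<bar>)"
    by (intro continuous_intros DERIV_continuous_on)
  have ne: "{u..v} \<noteq> {}" using True by auto
  obtain x0 where x0: "x0 \<in> {u..v}" "\<forall>y\<in>{u..v}. \<bar>g' x0\<bar> \<le> \<bar>g' y\<bar>"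
    using continuous_attains_inf[OF compact_Icc ne cg'] by auto
  obtain x1 where x1: "x1 \<in> {u..v}" "\<forall>y\<in>{u..v}. \<bar>g' y\<bar> \<le> \<bar>g' x1\<bar>"
    using continuous_attains_sup[OF compact_Icc ne cg'] by auto
  have cg'': "continuous_on {u..v} (\<lambda>x. \<bar>g'' x\<bar>)"
    using g''(2) assms(2) by (intro continuous_intros) (rule continuous_on_subset)
  obtain x2 where x2: "x2 \<in> {u..v}" "\<forall>y\<in>{u..v}. \<bar>g'' y\<bar> \<le> \<bar>g'' x2\<bar>"
    using continuous_attains_sup[OF compact_Icc ne cg''] by auto
  define m where "m = \<bar>g' x0\<bar>"
  define B where "B = \<bar>g'' x2\<bar>"
  have m: "m > 0" using nz x0 assms(2) unfolding m_def by auto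
  have lip: "\<bar>g' x - g' y\<bar> \<le> B * \<bar>x - y\<bar>" if "x \<in> {u..v}" "y \<in> {u..v}" for x y
  proof -
    have "norm (g' x - g' y) \<le> B * norm (x - y)"
    proof (rule field_differentiable_bound[of "{u..v}" g' g''])
      show "(g' has_field_derivative g'' z) (at z within {u..v})" if "z \<in> {u..v}" for z
        using dg' that .
      show "norm (g'' z) \<le> B" if "z \<in> {u..v}" for z using x2 that unfolding B_def by auto
    qed (use that in auto)
    then show ?thesis by simp
  qed
  have ll: "\<bar>g' x\<bar> \<le> exp ((B / m) * \<bar>x - y\<bar>) * \<bar>g' y\<bar>" if "x \<in> {u..v}" "y \<in> {u..v}" for x y
  proof -
    have my: "m \<le> \<bar>g' y\<bar>" using x0 that unfolding m_def by auto
    have "\<bar>g' x\<bar> \<le> \<bar>g' y\<bar> + B * \<bar>x - y\<bar>" using lip[OF that] by linarith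
    also have "B * \<bar>x - y\<bar> \<le> (B * \<bar>x - y\<bar>) * (\<bar>g' y\<bar> / m)"
      using my m mult_left_mono[of 1 "\<bar>g' y\<bar> / m" "B * \<bar>x - y\<bar>"] by (auto simp: B_def)
    also have "\<bar>g' y\<bar> + (B * \<bar>x - y\<bar>) * (\<bar>g' y\<bar> / m) = (1 + (B / m) * \<bar>x - y\<bar>) * \<bar>g' y\<bar>"
      by (simp add: algebra_simps)
    also have "\<dots> \<le> exp ((B / m) * \<bar>x - y\<bar>) * \<bar>g' y\<bar>"
      by (intro mult_right_mono exp_ge_add_one_self) auto
    finally show ?thesis by simp
  qed
  show ?thesis
    by (rule that[of "B / m" m g' "\<bar>g' x1\<bar>"]) (use m x0 x1 ll g' assms(2) in \<open>auto simp: B_def m_def\<close>)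
qed

text \<open>This fixes the orientation of the local diffeomorphisms at the ends of the flat spot. At
  an endpoint monotonicity is known on one side only, so the comparison point is taken inside the
  interval.\<close>

lemma derivative_nonneg_of_mono_on:
  fixes g :: "real \<Rightarrow> real"
  assumes "mono_on {u..v} g" "u < v" "x \<in> {u..v}" "(g has_real_derivative D) (at x)"
  shows "D \<ge> 0"
proof (rule ccontr)
  assume "\<not> D \<ge> 0"
  then have neg: "D < 0" by simp
  show False
  proof (cases "x = v")
    case True
    obtain d where d: "d > 0" "\<And>h. h > 0 \<Longrightarrow> h < d \<Longrightarrow> g x < g (x - h)"
      using DERIV_neg_dec_left[OF assms(4) neg] by blast
    define h where "h = min (d / 2) (v - u)"
    have "h > 0" "h < d" "x - h \<in> {u..v}" using d assms True unfolding h_def by auto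
    then have "g (x - h) \<le> g x" using assms by (intro mono_onD[OF assms(1)]) auto
    with d(2)[of h] \<open>h > 0\<close> \<open>h < d\<close> show False by simp
  next
    case False
    obtain d where d: "d > 0" "\<And>h. h > 0 \<Longrightarrow> h < d \<Longrightarrow> g (x + h) < g x"
      using DERIV_neg_dec_right[OF assms(4) neg] by blast
    define h where "h = min (d / 2) (v - x)"
    have "h > 0" "h < d" "x + h \<in> {u..v}" using d assms False unfolding h_def by auto
    then have "g x \<le> g (x + h)" using assms by (intro mono_onD[OF assms(1)]) auto
    with d(2)[of h] \<open>h > 0\<close> \<open>h < d\<close> show False by simp
  qed
qed

section \<open>The lift near an endpoint of the flat spot\<close>

lemma powr_diff_le:
  fixes \<nu> :: real
  assumes "\<nu> \<ge> 1" "0 \<le> s" "s \<le> t" "t \<le> 1"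
  shows "t powr \<nu> - s powr \<nu> \<le> \<nu> * (t - s)"
proof (cases "s = t")
  case False
  then have "s < t" using assms by simp
  have cont: "continuous_on {s..t} (\<lambda>x. x powr \<nu>)"
    using assms by (intro continuous_on_powr' continuous_intros) auto
  have der: "((\<lambda>x. x powr \<nu>) has_derivative (\<lambda>h. \<nu> * x powr (\<nu> - 1) * h)) (at x)"
    if "s < x" "x < t" for x
    using has_real_derivative_powr[of x \<nu>] that assms(2) by (simp add: has_field_derivative_def)
  obtain z where z: "s < z" "z < t" "t powr \<nu> - s powr \<nu> = \<nu> * z powr (\<nu> - 1) * (t - s)"
    by (rule mvt[OF \<open>s < t\<close> cont der])
  have "z powr (\<nu> - 1) \<le> 1" using z assms by (intro powr_le1) auto
  then have "\<nu> * z powr (\<nu> - 1) \<le> \<nu> * 1" using assms by (intro mult_left_mono) auto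
  then have "\<nu> * z powr (\<nu> - 1) * (t - s) \<le> \<nu> * 1 * (t - s)"
    using assms by (intro mult_right_mono) auto
  with z show ?thesis by simp
qed simp

text \<open>The sign \<open>\<sigma>\<close> lets one lemma serve both ends: the left end is treated
  by passing to the map x to - f (- x), whose local form is the given diffeomorphism times -1. The
  distortion bound is for short intervals, the power bounds on the derivative are for
  \<open>doubling\<close>.\<close>

lemma near_critical_point:
  fixes f H0 :: "real \<Rightarrow> real" and \<nu> \<sigma> :: real
  assumes \<nu>: "\<nu> \<ge> 1" and H0: "C2_diffeo_on H0 {-e<..<e}" "e > 0" and \<sigma>: "\<bar>\<sigma>\<bar> = 1"
    and ev0: "\<forall>\<^sub>F x in at_right b. f x = \<sigma> * H0 ((x - b) powr \<nu>)"
    and f: "continuous_on UNIV f" "mono f"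
  obtains \<epsilon> C m M where "\<epsilon> > 0" "C \<ge> 0" "0 < m" "cr_distortion f {b..b+\<epsilon>} C"
    "\<And>x. x \<in> {b<..<b+\<epsilon>} \<Longrightarrow> \<exists>D. (f has_real_derivative D) (at x) \<and>
        m * (x - b) powr (\<nu> - 1) \<le> D \<and> D \<le> M * (x - b) powr (\<nu> - 1)"
proof -
  define H where "H = (\<lambda>t. \<sigma> * H0 t)"
  have ev: "\<forall>\<^sub>F x in at_right b. f x = H ((x - b) powr \<nu>)"
    using ev0 by (simp add: H_def)
  obtain b' where b': "b' > b" "\<And>x. b < x \<Longrightarrow> x < b' \<Longrightarrow> f x = H ((x - b) powr \<nu>)"
    using ev unfolding eventually_at_right_field by blast
  \<comment> \<open>With \<open>\<epsilon> \<le> 1\<close> the power \<open>E\<close> is at most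
    \<open>\<epsilon>\<close>, hence below \<open>e\<close> and inside the domain of
    \<open>H0\<close>; moreover the power map is \<open>\<nu>\<close>-Lipschitz on the unit
    interval.\<close>
  define \<epsilon> where "\<epsilon> = min ((b' - b) / 2) (min 1 (e / 2))"
  define E where "E = \<epsilon> powr \<nu>"
  have \<epsilon>: "\<epsilon> > 0" "\<epsilon> \<le> 1" "b + \<epsilon> < b'" "\<epsilon> \<le> e / 2"
    using b' H0(2) unfolding \<epsilon>_def by (auto simp: min_def field_simps)
  have E: "0 < E" "E < e"
    using powr_mono'[of 1 \<nu> \<epsilon>] \<nu> \<epsilon> H0(2) unfolding E_def by auto
  have sub: "{0..E} \<subseteq> {-e<..<e}" using E H0(2) by auto
  obtain H0' c m M where c: "c \<ge> 0" "0 < m"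
    and dH0: "\<And>x. x \<in> {0..E} \<Longrightarrow> (H0 has_real_derivative H0' x) (at x)"
    and bd0: "\<And>x. x \<in> {0..E} \<Longrightarrow> m \<le> \<bar>H0' x\<bar> \<and> \<bar>H0' x\<bar> \<le> M"
    and ll0: "\<And>x y. x \<in> {0..E} \<Longrightarrow> y \<in> {0..E} \<Longrightarrow> \<bar>H0' x\<bar> \<le> exp (c * \<bar>x - y\<bar>) * \<bar>H0' y\<bar>"
    by (rule C2_diffeo_derivative[OF H0(1) sub], rule that)
  define H' where "H' = (\<lambda>t. \<sigma> * H0' t)"
  have dH: "(H has_real_derivative H' x) (at x)" if "x \<in> {0..E}" for x
    unfolding H_def H'_def using dH0[OF that] by (rule DERIV_cmult)
  have abs: "\<bar>H' x\<bar> = \<bar>H0' x\<bar>" for x using \<sigma> by (simp add: H'_def abs_mult)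
  note bd = bd0[folded abs] and ll = ll0[folded abs]
  \<comment> \<open>The local form is given strictly to the right of \<open>b\<close>; at
    \<open>b\<close> it holds by continuity.\<close>
  have fb: "f b = H 0"
  proof (rule tendsto_unique[of "at_right b"])
    show "(f \<longlongrightarrow> f b) (at_right b)"
      using f(1) by (simp add: continuous_on_def filterlim_at_split)
    have "isCont H 0" using dH[of 0] E by (auto intro: DERIV_isCont)
    moreover have "((\<lambda>x. (x - b) powr \<nu>) \<longlongrightarrow> (b - b) powr \<nu>) (at_right b)"
      using \<nu> by (intro tendsto_powr2 tendsto_intros) (auto simp: eventually_at_filter)
    ultimately have "((\<lambda>x. H ((x - b) powr \<nu>)) \<longlongrightarrow> H 0) (at_right b)"
      by (intro isCont_tendsto_compose[of 0 H]) auto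
    then show "(f \<longlongrightarrow> H 0) (at_right b)"
      by (rule Lim_transform_eventually) (use ev in eventually_elim, simp)
  qed auto
  have feq: "f x = H ((x - b) powr \<nu>)" if "x \<in> {b..b+\<epsilon>}" for x
    using that fb b'(2)[of x] \<epsilon> by (cases "x = b") auto
  have inE: "(x - b) powr \<nu> \<in> {0..E}" if "x \<in> {b..b+\<epsilon>}" for x
    using that \<nu> unfolding E_def by (auto intro!: powr_mono2)
  have root: "\<exists>x\<in>{b..b+\<epsilon>}. t = (x - b) powr \<nu>" if "t \<in> {0..E}" for t
  proof (intro bexI)
    show "t = (b + t powr (1/\<nu>) - b) powr \<nu>" using \<nu> that by (simp add: powr_powr)
    have "t powr (1 / \<nu>) \<le> E powr (1 / \<nu>)" using \<nu> that by (intro powr_mono2) auto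
    also have "\<dots> = \<epsilon>" using \<nu> \<epsilon> unfolding E_def by (simp add: powr_powr)
    finally show "b + t powr (1 / \<nu>) \<in> {b..b+\<epsilon>}" by simp
  qed
  \<comment> \<open>By \<open>root\<close> the powers of the distances to \<open>b\<close> fill
    \<open>{0..E}\<close>, so that \<open>H\<close> inherits monotonicity from \<open>f\<close>; as
    its derivative has no zero, it is positive.\<close>
  have "mono_on {0..E} H"
  proof (rule mono_onI)
    fix s t assume st: "s \<in> {0..E}" "t \<in> {0..E}" "s \<le> t"
    obtain x y where xy: "x \<in> {b..b+\<epsilon>}" "s = (x - b) powr \<nu>" "y \<in> {b..b+\<epsilon>}" "t = (y - b) powr \<nu>"
      using root st by blast
    have "x \<le> y"
    proof (rule ccontr)
      assume "\<not> x \<le> y"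
      then have "(y - b) powr \<nu> < (x - b) powr \<nu>" using xy \<nu> by (intro powr_less_mono2) auto
      then show False using st xy by simp
    qed
    then show "H s \<le> H t" using feq xy f(2) by (metis monoD)
  qed
  then have pos: "H' x > 0" if "x \<in> {0..E}" for x
    using derivative_nonneg_of_mono_on[of 0 E H x "H' x"] dH[OF that] bd[OF that] c E that by auto
  have ll': "H' x \<le> exp (c * \<bar>x - y\<bar>) * H' y" if "x \<in> {0..E}" "y \<in> {0..E}" for x y
    using ll[OF that] pos[OF that(1)] pos[OF that(2)] by simp
  have crH: "cr_distortion H {0..E} (2 * c)"
    using cr_distortion_log_lipschitz[OF dH pos ll' c(1)] .
  have "cr_distortion f {b..b+\<epsilon>} (2 * c * \<nu>)"
    unfolding cr_distortion_def
  proof (intro ballI impI)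
    fix p q r s assume S: "p \<in> {b..b+\<epsilon>}" "q \<in> {b..b+\<epsilon>}" "r \<in> {b..b+\<epsilon>}" "s \<in> {b..b+\<epsilon>}"
      and o: "p \<le> q \<and> q < r \<and> r \<le> s"
    define p' q' r' s' where "p' = p - b" "q' = q - b" "r' = r - b" "s' = s - b"
    note d = p'_q'_r'_s'_def
    have cc: "cr p q r s = cr p' q' r' s'" unfolding d by (simp add: cr_def)
    have "cr (f p) (f q) (f r) (f s) \<le> exp (2 * c * (s' powr \<nu> - p' powr \<nu>)) *
        cr (p' powr \<nu>) (q' powr \<nu>) (r' powr \<nu>) (s' powr \<nu>)"
      unfolding feq[OF S(1)] feq[OF S(2)] feq[OF S(3)] feq[OF S(4)] d
      using inE S o \<nu> by (intro cr_distortionD[OF crH]) (auto intro!: powr_mono2 powr_less_mono2)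
    also have "\<dots> \<le> exp (2 * c * \<nu> * (s - p)) * cr p q r s"
    proof (intro mult_mono)
      have "s' powr \<nu> - p' powr \<nu> \<le> \<nu> * (s' - p')"
        using S o \<nu> \<epsilon> unfolding d by (intro powr_diff_le) auto
      then have "2 * c * (s' powr \<nu> - p' powr \<nu>) \<le> 2 * c * (\<nu> * (s' - p'))"
        using c by (intro mult_left_mono) auto
      then show "exp (2 * c * (s' powr \<nu> - p' powr \<nu>)) \<le> exp (2 * c * \<nu> * (s - p))"
        unfolding d by (simp add: mult.assoc)
      show "cr (p' powr \<nu>) (q' powr \<nu>) (r' powr \<nu>) (s' powr \<nu>) \<le> cr p q r s"
        unfolding cc using S o \<nu> unfolding d by (intro cr_powr) auto
      show "0 \<le> cr (p' powr \<nu>) (q' powr \<nu>) (r' powr \<nu>) (s' powr \<nu>)"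
        using S o \<nu> unfolding d by (intro cr_nonneg) (auto intro!: powr_mono2)
    qed auto
    finally show "cr (f p) (f q) (f r) (f s) \<le> exp (2 * c * \<nu> * (s - p)) * cr p q r s" .
  qed
  moreover have "\<exists>D. (f has_real_derivative D) (at x) \<and>
        m * (x - b) powr (\<nu> - 1) \<le> D \<and> D \<le> (M * \<nu>) * (x - b) powr (\<nu> - 1)"
    if x: "x \<in> {b<..<b+\<epsilon>}" for x
  proof (intro exI conjI)
    define t where "t = (x - b) powr \<nu>"
    have t: "t \<in> {0..E}" unfolding t_def using inE x by auto
    have "((\<lambda>x. H ((x - b) powr \<nu>)) has_real_derivative H' t * (\<nu> * (x - b) powr (\<nu> - 1))) (at x)"
      unfolding t_def
    proof (rule DERIV_chain2[of H])
      show "(H has_real_derivative H' ((x - b) powr \<nu>)) (at ((x - b) powr \<nu>))"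
        using dH t unfolding t_def by auto
      show "((\<lambda>x. (x - b) powr \<nu>) has_real_derivative \<nu> * (x - b) powr (\<nu> - 1)) (at x)"
        using x by (auto intro!: derivative_eq_intros)
    qed
    then show "(f has_real_derivative H' t * (\<nu> * (x - b) powr (\<nu> - 1))) (at x)"
      by (rule has_field_derivative_transform_within_open[of _ _ _ "{b<..<b+\<epsilon>}"])
         (use x feq in auto)
    have B: "m \<le> H' t" "H' t \<le> M" using bd[OF t] pos[OF t] by auto
    have "m * 1 \<le> H' t * \<nu>" using B c \<nu> by (intro mult_mono) auto
    then have "m * (x - b) powr (\<nu> - 1) \<le> (H' t * \<nu>) * (x - b) powr (\<nu> - 1)"
      by (intro mult_right_mono) auto
    then show "m * (x - b) powr (\<nu> - 1) \<le> H' t * (\<nu> * (x - b) powr (\<nu> - 1))"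
      by (simp add: mult.assoc)
    have "H' t * \<nu> \<le> M * \<nu>" using B \<nu> by (intro mult_right_mono) auto
    then have "(H' t * \<nu>) * (x - b) powr (\<nu> - 1) \<le> (M * \<nu>) * (x - b) powr (\<nu> - 1)"
      by (rule mult_right_mono) auto
    then show "H' t * (\<nu> * (x - b) powr (\<nu> - 1)) \<le> (M * \<nu>) * (x - b) powr (\<nu> - 1)"
      by (simp add: mult.assoc)
  qed
  ultimately show ?thesis
    using that[of \<epsilon> "2 * c * \<nu>" m "M * \<nu>"] \<epsilon>(1) c \<nu> by auto
qed

text \<open>This carries the estimate for the reflected map near \<open>-a\<close> to
  \<open>f\<close> near \<open>a + 1\<close>.\<close>

lemma cr_distortion_reflect:
  assumes "cr_distortion g S C" "\<And>y. y \<in> T \<Longrightarrow> 1 - y \<in> S" "\<And>y. y \<in> T \<Longrightarrow> f y = 1 - g (1 - y)"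
  shows "cr_distortion f T C"
  unfolding cr_distortion_def
proof (intro ballI impI)
  fix p q r s assume S: "p \<in> T" "q \<in> T" "r \<in> T" "s \<in> T" and o: "p \<le> q \<and> q < r \<and> r \<le> s"
  have refl: "cr (1 - s') (1 - r') (1 - q') (1 - p') = cr p' q' r' s'" for p' q' r' s'
    using cr_uminus[of s' r' q' p'] cr_add[of "-s'" 1 "-r'" "-q'" "-p'"] by simp
  have "cr (f p) (f q) (f r) (f s) = cr (g (1 - s)) (g (1 - r)) (g (1 - q)) (g (1 - p))"
    by (simp add: assms(3) S refl)
  also have "\<dots> \<le> exp (C * ((1 - p) - (1 - s))) * cr (1 - s) (1 - r) (1 - q) (1 - p)"
    using S o by (intro cr_distortionD[OF assms(1)] assms(2)) auto
  finally show "cr (f p) (f q) (f r) (f s) \<le> exp (C * (s - p)) * cr p q r s"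
    by (simp add: refl)
qed

lemma cr_distortion_weaken:
  assumes "cr_distortion g S C" "C \<le> C'"
  shows "cr_distortion g S C'"
  unfolding cr_distortion_def
proof (intro ballI impI)
  fix p q r s assume S: "p \<in> S" "q \<in> S" "r \<in> S" "s \<in> S" and o: "p \<le> q \<and> q < r \<and> r \<le> s"
  have "cr (g p) (g q) (g r) (g s) \<le> exp (C * (s - p)) * cr p q r s"
    using S o by (intro cr_distortionD[OF assms(1)]) auto
  also have "\<dots> \<le> exp (C' * (s - p)) * cr p q r s"
    using o assms(2) by (intro mult_right_mono cr_nonneg) (auto intro!: mult_right_mono)
  finally show "cr (g p) (g q) (g r) (g s) \<le> exp (C' * (s - p)) * cr p q r s" .
qed

text \<open>If the derivative is comparable to a power of the distance to the boundary, then the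
  midpoints between \<open>J\<close> and a given point of \<open>J\<close> form half of \<open>J\<close>, on which the derivative is
  bounded below by a multiple of its value at that point.\<close>

lemma doubling:
  fixes f :: "real \<Rightarrow> real"
  assumes f: "continuous_on UNIV f" "mono f" and \<nu>: "\<nu> \<ge> 1" and m: "0 < m"
    and df: "\<And>x. x \<in> {b<..<e} \<Longrightarrow> \<exists>D. (f has_real_derivative D) (at x) \<and>
        m * (min (x - b) (e - x)) powr (\<nu> - 1) \<le> D \<and> D \<le> M * (min (x - b) (e - x)) powr (\<nu> - 1)"
    and o: "b \<le> u" "u \<le> s" "s \<le> t" "t \<le> v" "v \<le> e"
  shows "(f t - f s) * (v - u) \<le> (M * 2 powr \<nu> / m) * (f v - f u) * (t - s)"
proof (cases "s < t")
  case False
  then show ?thesis using o by simp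
next
  case True
  define l where "l = (\<lambda>x. min (x - b) (e - x))"
  obtain D where D: "\<And>x. x \<in> {b<..<e} \<Longrightarrow> (f has_real_derivative D x) (at x)"
      "\<And>x. x \<in> {b<..<e} \<Longrightarrow> m * l x powr (\<nu> - 1) \<le> D x"
      "\<And>x. x \<in> {b<..<e} \<Longrightarrow> D x \<le> M * l x powr (\<nu> - 1)"
    using df unfolding l_def by metis
  have mvt': "\<exists>z. x < z \<and> z < y \<and> f y - f x = D z * (y - x)" if "b \<le> x" "x < y" "y \<le> e" for x y
  proof -
    have "continuous_on {x..y} f" using f(1) continuous_on_subset by blast
    moreover have "(f has_derivative (\<lambda>h. D z * h)) (at z)" if "x < z" "z < y" for z
      using D(1)[of z] that \<open>b \<le> x\<close> \<open>y \<le> e\<close> by (simp add: has_field_derivative_def)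
    ultimately show ?thesis by (metis mvt[OF \<open>x < y\<close>, of f "\<lambda>z h. D z * h"])
  qed
  obtain \<xi> where \<xi>: "s < \<xi>" "\<xi> < t" "f t - f s = D \<xi> * (t - s)"
    using mvt'[of s t] True o by auto
  obtain \<zeta> where \<zeta>: "(u + \<xi>) / 2 < \<zeta>" "\<zeta> < (v + \<xi>) / 2"
      "f ((v + \<xi>) / 2) - f ((u + \<xi>) / 2) = D \<zeta> * ((v + \<xi>) / 2 - (u + \<xi>) / 2)"
    using mvt'[of "(u + \<xi>) / 2" "(v + \<xi>) / 2"] \<xi> o by auto
  have in1: "\<xi> \<in> {b<..<e}" "\<zeta> \<in> {b<..<e}" using \<xi> \<zeta> o by auto
  \<comment> \<open>\<open>\<zeta>\<close> is the midpoint of \<open>\<xi>\<close> and a point of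
    \<open>{u..v}\<close>, so its distance to the boundary is at least half that of
    \<open>\<xi>\<close>. This gives \<open>2 powr (\<nu> - 1)\<close>; the remaining factor 2 comes
    from the halved length.\<close>
  have l\<xi>: "0 < l \<xi>" "l \<xi> / 2 \<le> l \<zeta>" using in1 \<zeta> o unfolding l_def by (auto simp: min_def)
  have Mpos: "M \<ge> 0"
  proof -
    have "0 \<le> m * l \<xi> powr (\<nu> - 1)" using m by simp
    also have "\<dots> \<le> M * l \<xi> powr (\<nu> - 1)" using D(2,3)[OF in1(1)] by simp
    finally show ?thesis using l\<xi>(1) by (simp add: zero_le_mult_iff)
  qed
  have a: "(l \<xi> / 2) powr (\<nu> - 1) \<le> l \<zeta> powr (\<nu> - 1)"
    using l\<xi> \<nu> by (intro powr_mono2) auto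
  have b: "l \<xi> powr (\<nu> - 1) = 2 powr (\<nu> - 1) * (l \<xi> / 2) powr (\<nu> - 1)"
    using l\<xi> by (simp add: powr_divide)
  have "D \<xi> \<le> M * l \<xi> powr (\<nu> - 1)" using D(3) in1 by simp
  also have "\<dots> \<le> M * (2 powr (\<nu> - 1) * l \<zeta> powr (\<nu> - 1))"
    unfolding b using a Mpos by (intro mult_left_mono) auto
  also have "\<dots> = (M * 2 powr (\<nu> - 1) / m) * (m * l \<zeta> powr (\<nu> - 1))" using m by simp
  also have "\<dots> \<le> (M * 2 powr (\<nu> - 1) / m) * D \<zeta>"
    using D(2)[OF in1(2)] Mpos m by (intro mult_left_mono) auto
  finally have 1: "D \<xi> \<le> (M * 2 powr (\<nu> - 1) / m) * D \<zeta>" .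
  have "D \<zeta> * (v - u) = 2 * (f ((v + \<xi>) / 2) - f ((u + \<xi>) / 2))"
    unfolding \<zeta>(3) by (simp add: field_simps)
  also have "\<dots> \<le> 2 * (f v - f u)"
  proof -
    have "f ((v + \<xi>) / 2) \<le> f v" "f u \<le> f ((u + \<xi>) / 2)"
      using \<xi> o by (auto intro!: monoD[OF f(2)])
    then show ?thesis by simp
  qed
  finally have 2: "D \<zeta> * (v - u) \<le> 2 * (f v - f u)" .
  have "(f t - f s) * (v - u) = D \<xi> * ((t - s) * (v - u))" unfolding \<xi>(3) by simp
  also have "\<dots> \<le> ((M * 2 powr (\<nu> - 1) / m) * D \<zeta>) * ((t - s) * (v - u))"
    using 1 o by (intro mult_right_mono) auto
  also have "\<dots> = (M * 2 powr (\<nu> - 1) / m) * (D \<zeta> * (v - u)) * (t - s)" by (simp add: mult_ac)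
  also have "\<dots> \<le> (M * 2 powr (\<nu> - 1) / m) * (2 * (f v - f u)) * (t - s)"
    using 2 Mpos m o by (intro mult_right_mono mult_left_mono) auto
  also have "\<dots> = (M * (2 powr (\<nu> - 1) * 2) / m) * (f v - f u) * (t - s)" by simp
  also have "2 powr (\<nu> - 1) * 2 = 2 powr \<nu>" using powr_add[of 2 "\<nu> - 1" 1] by simp
  finally show ?thesis .
qed

section \<open>Cross-ratio distortion of the lift\<close>

text \<open>Short and long intervals T need different reasons. A short T meets the flat spot only in
  parts of L and R, which are cut off; the rest lies in one of three overlapping charts, two with a
  power law and one where the derivative is bounded away from 0. For T of length at least
  \<open>\<eta>\<close> a bounded loss is affordable, since \<open>exp (C * \<eta>)\<close> becomes
  as large as desired with C; doubling bounds the loss in each factor by K.\<close>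

lemma cr_one_step:
  fixes f :: "real \<Rightarrow> real" and a b \<nu> :: real
  assumes \<nu>: "\<nu> \<ge> 1" and f: "continuous_on UNIV f" "mono f" "\<And>x. f (x + 1) = f x + 1"
    and ab: "a < b" "b < a + 1" "f a = f b"
    and C2: "C2_diffeo_on f {b<..<a + 1}"
    and R: "C2_diffeo_on Hr {-er<..<er}" "er > 0" "\<forall>\<^sub>F x in at_right b. f x = Hr ((x - b) powr \<nu>)"
    and L: "C2_diffeo_on Hl {-el<..<el}" "el > 0" "\<forall>\<^sub>F x in at_left a. f x = Hl ((a - x) powr \<nu>)"
  shows "\<exists>C\<ge>0. \<forall>\<alpha> \<beta> \<gamma> \<delta>. \<alpha> \<le> \<beta> \<and> b \<le> \<beta> \<and> \<beta> < \<gamma> \<and> \<gamma> \<le> a + 1 \<and> \<gamma> \<le> \<delta> \<longrightarrow>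
     f \<beta> < f \<gamma> \<and> cr (f \<alpha>) (f \<beta>) (f \<gamma>) (f \<delta>) \<le> exp (C * (\<delta> - \<alpha>)) * cr \<alpha> \<beta> \<gamma> \<delta>"
proof -
  define g where "g = (\<lambda>x. - f (- x))"
  have g: "continuous_on UNIV g" "mono g"
    unfolding g_def
    by (intro continuous_intros continuous_on_compose2[OF f(1)]; simp)
       (rule monoI, simp add: monoD[OF f(2)])
  have evg: "\<forall>\<^sub>F x in at_right (- a). g x = (-1) * Hl ((x - (- a)) powr \<nu>)"
    using L(3) unfolding at_left_minus[of a] eventually_filtermap g_def
    by eventually_elim (simp add: add.commute)
  have fg: "f y = 1 - g (1 - y)" for y using f(3)[of "y - 1"] by (simp add: g_def)
  obtain \<epsilon>1 C1 m1 M1 where 1: "\<epsilon>1 > 0" "C1 \<ge> 0" "0 < m1" "cr_distortion f {b..b+\<epsilon>1} C1"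
    and D1: "\<And>x. x \<in> {b<..<b+\<epsilon>1} \<Longrightarrow> \<exists>D. (f has_real_derivative D) (at x) \<and>
        m1 * (x - b) powr (\<nu> - 1) \<le> D \<and> D \<le> M1 * (x - b) powr (\<nu> - 1)"
    by (rule near_critical_point[OF \<nu> R(1,2) _ _ f(1,2), of 1 b]) (use R(3) in auto)
  obtain \<epsilon>2 C2 m2 M2 where 2: "\<epsilon>2 > 0" "C2 \<ge> 0" "0 < m2" "cr_distortion g {-a..-a+\<epsilon>2} C2"
    and D2: "\<And>x. x \<in> {-a<..<-a+\<epsilon>2} \<Longrightarrow> \<exists>D. (g has_real_derivative D) (at x) \<and>
        m2 * (x - (-a)) powr (\<nu> - 1) \<le> D \<and> D \<le> M2 * (x - (-a)) powr (\<nu> - 1)"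
    by (rule near_critical_point[OF \<nu> L(1,2) _ evg g]) auto
  \<comment> \<open>The bound by half the length of the complement decides on each end chart which
    endpoint is the nearer one.\<close>
  define \<epsilon> where "\<epsilon> = min (min \<epsilon>1 \<epsilon>2) ((a + 1 - b) / 2)"
  have "\<epsilon> \<le> (a + 1 - b) / 2" unfolding \<epsilon>_def by (rule min.cobounded2)
  moreover have "(a + 1 - b) / 2 < 1" using ab(1) by simp
  moreover have "\<epsilon> > 0" "\<epsilon> \<le> \<epsilon>1" "\<epsilon> \<le> \<epsilon>2" using 1 2 ab unfolding \<epsilon>_def by auto
  ultimately have \<epsilon>: "\<epsilon> > 0" "\<epsilon> \<le> \<epsilon>1" "\<epsilon> \<le> \<epsilon>2" "\<epsilon> \<le> (a + 1 - b) / 2" "\<epsilon> < 1" by linarith+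
  have sub: "{b + \<epsilon>/2..a + 1 - \<epsilon>/2} \<subseteq> {b<..<a+1}" using \<epsilon> by auto
  obtain g3 C3 m3 M3 where 3: "C3 \<ge> 0" "0 < m3"
    and D3: "\<And>x. x \<in> {b + \<epsilon>/2..a + 1 - \<epsilon>/2} \<Longrightarrow> (f has_real_derivative g3 x) (at x)"
    and B3: "\<And>x. x \<in> {b + \<epsilon>/2..a + 1 - \<epsilon>/2} \<Longrightarrow> m3 \<le> \<bar>g3 x\<bar> \<and> \<bar>g3 x\<bar> \<le> M3"
    and L3: "\<And>x y. x \<in> {b + \<epsilon>/2..a + 1 - \<epsilon>/2} \<Longrightarrow> y \<in> {b + \<epsilon>/2..a + 1 - \<epsilon>/2} \<Longrightarrow>
        \<bar>g3 x\<bar> \<le> exp (C3 * \<bar>x - y\<bar>) * \<bar>g3 y\<bar>"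
    by (rule C2_diffeo_derivative[OF C2 sub], rule that)
  have mf: "mono_on {b + \<epsilon>/2..a + 1 - \<epsilon>/2} f" by (rule mono_onI) (rule monoD[OF f(2)])
  have P3: "g3 x > 0" if "x \<in> {b + \<epsilon>/2..a + 1 - \<epsilon>/2}" for x
    using derivative_nonneg_of_mono_on[OF mf _ that D3[OF that]] B3[OF that] 3 \<epsilon> ab by auto
  have L3': "g3 x \<le> exp (C3 * \<bar>x - y\<bar>) * g3 y"
    if "x \<in> {b + \<epsilon>/2..a + 1 - \<epsilon>/2}" "y \<in> {b + \<epsilon>/2..a + 1 - \<epsilon>/2}" for x y
    using L3[OF that] P3[OF that(1)] P3[OF that(2)] by simp
  have cr3: "cr_distortion f {b + \<epsilon>/2..a + 1 - \<epsilon>/2} (2 * C3)"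
    using cr_distortion_log_lipschitz[OF D3 P3 L3' 3(1)] .
  have cr2: "cr_distortion f {a + 1 - \<epsilon>2..a + 1} C2"
    by (rule cr_distortion_reflect[OF 2(4)]) (auto simp: fg)
  define C where "C = max C1 (max C2 (2 * C3))"
  have cr: "cr_distortion f {b..b+\<epsilon>1} C" "cr_distortion f {a + 1 - \<epsilon>2..a + 1} C"
      "cr_distortion f {b + \<epsilon>/2..a + 1 - \<epsilon>/2} C"
    by (rule cr_distortion_weaken[OF 1(4)] cr_distortion_weaken[OF cr2] cr_distortion_weaken[OF cr3];
        simp add: C_def)+
  define m where "m = min m1 (min m2 m3)"
  \<comment> \<open>On the middle chart the power of the distance lies between
    \<open>(\<epsilon>/2) powr (\<nu> - 1)\<close> and 1, which converts the constant bounds on the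
    derivative into power bounds.\<close>
  define M where "M = max M1 (max M2 (M3 / (\<epsilon>/2) powr (\<nu> - 1)))"
  have mpos: "m > 0" using 1 2 3 unfolding m_def by auto
  have fstrict: "f \<beta> < f \<gamma>" if "b \<le> \<beta>" "\<beta> < \<gamma>" "\<gamma> \<le> a + 1" for \<beta> \<gamma>
  proof -
    define p q where "p = (2 * \<beta> + \<gamma>) / 3" "q = (\<beta> + 2 * \<gamma>) / 3"
    have pq: "\<beta> < p" "p < q" "q < \<gamma>" using that unfolding p_q_def by auto
    have "inj_on f {b<..<a+1}" using C2 unfolding C2_diffeo_on_def by auto
    moreover have "p \<in> {b<..<a+1}" "q \<in> {b<..<a+1}" using pq that by auto
    ultimately have "f p \<noteq> f q" using pq(2) by (metis inj_onD less_irrefl)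
    moreover have "f \<beta> \<le> f p" "f p \<le> f q" "f q \<le> f \<gamma>" using pq by (auto intro!: monoD[OF f(2)])
    ultimately show ?thesis by linarith
  qed
  have derB: "\<exists>D. (f has_real_derivative D) (at x) \<and>
        m * (min (x - b) (a + 1 - x)) powr (\<nu> - 1) \<le> D \<and> D \<le> M * (min (x - b) (a + 1 - x)) powr (\<nu> - 1)"
    if x: "x \<in> {b<..<a+1}" for x
  proof -
    define w where "w = (min (x - b) (a + 1 - x)) powr (\<nu> - 1)"
    have w0: "w \<ge> 0" unfolding w_def by simp
    have wk: "m * w \<le> m' * w" "M' * w \<le> M * w" if "m \<le> m'" "M' \<le> M" for m' M'
      using that w0 by (auto intro: mult_right_mono)
    consider "x < b + \<epsilon>" | "x > a + 1 - \<epsilon>" | "x \<in> {b + \<epsilon>/2..a + 1 - \<epsilon>/2}"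
      using \<epsilon> by fastforce
    then have "\<exists>D. (f has_real_derivative D) (at x) \<and> m * w \<le> D \<and> D \<le> M * w"
    proof cases
      case A: 1
      have w: "w = (x - b) powr (\<nu> - 1)" using A \<epsilon> unfolding w_def by (simp add: min_def)
      obtain D where "(f has_real_derivative D) (at x)" "m1 * w \<le> D" "D \<le> M1 * w"
        using D1[of x] A x \<epsilon> unfolding w by auto
      moreover have "m \<le> m1" "M1 \<le> M" unfolding m_def M_def by auto
      ultimately show ?thesis using wk[of m1 M1] by (intro exI[of _ D]) auto
    next
      case A: 2
      have w: "w = (a + 1 - x) powr (\<nu> - 1)" using A \<epsilon> unfolding w_def by (simp add: min_def)
      have eq: "1 - x - (- a) = a + 1 - x" by simp
      obtain D where D: "(g has_real_derivative D) (at (1 - x))" "m2 * w \<le> D" "D \<le> M2 * w"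
        using D2[of "1 - x", unfolded eq] A x \<epsilon> unfolding w by auto
      have "((\<lambda>y. 1 - g (1 - y)) has_real_derivative D) (at x)"
        using D(1) by (auto intro!: derivative_eq_intros DERIV_chain2[of g])
      then have "(f has_real_derivative D) (at x)" unfolding fg[symmetric] .
      moreover have "m \<le> m2" "M2 \<le> M" unfolding m_def M_def by auto
      ultimately show ?thesis using wk[of m2 M2] D by (intro exI[of _ D]) auto
    next
      case A: 3
      have l: "\<epsilon>/2 \<le> min (x - b) (a + 1 - x)" "min (x - b) (a + 1 - x) \<le> 1" using A ab by auto
      have w1: "w \<le> 1" unfolding w_def using l \<epsilon> \<nu> by (intro powr_le1) auto
      have w2: "(\<epsilon>/2) powr (\<nu> - 1) \<le> w" unfolding w_def using l \<epsilon> \<nu> by (intro powr_mono2) auto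
      have "M3 / (\<epsilon>/2) powr (\<nu> - 1) \<le> M" "m \<le> m3" unfolding M_def m_def by auto
      note k = wk[OF this(2,1)]
      have "m3 * w \<le> m3" using w1 3 by (simp add: mult_left_le)
      moreover have "M3 \<ge> 0" using B3[OF A] 3 by linarith
      have "M3 \<le> M3 * (w / (\<epsilon>/2) powr (\<nu> - 1))"
        using mult_left_mono[of 1 "w / (\<epsilon>/2) powr (\<nu> - 1)" M3] w2 \<epsilon> \<open>M3 \<ge> 0\<close> by simp
      then have "M3 \<le> M3 / (\<epsilon>/2) powr (\<nu> - 1) * w" by simp
      ultimately show ?thesis using k D3[OF A] B3[OF A] P3[OF A]
        by (intro exI[of _ "g3 x"]) auto
    qed
    then show ?thesis unfolding w_def .
  qed
  \<comment> \<open>The first entry is the doubling constant. The second covers an outer interval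
    that contains the whole flat spot: it is at least \<open>b - a\<close> long, while the middle
    interval has length at most 1, so its factor is at least
    \<open>(b - a) / (b - a + 1)\<close>.\<close>
  define K where "K = max (M * 2 powr \<nu> / m) ((b - a + 1) / (b - a))"
  have "(b - a + 1) / (b - a) \<ge> 1" using ab by simp
  then have K1: "K \<ge> 1" unfolding K_def by linarith
  have dbl: "(f t - f s) / (f v - f u) \<le> K * ((t - s) / (v - u))"
    if "b \<le> u" "u \<le> s" "s \<le> t" "t \<le> v" "v \<le> a + 1" "u < v" for u s t v
  proof -
    have fuv: "f u < f v" using fstrict that by auto
    have "(f t - f s) * (v - u) \<le> (M * 2 powr \<nu> / m) * (f v - f u) * (t - s)"
      by (rule doubling[OF f(1,2) \<nu> mpos derB that(1-5)])
    also have "\<dots> \<le> K * (f v - f u) * (t - s)"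
      using fuv that unfolding K_def by (intro mult_right_mono) auto
    finally show ?thesis using fuv that by (simp add: field_simps)
  qed
  have flat: "f x = f b" if "a \<le> x" "x \<le> b" for x
    using monoD[OF f(2) that(1)] monoD[OF f(2) that(2)] ab(3) by simp
  have flat': "f x = f (a + 1)" if "a + 1 \<le> x" "x \<le> b + 1" for x
    using flat[of "x - 1"] f(3)[of "x - 1"] f(3)[of a] ab(3) that by simp
  have Kfar: "1 \<le> K * (l / (l + m'))" if "l \<ge> b - a" "0 < m'" "m' \<le> 1" for l m'
  proof -
    have "(b - a) / (b - a + 1) \<le> (b - a) / (b - a + m')"
      using that ab by (intro divide_left_mono) auto
    also have "\<dots> \<le> l / (l + m')" using frac_mono_left[of "b - a" l m'] that ab by simp
    finally have "K * ((b - a) / (b - a + 1)) \<le> K * (l / (l + m'))"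
      using K1 by (intro mult_left_mono) auto
    moreover have "((b - a + 1) / (b - a)) * ((b - a) / (b - a + 1)) \<le> K * ((b - a) / (b - a + 1))"
      unfolding K_def using ab by (intro mult_right_mono) auto
    moreover have "((b - a + 1) / (b - a)) * ((b - a) / (b - a + 1)) = 1" using ab by simp
    ultimately show ?thesis by linarith
  qed
  have left: "(f \<beta> - f \<alpha>) / (f \<gamma> - f \<alpha>) \<le> K * ((\<beta> - \<alpha>) / (\<gamma> - \<alpha>))"
    if "\<alpha> \<le> \<beta>" "b \<le> \<beta>" "\<beta> < \<gamma>" "\<gamma> \<le> a + 1" for \<alpha> \<beta> \<gamma>
  proof -
    consider "b \<le> \<alpha>" | "a \<le> \<alpha>" "\<alpha> < b" | "\<alpha> < a" by linarith
    then show ?thesis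
    proof cases
      case 1 then show ?thesis using dbl[of \<alpha> \<alpha> \<beta> \<gamma>] that by auto
    next
      case 2
      have "(f \<beta> - f \<alpha>) / (f \<gamma> - f \<alpha>) \<le> K * ((\<beta> - b) / (\<gamma> - b))"
        using dbl[of b b \<beta> \<gamma>] that flat[of \<alpha>] 2 by auto
      also have "\<dots> \<le> K * ((\<beta> - \<alpha>) / (\<gamma> - \<alpha>))"
        using frac_mono_left[of "\<beta> - b" "\<beta> - \<alpha>" "\<gamma> - \<beta>"] that 2 K1 by (intro mult_left_mono) auto
      finally show ?thesis .
    next
      case 3
      have "f \<alpha> \<le> f \<beta>" "f \<beta> < f \<gamma>" using that fstrict monoD[OF f(2)] by auto
      then have "(f \<beta> - f \<alpha>) / (f \<gamma> - f \<alpha>) \<le> 1" by simp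
      also have "\<dots> \<le> K * ((\<beta> - \<alpha>) / ((\<beta> - \<alpha>) + (\<gamma> - \<beta>)))"
        using that 3 ab by (intro Kfar) auto
      finally show ?thesis by simp
    qed
  qed
  have right: "(f \<delta> - f \<gamma>) / (f \<delta> - f \<beta>) \<le> K * ((\<delta> - \<gamma>) / (\<delta> - \<beta>))"
    if "\<gamma> \<le> \<delta>" "b \<le> \<beta>" "\<beta> < \<gamma>" "\<gamma> \<le> a + 1" for \<beta> \<gamma> \<delta>
  proof -
    consider "\<delta> \<le> a + 1" | "a + 1 < \<delta>" "\<delta> \<le> b + 1" | "b + 1 < \<delta>" by linarith
    then show ?thesis
    proof cases
      case 1 then show ?thesis using dbl[of \<beta> \<gamma> \<delta> \<delta>] that by auto
    next
      case 2
      have "(f \<delta> - f \<gamma>) / (f \<delta> - f \<beta>) \<le> K * ((a + 1 - \<gamma>) / (a + 1 - \<beta>))"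
        using dbl[of \<beta> \<gamma> "a + 1" "a + 1"] that flat'[of \<delta>] 2 by auto
      also have "\<dots> \<le> K * ((\<delta> - \<gamma>) / (\<delta> - \<beta>))"
      proof (rule mult_left_mono)
        have e: "(a + 1 - \<gamma>) + (\<gamma> - \<beta>) = a + 1 - \<beta>" "(\<delta> - \<gamma>) + (\<gamma> - \<beta>) = \<delta> - \<beta>" by simp_all
        show "(a + 1 - \<gamma>) / (a + 1 - \<beta>) \<le> (\<delta> - \<gamma>) / (\<delta> - \<beta>)"
          using frac_mono_left[of "a + 1 - \<gamma>" "\<delta> - \<gamma>" "\<gamma> - \<beta>", unfolded e] that 2 by auto
      qed (use K1 in simp)
      finally show ?thesis .
    next
      case 3
      have "f \<gamma> \<le> f \<delta>" "f \<beta> < f \<gamma>" using that fstrict monoD[OF f(2)] by auto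
      then have "(f \<delta> - f \<gamma>) / (f \<delta> - f \<beta>) \<le> 1" by simp
      also have "\<dots> \<le> K * ((\<delta> - \<gamma>) / ((\<delta> - \<gamma>) + (\<gamma> - \<beta>)))"
        using that 3 ab by (intro Kfar) auto
      finally show ?thesis by simp
    qed
  qed
  \<comment> \<open>The bound \<open>b - a\<close> prevents the ends of a short T from leaving the
    adjacent flat intervals; the bound \<open>\<epsilon>/2\<close> is the overlap of the charts, so
    that the truncated T fits into one of them.\<close>
  define \<eta> where "\<eta> = min (\<epsilon>/2) (b - a)"
  have "\<eta> > 0" using \<epsilon> ab unfolding \<eta>_def by simp
  moreover have "\<eta> \<le> \<epsilon>/2" "\<eta> \<le> b - a" unfolding \<eta>_def by (rule min.cobounded1, rule min.cobounded2)
  ultimately have \<eta>: "\<eta> > 0" "\<eta> \<le> \<epsilon>/2" "\<eta> \<le> b - a" .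
  define C' where "C' = max C (2 * ln K / \<eta>)"
  have C': "C' \<ge> 0" "C \<le> C'" using 1 unfolding C'_def C_def by auto
  have main: "cr (f \<alpha>) (f \<beta>) (f \<gamma>) (f \<delta>) \<le> exp (C' * (\<delta> - \<alpha>)) * cr \<alpha> \<beta> \<gamma> \<delta>"
    if o: "\<alpha> \<le> \<beta>" "b \<le> \<beta>" "\<beta> < \<gamma>" "\<gamma> \<le> a + 1" "\<gamma> \<le> \<delta>" for \<alpha> \<beta> \<gamma> \<delta>
  proof (cases "\<delta> - \<alpha> < \<eta>")
    case True
    define \<alpha>' \<delta>' where "\<alpha>' = max \<alpha> b" "\<delta>' = min \<delta> (a + 1)"
    have t: "f \<alpha> = f \<alpha>'" "f \<delta> = f \<delta>'" "\<alpha> \<le> \<alpha>'" "\<delta>' \<le> \<delta>" "\<alpha>' \<le> \<beta>" "\<gamma> \<le> \<delta>'"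
        "b \<le> \<alpha>'" "\<delta>' \<le> a + 1" "\<delta>' - \<alpha>' < \<epsilon>/2"
      using o True \<eta> flat[of \<alpha>] flat'[of \<delta>] unfolding \<alpha>'_\<delta>'_def by (auto simp: max_def min_def)
    consider "\<alpha>' < b + \<epsilon>/2" | "\<delta>' > a + 1 - \<epsilon>/2" | "b + \<epsilon>/2 \<le> \<alpha>'" "\<delta>' \<le> a + 1 - \<epsilon>/2"
      by linarith
    then have "cr (f \<alpha>') (f \<beta>) (f \<gamma>) (f \<delta>') \<le> exp (C * (\<delta>' - \<alpha>')) * cr \<alpha>' \<beta> \<gamma> \<delta>'"
      by cases (rule cr_distortionD[OF cr(1)] cr_distortionD[OF cr(2)] cr_distortionD[OF cr(3)];
          use t o \<epsilon> in auto)+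
    also have "\<dots> \<le> exp (C' * (\<delta> - \<alpha>)) * cr \<alpha> \<beta> \<gamma> \<delta>"
      using t o C' by (intro mult_mono cr_mono cr_nonneg) (auto intro!: mult_mono)
    finally show ?thesis unfolding t(1,2) .
  next
    case False
    have s: "f \<alpha> \<le> f \<beta>" "f \<beta> < f \<gamma>" "f \<gamma> \<le> f \<delta>" using o fstrict monoD[OF f(2)] by auto
    have "cr (f \<alpha>) (f \<beta>) (f \<gamma>) (f \<delta>) \<le>
        (K * ((\<beta> - \<alpha>) / (\<gamma> - \<alpha>))) * (K * ((\<delta> - \<gamma>) / (\<delta> - \<beta>)))"
      unfolding cr_eq using left[OF o(1-4)] right[OF o(5,2-4)] s o K1 by (intro mult_mono) auto
    also have "\<dots> = K\<^sup>2 * cr \<alpha> \<beta> \<gamma> \<delta>" unfolding cr_eq by (simp add: power2_eq_square ac_simps)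
    also have "\<dots> \<le> exp (C' * (\<delta> - \<alpha>)) * cr \<alpha> \<beta> \<gamma> \<delta>"
    proof (intro mult_right_mono cr_nonneg)
      have "2 * ln K = (2 * ln K / \<eta>) * \<eta>" using \<eta> by simp
      also have "\<dots> \<le> C' * (\<delta> - \<alpha>)"
        using False C' K1 \<eta> unfolding C'_def by (intro mult_mono) auto
      finally have "exp (2 * ln K) \<le> exp (C' * (\<delta> - \<alpha>))" by simp
      moreover have "exp (2 * ln K) = K\<^sup>2" using K1 by (simp add: exp_double)
      ultimately show "K\<^sup>2 \<le> exp (C' * (\<delta> - \<alpha>))" by simp
    qed (use o in auto)
    finally show ?thesis .
  qed
  show ?thesis using main fstrict C'(1) by (intro exI[of _ C']) auto
qed

section \<open>Iterates and preimages of the flat spot\<close>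

definition flat_hit :: "real \<Rightarrow> real \<Rightarrow> real \<Rightarrow> bool" where
  "flat_hit a b x \<longleftrightarrow> (\<exists>p::int. a + of_int p < x \<and> x < b + of_int p)"

lemma add_int_of_add1:
  fixes g :: "real \<Rightarrow> real"
  assumes g: "\<And>x. g (x + 1) = g x + 1"
  shows "g (x + of_int p) = g x + of_int p"
proof (induction p rule: int_induct[of _ 0])
  case (step1 i)
  then show ?case using g[of "x + of_int i"] by (simp add: ac_simps)
next
  case (step2 i)
  then show ?case using g[of "x + of_int i - 1"] by (simp add: algebra_simps)
qed simp

lemma flat_hit_uminus: "flat_hit (-b) (-a) x \<longleftrightarrow> flat_hit a b (-x)"
proof -
  have *: "flat_hit (-b) (-a) x \<Longrightarrow> flat_hit a b (-x)" for a b x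
  proof -
    assume "flat_hit (-b) (-a) x"
    then obtain p :: int where "-b + of_int p < x" "x < -a + of_int p" by (auto simp: flat_hit_def)
    then show "flat_hit a b (-x)" unfolding flat_hit_def by (intro exI[of _ "-p"]) auto
  qed
  show ?thesis using *[of b a x] *[of "-a" "-b" "-x"] by auto
qed

lemma flat_hit_add_int: "flat_hit a b (x + of_int p) \<longleftrightarrow> flat_hit a b x"
proof -
  have *: "flat_hit a b x \<Longrightarrow> flat_hit a b (x + of_int p)" for x and p :: int
  proof -
    assume "flat_hit a b x"
    then obtain q :: int where "a + of_int q < x" "x < b + of_int q" by (auto simp: flat_hit_def)
    then show ?thesis unfolding flat_hit_def by (intro exI[of _ "q + p"]) auto
  qed
  show ?thesis using *[of x p] *[of "x + of_int p" "-p"] by auto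
qed

text \<open>The scales used below are \<open>Q = q\<^sub>n\<^sub>+\<^sub>1\<close> and \<open>d = \<bar>q\<^sub>n \<rho> - p\<^sub>n\<bar>\<close> for the convergents \<open>p\<^sub>n / q\<^sub>n\<close> of \<open>\<rho>\<close>.\<close>

definition rotation_scale :: "real \<Rightarrow> nat \<Rightarrow> real \<Rightarrow> bool" where
  "rotation_scale \<rho> Q d \<longleftrightarrow> d > 0 \<and> Q \<ge> 1 \<and>
     (\<forall>j (p::int). 0 < j \<and> j < Q \<longrightarrow> d \<le> \<bar>real j * \<rho> - of_int p\<bar>) \<and>
     (\<forall>t. \<exists>j (p::int). 1 \<le> j \<and> j \<le> Q \<and> t \<le> real j * \<rho> + of_int p \<and> real j * \<rho> + of_int p \<le> t + 2 * d)"

lemma rotation_scale_uminus: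
  assumes "rotation_scale \<rho> Q d"
  shows "rotation_scale (-\<rho>) Q d"
  unfolding rotation_scale_def
proof (intro conjI allI impI)
  show "d > 0" "Q \<ge> 1" using assms unfolding rotation_scale_def by auto
  fix j :: nat and p :: int assume "0 < j \<and> j < Q"
  then have "d \<le> \<bar>real j * \<rho> - of_int (-p)\<bar>" using assms unfolding rotation_scale_def by blast
  then show "d \<le> \<bar>real j * - \<rho> - real_of_int p\<bar>" by simp
next
  fix t
  obtain j and p :: int where "1 \<le> j" "j \<le> Q" "- t - 2 * d \<le> real j * \<rho> + of_int p"
      "real j * \<rho> + of_int p \<le> - t - 2 * d + 2 * d"
    using assms unfolding rotation_scale_def by blast
  then show "\<exists>j p. 1 \<le> j \<and> j \<le> Q \<and> t \<le> real j * - \<rho> + real_of_int p \<and>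
      real j * - \<rho> + real_of_int p \<le> t + 2 * d"
    by (intro exI[of _ j] exI[of _ "-p"]) auto
qed

text \<open>These axioms are invariant under reflection (\<open>reflected\<close>), which is why
  smoothness enters only through \<open>cr_step\<close>. The normalisation \<open>h b = 0\<close>
  puts every hit of the lifted flat spot at an integer height.\<close>

locale flat_dynamics =
  fixes f :: "real \<Rightarrow> real" and a b C \<rho> :: real and h :: "real \<Rightarrow> real"
  assumes f_cont: "continuous_on UNIV f" and f_mono: "mono f" and f_add1: "f (x + 1) = f x + 1"
    and a_less_b: "a < b" and b_less: "b < a + 1" and f_flat: "f a = f b"
    and C_nonneg: "C \<ge> 0"
    and cr_step: "\<lbrakk>\<alpha> \<le> \<beta>; b \<le> \<beta>; \<beta> < \<gamma>; \<gamma> \<le> a + 1; \<gamma> \<le> \<delta>\<rbrakk> \<Longrightarrow>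
      f \<beta> < f \<gamma> \<and> cr (f \<alpha>) (f \<beta>) (f \<gamma>) (f \<delta>) \<le> exp (C * (\<delta> - \<alpha>)) * cr \<alpha> \<beta> \<gamma> \<delta>"
    and h_mono: "mono h" and h_f: "h (f x) = h x + \<rho>" and h_add1: "h (x + 1) = h x + 1"
    and h_b: "h b = 0"
    and irrational: "\<rho> \<notin> \<rat>"
begin

lemma h_add_int [simp]: "h (x + of_int p) = h x + of_int p"
  using h_add1 by (rule add_int_of_add1)

lemma f_add_int: "f (x + of_int p) = f x + of_int p"
  using f_add1 by (rule add_int_of_add1)

lemma iter_add_int [simp]: "(f ^^ n) (x + of_int p) = (f ^^ n) x + of_int p"
  by (induction n) (auto simp: f_add_int)

lemma h_iter [simp]: "h ((f ^^ n) x) = h x + real n * \<rho>"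
  by (induction n) (auto simp: h_f algebra_simps)

lemma iter_mono: "x \<le> y \<Longrightarrow> (f ^^ n) x \<le> (f ^^ n) y"
  using funpow_mono[OF f_mono] by blast

lemma iter_less_imp_less: "(f ^^ n) x < (f ^^ n) y \<Longrightarrow> x < y"
  using iter_mono[of y x n] by (meson not_le)

lemma h_less_imp_less: "h x < h y \<Longrightarrow> x < y"
  using h_mono by (meson monoD not_le)

lemma surj_f: "surj f"
  unfolding surj_def
proof
  fix z
  define n where "n = \<lceil>\<bar>z - f 0\<bar>\<rceil>"
  have "\<bar>z - f 0\<bar> \<le> of_int n" unfolding n_def by linarith
  then have "f (0 + of_int (-n)) \<le> z" "z \<le> f (0 + of_int n)" "- of_int n \<le> (of_int n :: real)"
    unfolding f_add_int by (auto simp: abs_le_iff)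
  moreover have "continuous_on {0 + of_int (-n)..0 + of_int n} f"
    using f_cont continuous_on_subset by blast
  ultimately obtain x where "f x = z"
    using IVT'[of f "0 + of_int (-n)" z "0 + of_int n"] by auto
  then show "\<exists>x. z = f x" by blast
qed

lemma iter_surj: obtains x where "(f ^^ n) x = z"
proof -
  have "surj (f ^^ n)"
  proof (induction n)
    case (Suc n)
    then show ?case unfolding funpow.simps by (intro comp_surj surj_f)
  qed (simp add: surj_id[unfolded id_def] id_def)
  then obtain x where "z = (f ^^ n) x" by (rule surjE)
  then show ?thesis using that by simp
qed

lemma h_a: "h a = 0"
  using h_f[of a] h_f[of b] f_flat h_b by simp

lemma h_flat_hit:
  assumes "flat_hit a b x" obtains p :: int where "h x = of_int p"
proof -
  obtain p :: int where p: "a + of_int p < x" "x < b + of_int p" using assms by (auto simp: flat_hit_def)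
  have "h (a + of_int p) \<le> h x" "h x \<le> h (b + of_int p)"
    using p monoD[OF h_mono, of "a + of_int p" x] monoD[OF h_mono, of x "b + of_int p"]
    by (simp_all del: h_add_int)
  then show ?thesis using that[of p] h_a h_b by simp
qed

lemma less_add1: "h y - h x < 1 \<Longrightarrow> y < x + 1"
  using h_less_imp_less[of y "x + 1"] h_add1[of x] by simp

section \<open>Cross-ratios and lengths along orbits\<close>

lemma avoiding_interval:
  assumes "\<beta> < \<gamma>" "\<And>x. \<beta> < x \<Longrightarrow> x < \<gamma> \<Longrightarrow> \<not> flat_hit a b x"
  obtains p :: int where "b + of_int p \<le> \<beta>" "\<gamma> \<le> a + 1 + of_int p"
proof -
  define p where "p = \<lfloor>\<beta> - a\<rfloor>"
  have p: "a + of_int p \<le> \<beta>" "\<beta> < a + of_int p + 1" unfolding p_def by linarith+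
  have "b + of_int p \<le> \<beta>"
  proof (rule ccontr)
    assume "\<not> ?thesis"
    define x where "x = (\<beta> + min \<gamma> (b + of_int p)) / 2"
    have x: "\<beta> < x" "x < \<gamma>" "x < b + of_int p"
      using \<open>\<not> b + of_int p \<le> \<beta>\<close> assms(1) unfolding x_def by (auto simp: min_def field_simps)
    then have "flat_hit a b x" using p unfolding flat_hit_def by (intro exI[of _ p]) auto
    then show False using assms(2) x by blast
  qed
  moreover have "\<gamma> \<le> a + 1 + of_int p"
  proof (rule ccontr)
    assume "\<not> ?thesis"
    define x where "x = (a + 1 + of_int p + min \<gamma> (b + 1 + of_int p)) / 2"
    have x: "a + 1 + of_int p < x" "x < \<gamma>" "x < b + 1 + of_int p"
      using \<open>\<not> \<gamma> \<le> a + 1 + of_int p\<close> a_less_b unfolding x_def by (auto simp: min_def field_simps)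
    then have "flat_hit a b x" unfolding flat_hit_def by (intro exI[of _ "p + 1"]) auto
    moreover have "\<beta> < x" using p x by simp
    ultimately show False using assms(2) x by blast
  qed
  ultimately show ?thesis using that by blast
qed

text \<open>The middle interval is in one complementary interval of the lifted flat spot at each
  step, so \<open>cr_step\<close> applies after an integer translation and the exponents add up. The
  first conclusion is also used alone: \<open>f ^^ m\<close> is strictly increasing across an
  interval that is not hit before time \<open>m\<close>.\<close>

lemma cr_chain:
  assumes o: "\<alpha> \<le> \<beta>" "\<beta> < \<gamma>" "\<gamma> \<le> \<delta>"
    and avoid: "\<And>j x. j < m \<Longrightarrow> (f ^^ j) \<beta> < x \<Longrightarrow> x < (f ^^ j) \<gamma> \<Longrightarrow> \<not> flat_hit a b x"
  shows "(f ^^ m) \<beta> < (f ^^ m) \<gamma>"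
    and "cr ((f ^^ m) \<alpha>) ((f ^^ m) \<beta>) ((f ^^ m) \<gamma>) ((f ^^ m) \<delta>) \<le>
      exp (C * (\<Sum>j<m. (f ^^ j) \<delta> - (f ^^ j) \<alpha>)) * cr \<alpha> \<beta> \<gamma> \<delta>"
proof -
  have "(f ^^ m) \<beta> < (f ^^ m) \<gamma> \<and> cr ((f ^^ m) \<alpha>) ((f ^^ m) \<beta>) ((f ^^ m) \<gamma>) ((f ^^ m) \<delta>) \<le>
      exp (C * (\<Sum>j<m. (f ^^ j) \<delta> - (f ^^ j) \<alpha>)) * cr \<alpha> \<beta> \<gamma> \<delta>"
    using avoid
  proof (induction m)
    case 0 then show ?case using o by simp
  next
    case (Suc m)
    let ?A = "(f ^^ m) \<alpha>" and ?B = "(f ^^ m) \<beta>" and ?G = "(f ^^ m) \<gamma>" and ?D = "(f ^^ m) \<delta>"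
    have avoid': "\<not> flat_hit a b x" if "j < m" "(f ^^ j) \<beta> < x" "x < (f ^^ j) \<gamma>" for j x
      using Suc.prems[of j x] that by simp
    have IH: "?B < ?G" "cr ?A ?B ?G ?D \<le> exp (C * (\<Sum>j<m. (f ^^ j) \<delta> - (f ^^ j) \<alpha>)) * cr \<alpha> \<beta> \<gamma> \<delta>"
      using Suc.IH[OF avoid'] by auto
    obtain p :: int where p: "b + of_int p \<le> ?B" "?G \<le> a + 1 + of_int p"
      using avoiding_interval[OF IH(1)] Suc.prems[of m] by blast
    have sh: "f x = f (x - of_int p) + of_int p" for x
      using f_add_int[of "x - of_int p" p] by simp
    have cs: "cr (x + t) (y + t) (z + t) (w + t) = cr x y z w" for x y z w t by (rule cr_add)
    have AB: "?A \<le> ?B" "?G \<le> ?D" using iter_mono o by auto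
    have st: "f (?B - of_int p) < f (?G - of_int p)"
       "cr (f (?A - of_int p)) (f (?B - of_int p)) (f (?G - of_int p)) (f (?D - of_int p)) \<le>
        exp (C * ((?D - of_int p) - (?A - of_int p))) *
        cr (?A - of_int p) (?B - of_int p) (?G - of_int p) (?D - of_int p)"
      using cr_step[of "?A - of_int p" "?B - of_int p" "?G - of_int p" "?D - of_int p"] AB IH(1) p
      by auto
    have "cr (f ?A) (f ?B) (f ?G) (f ?D) \<le> exp (C * (?D - ?A)) * cr ?A ?B ?G ?D"
      using st(2) unfolding sh[of ?A] sh[of ?B] sh[of ?G] sh[of ?D] cs
      using cs[of ?A "- of_int p" ?B ?G ?D] by simp
    also have "\<dots> \<le> exp (C * (?D - ?A)) *
        (exp (C * (\<Sum>j<m. (f ^^ j) \<delta> - (f ^^ j) \<alpha>)) * cr \<alpha> \<beta> \<gamma> \<delta>)"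
      using IH(2) by (intro mult_left_mono) auto
    also have "\<dots> = exp (C * (\<Sum>j<Suc m. (f ^^ j) \<delta> - (f ^^ j) \<alpha>)) * cr \<alpha> \<beta> \<gamma> \<delta>"
      by (simp add: exp_add[symmetric] distrib_left[symmetric] mult.assoc[symmetric] add.commute)
    finally show ?case using st(1) sh[of ?B] sh[of ?G] by simp
  qed
  then show "(f ^^ m) \<beta> < (f ^^ m) \<gamma>"
    and "cr ((f ^^ m) \<alpha>) ((f ^^ m) \<beta>) ((f ^^ m) \<gamma>) ((f ^^ m) \<delta>) \<le>
      exp (C * (\<Sum>j<m. (f ^^ j) \<delta> - (f ^^ j) \<alpha>)) * cr \<alpha> \<beta> \<gamma> \<delta>" by auto
qed

text \<open>The times in \<open>J\<close> differ by less than \<open>Q\<close>, so the base points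
  \<open>j * \<rho>\<close> are at least \<open>d\<close> apart modulo 1. After translation each
  interval starts in the unit interval, and one that contains a given point has its base in a window
  of length \<open>w * d\<close>; hence at most \<open>w + 1\<close> of them do. Integrating this
  multiplicity over \<open>{0..2}\<close> gives the bound.\<close>

lemma sum_lengths_le_block:
  assumes sc: "rotation_scale \<rho> Q d" and w: "0 \<le> w"
    and J: "finite J" "\<And>i j. i \<in> J \<Longrightarrow> j \<in> J \<Longrightarrow> i < j + Q"
    and lr: "\<And>j. j \<in> J \<Longrightarrow> l j \<le> r j" "\<And>j. j \<in> J \<Longrightarrow> r j \<le> l j + 1"
    and hl: "\<And>j. j \<in> J \<Longrightarrow> real j * \<rho> + t \<le> h (l j)"
    and hr: "\<And>j. j \<in> J \<Longrightarrow> h (r j) \<le> real j * \<rho> + t + w * d"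
  shows "(\<Sum>j\<in>J. r j - l j) \<le> 2 * (w + 1)"
proof -
  have d: "d > 0" using sc unfolding rotation_scale_def by auto
  define p where "p = (\<lambda>j. \<lfloor>l j\<rfloor>)"
  define s where "s = (\<lambda>j. real j * \<rho> - of_int (p j))"
  define I where "I = (\<lambda>j. {l j - of_int (p j)..r j - of_int (p j)})"
  have sep: "d \<le> \<bar>s i - s j\<bar>" if "i \<in> J" "j \<in> J" "i < j" for i j
  proof -
    have "0 < j - i \<and> j - i < Q" using that J(2)[of j i] by auto
    then have "d \<le> \<bar>real (j - i) * \<rho> - of_int (p j - p i)\<bar>"
      using sc unfolding rotation_scale_def by blast
    also have "real (j - i) * \<rho> - of_int (p j - p i) = s j - s i"
      using that unfolding s_def by (simp add: of_nat_diff algebra_simps)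
    finally show ?thesis by simp
  qed
  have mult: "real (card {j \<in> J. x \<in> I j}) \<le> w + 1" for x
  proof -
    \<comment> \<open>The cell of length \<open>d\<close> that contains the base point, counted from
      the left end of the window. Separation puts at most one base point in each cell.\<close>
    define \<phi> where "\<phi> = (\<lambda>j. \<lfloor>(s j - (h x - t - w * d)) / d\<rfloor>)"
    have rng: "0 \<le> s j - (h x - t - w * d) \<and> s j - (h x - t - w * d) \<le> w * d"
      if j: "j \<in> J" "x \<in> I j" for j
    proof -
      have "h (l j + of_int (- p j)) \<le> h x" "h x \<le> h (r j + of_int (- p j))"
        using j unfolding I_def by (auto intro!: monoD[OF h_mono])
      then show ?thesis using hl[OF j(1)] hr[OF j(1)] unfolding h_add_int s_def by simp
    qed
    have "inj_on \<phi> {j \<in> J. x \<in> I j}"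
    proof (rule linorder_inj_onI')
      fix i j assume ij: "i \<in> {j \<in> J. x \<in> I j}" "j \<in> {j \<in> J. x \<in> I j}" "i < j"
      then have "d \<le> \<bar>s i - s j\<bar>" using sep by auto
      then have "1 \<le> \<bar>(s i - (h x - t - w * d)) / d - (s j - (h x - t - w * d)) / d\<bar>"
        using d by (simp add: diff_divide_distrib[symmetric] abs_divide)
      then show "\<phi> i \<noteq> \<phi> j" unfolding \<phi>_def by linarith
    qed
    moreover have "\<phi> ` {j \<in> J. x \<in> I j} \<subseteq> {0..\<lfloor>w\<rfloor>}"
    proof
      fix y assume "y \<in> \<phi> ` {j \<in> J. x \<in> I j}"
      then obtain j where j: "j \<in> J" "x \<in> I j" "y = \<phi> j" by auto
      have "0 \<le> (s j - (h x - t - w * d)) / d" "(s j - (h x - t - w * d)) / d \<le> w"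
        using rng[OF j(1,2)] d by (auto simp: divide_le_eq)
      then show "y \<in> {0..\<lfloor>w\<rfloor>}" unfolding j(3) \<phi>_def by (auto intro: floor_mono)
    qed
    ultimately have "card {j \<in> J. x \<in> I j} \<le> card {0..\<lfloor>w\<rfloor>}"
      by (intro card_inj_on_le) auto
    also have "card {0..\<lfloor>w\<rfloor>} = nat (\<lfloor>w\<rfloor> + 1)" by simp
    finally show ?thesis using w by linarith
  qed
  have pl: "0 \<le> l j - of_int (p j)" "l j - of_int (p j) < 1" for j unfolding p_def by linarith+
  have "(\<Sum>j\<in>J. r j - l j) = (\<Sum>j\<in>J. integral\<^sup>L lborel (indicator (I j) :: real \<Rightarrow> real))"
    using lr by (intro sum.cong) (auto simp: I_def)
  also have "\<dots> = integral\<^sup>L lborel (\<lambda>x. \<Sum>j\<in>J. indicator (I j) x :: real)"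
    by (rule Bochner_Integration.integral_sum[symmetric]) (auto simp: I_def emeasure_lborel_Icc_eq)
  also have "\<dots> \<le> integral\<^sup>L lborel (\<lambda>x. (w + 1) * indicator {0..2::real} x)"
  proof (rule integral_mono)
    fix x :: real
    show "(\<Sum>j\<in>J. indicator (I j) x) \<le> (w + 1) * indicator {0..2::real} x"
    proof (cases "x \<in> {0..2}")
      case True
      have "(\<Sum>j\<in>J. indicator (I j) x :: real) = real (card {j \<in> J. x \<in> I j})"
        using J(1) by (simp add: indicator_def sum.If_cases Int_def)
      then show ?thesis using mult[of x] True by simp
    next
      case False
      have "x \<notin> I j" if "j \<in> J" for j
        using False pl[of j] lr(2)[OF that] unfolding I_def by auto
      then show ?thesis using False by simp
    qed
  qed (auto simp: I_def emeasure_lborel_Icc_eq)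
  also have "\<dots> = 2 * (w + 1)" by simp
  finally show ?thesis .
qed

text \<open>The times below \<open>c * Q\<close> split into \<open>c\<close> blocks to which the
  previous bound applies.\<close>

lemma sum_lengths_le:
  assumes sc: "rotation_scale \<rho> Q d" and w: "0 \<le> w" and m: "m \<le> c * Q"
    and lr: "\<And>j. l j \<le> r j" "\<And>j. r j \<le> l j + 1"
    and hl: "\<And>j. real j * \<rho> + t \<le> h (l j)"
    and hr: "\<And>j. h (r j) \<le> real j * \<rho> + t + w * d"
  shows "(\<Sum>j<m. r j - l j) \<le> real c * (2 * (w + 1))"
  using m
proof (induction c arbitrary: m)
  case 0 then show ?case by simp
next
  case (Suc c)
  show ?case
  proof (cases "m \<le> c * Q")
    case True
    then show ?thesis using Suc.IH[OF True] w by (simp add: algebra_simps)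
  next
    case False
    then have un: "{..<m} = {..<c * Q} \<union> {c * Q..<m}" by auto
    have "(\<Sum>j<m. r j - l j) = (\<Sum>j<c*Q. r j - l j) + (\<Sum>j\<in>{c * Q..<m}. r j - l j)"
      unfolding un by (rule sum.union_disjoint) auto
    also have "\<dots> \<le> real c * (2 * (w + 1)) + 2 * (w + 1)"
      using Suc.prems by (intro add_mono Suc.IH sum_lengths_le_block[OF sc w _ _ lr hl hr]) auto
    finally show ?thesis by (simp add: algebra_simps)
  qed
qed

text \<open>Among the disjoint intervals \<open>f\<^sup>j(b, e)\<close> with \<open>1 \<le> j \<le> Q\<close> the shortest one has a longer
  one on either side within bounded combinatorial distance; pulling this configuration back to
  time \<open>0\<close> gives room to the right of \<open>(b, e)\<close>.\<close>

lemma space_beyond: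
  assumes sc: "rotation_scale \<rho> Q d" and d: "d \<le> 1 / 20" and e: "b < e" "h e < d"
  obtains y where "e < y" "h y \<le> 5 * d" "exp (- 20 * C) / 4 * (y - b) \<le> y - e"
proof -
  have dpos: "d > 0" and Q: "Q \<ge> 1"
    and G1: "\<And>j (p::int). 0 < j \<Longrightarrow> j < Q \<Longrightarrow> d \<le> \<bar>real j * \<rho> - of_int p\<bar>"
    and G2: "\<And>t. \<exists>j (p::int). 1 \<le> j \<and> j \<le> Q \<and> t \<le> real j * \<rho> + of_int p \<and>
        real j * \<rho> + of_int p \<le> t + 2 * d"
    using sc unfolding rotation_scale_def by blast+
  have he: "0 \<le> h e" using monoD[OF h_mono, of b e] e h_b by simp
  have avoid: "\<not> flat_hit a b x" if j: "j < Q" "(f ^^ j) b < x" "x < (f ^^ j) e" for j x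
  proof
    assume hit: "flat_hit a b x"
    obtain p :: int where p: "h x = of_int p" using h_flat_hit[OF hit] .
    have x: "real j * \<rho> \<le> of_int p" "of_int p \<le> h e + real j * \<rho>"
      using monoD[OF h_mono, of "(f ^^ j) b" x] monoD[OF h_mono, of x "(f ^^ j) e"] j p h_b by auto
    show False
    proof (cases "j = 0")
      case True
      obtain q :: int where q: "a + of_int q < x" "x < b + of_int q" using hit by (auto simp: flat_hit_def)
      then have "b < b + of_int q" using j True by simp
      then have "1 \<le> q" by simp
      then have "(1::real) \<le> of_int q" by simp
      moreover have "x < e" using j True by simp
      ultimately have "a + 1 \<le> e" using q by linarith
      then have "h (a + 1) \<le> h e" by (rule monoD[OF h_mono])
      then show False using h_add1[of a] h_a e d by simp
    next
      case False
      then have "d \<le> \<bar>real j * \<rho> - of_int p\<bar>" using G1 j by auto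
      then show False using x e by linarith
    qed
  qed
  define len where "len = (\<lambda>j. (f ^^ j) e - (f ^^ j) b)"
  have "finite {1..Q}" "{1..Q} \<noteq> {}" using Q by auto
  then obtain k where k: "k \<in> {1..Q}" "\<And>j. j \<in> {1..Q} \<Longrightarrow> len k \<le> len j"
    using ex_min_if_finite[of "len ` {1..Q}"] by (metis (no_types, lifting) finite_imageI
      image_iff image_is_empty imageI not_le)
  have avoid_k: "\<not> flat_hit a b x" if "j < k" "(f ^^ j) b < x" "x < (f ^^ j) e" for j x
    using avoid[of j x] that k(1) by simp
  have kb: "(f ^^ k) b < (f ^^ k) e"
    by (rule cr_chain(1)[OF order_refl e(1) order_refl]) (rule avoid_k)
  \<comment> \<open>The images of \<open>M\<close> have h-width below \<open>d\<close>. The windows,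
    from \<open>d\<close> to \<open>3 * d\<close> beyond the shortest image and from
    \<open>4 * d\<close> to \<open>2 * d\<close> before it, leave room for this width, so the
    neighbours found there are disjoint from it. Pulled back to time 0 the configuration reaches
    from \<open>- 4 * d\<close> to at most \<open>5 * d\<close>: width \<open>9 * d\<close>,
    multiplicity at most 10 and sum of lengths at most 20.\<close>
  obtain j1 and p1 :: int where j1: "1 \<le> j1" "j1 \<le> Q" "h ((f ^^ k) e) + d \<le> real j1 * \<rho> + of_int p1"
      "real j1 * \<rho> + of_int p1 \<le> h ((f ^^ k) e) + d + 2 * d"
    using G2 by blast
  obtain y where y: "(f ^^ k) y = (f ^^ j1) e + of_int p1" by (rule iter_surj)
  have hb1: "h ((f ^^ j1) b + of_int p1) = real j1 * \<rho> + of_int p1" using h_b by simp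
  have ord1: "(f ^^ k) e < (f ^^ j1) b + of_int p1"
    by (rule h_less_imp_less) (use hb1 j1 dpos in linarith)
  obtain j2 and p2 :: int where j2: "1 \<le> j2" "j2 \<le> Q" "h ((f ^^ k) b) - 4 * d \<le> real j2 * \<rho> + of_int p2"
      "real j2 * \<rho> + of_int p2 \<le> h ((f ^^ k) b) - 4 * d + 2 * d"
    using G2 by blast
  obtain \<alpha> where \<alpha>: "(f ^^ k) \<alpha> = (f ^^ j2) b + of_int p2" by (rule iter_surj)
  have ord2: "(f ^^ j2) e + of_int p2 < (f ^^ k) b"
    by (rule h_less_imp_less) (use j2 dpos e in simp)
  have l1: "len k \<le> (f ^^ k) y - (f ^^ k) e"
    using k(2)[of j1] j1 y ord1 unfolding len_def by simp
  have l2: "len k \<le> (f ^^ k) b - (f ^^ k) \<alpha>"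
    using k(2)[of j2] j2 \<alpha> ord2 unfolding len_def by simp
  have lk: "len k > 0" using kb unfolding len_def by simp
  have o: "\<alpha> \<le> b" "e < y"
    using l1 l2 lk iter_less_imp_less[of k \<alpha> b] iter_less_imp_less[of k e y] by auto
  have hy: "h y \<le> 5 * d"
    using arg_cong[OF y, of h] j1 e by simp
  have h\<alpha>: "- 4 * d \<le> h \<alpha>"
    using arg_cong[OF \<alpha>, of h] j2 h_b by simp
  have S: "(\<Sum>j<k. (f ^^ j) y - (f ^^ j) \<alpha>) \<le> real 1 * (2 * (9 + 1))"
  proof (rule sum_lengths_le[OF sc, where t = "- 4 * d"])
    show "k \<le> 1 * Q" using k by simp
    fix j
    show "(f ^^ j) \<alpha> \<le> (f ^^ j) y" using o e by (intro iter_mono) simp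
    show "(f ^^ j) y \<le> (f ^^ j) \<alpha> + 1"
      by (rule less_imp_le, rule less_add1) (use hy h\<alpha> d in simp)
    show "real j * \<rho> + - 4 * d \<le> h ((f ^^ j) \<alpha>)" "h ((f ^^ j) y) \<le> real j * \<rho> + - 4 * d + 9 * d"
      using hy h\<alpha> by simp_all
  qed simp
  \<comment> \<open>Each neighbour, together with the space up to it, is at least as long as the
    shortest image, so each factor of the cross-ratio is at least 1/2.\<close>
  have "1 / 2 * (1 / 2) \<le> cr ((f ^^ k) \<alpha>) ((f ^^ k) b) ((f ^^ k) e) ((f ^^ k) y)"
    unfolding cr_eq using l1 l2 lk unfolding len_def
    by (intro mult_mono) (simp_all add: divide_simps)
  also have "\<dots> \<le> exp (C * (\<Sum>j<k. (f ^^ j) y - (f ^^ j) \<alpha>)) * cr \<alpha> b e y"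
    by (rule cr_chain(2)[OF o(1) e(1) less_imp_le[OF o(2)]]) (rule avoid_k)
  also have "\<dots> \<le> exp (20 * C) * ((y - e) / (y - b))"
    using S C_nonneg o e mult_left_mono[OF S C_nonneg]
    by (intro mult_mono cr_le_right cr_nonneg) (auto simp: mult.commute)
  finally have "1 / 4 \<le> exp (20 * C) * ((y - e) / (y - b))" by simp
  then have "exp (- 20 * C) * (1 / 4) \<le> exp (- 20 * C) * (exp (20 * C) * ((y - e) / (y - b)))"
    by (intro mult_left_mono) auto
  also have "\<dots> = (y - e) / (y - b)" by (simp add: mult.assoc[symmetric] exp_add[symmetric])
  finally have "exp (- 20 * C) / 4 * (y - b) \<le> y - e"
    using o e by (simp add: pos_le_divide_eq)
  then show ?thesis using that o hy by blast
qed

text \<open>The constant of \<open>preimage_comparable\<close>: \<open>b - a\<close> is the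
  contribution of the flat spot, \<open>exp (- 20 * C) / 4\<close> that of
  \<open>space_beyond\<close>, and the first factor pays for the pullback, where each of
  \<open>c\<close> blocks has sum of lengths at most 2 * (5 + 1) for the h-width
  \<open>5 * d\<close>.\<close>

definition \<kappa> :: "nat \<Rightarrow> real" where
  "\<kappa> c = exp (- 12 * C * real c) * ((b - a) * (exp (- 20 * C) / 4))"

lemma \<kappa>_pos: "\<kappa> c > 0"
  unfolding \<kappa>_def using a_less_b by simp

text \<open>Here M is the interval from \<open>v\<close> to \<open>e\<close>. At time
  \<open>m\<close> its left neighbour is the flat spot, whose factor is at least
  \<open>b - a\<close> because the image of \<open>e\<close> is below \<open>a + 1\<close>; its
  right neighbour comes from \<open>space_beyond\<close>. At time 0 only the left factor is
  kept.\<close>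

lemma preimage_comparable:
  assumes sc: "rotation_scale \<rho> Q d" and d: "d \<le> 1 / 20" and m: "m \<le> c * Q"
    and uv: "(f ^^ m) u = a" "(f ^^ m) v = b" and e: "v < e" "h e - h v < d"
    and avoid: "\<And>j x. j < m \<Longrightarrow> v < x \<Longrightarrow> x < e \<Longrightarrow> \<not> flat_hit a b ((f ^^ j) x)"
  shows "\<kappa> c * (e - v) \<le> v - u"
proof -
  have dpos: "d > 0" using sc unfolding rotation_scale_def by blast
  have avoid': "\<not> flat_hit a b x" if j: "j < m" "(f ^^ j) v < x" "x < (f ^^ j) e" for j x
  proof -
    obtain z where "(f ^^ j) z = x" by (rule iter_surj)
    then show ?thesis using avoid[of j z] j iter_less_imp_less[of j v z] iter_less_imp_less[of j z e] by auto
  qed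
  define E where "E = (f ^^ m) e"
  have bE: "b < E"
    using cr_chain(1)[of v v e e m] avoid' e uv unfolding E_def by auto
  have hu: "h u = - real m * \<rho>" using arg_cong[OF uv(1), of h] h_a by simp
  have hv: "h v = - real m * \<rho>" using arg_cong[OF uv(2), of h] h_b by simp
  have hE: "h E < d" using e hv unfolding E_def by simp
  obtain y where y: "E < y" "h y \<le> 5 * d" "exp (- 20 * C) / 4 * (y - b) \<le> y - E"
    using space_beyond[OF sc d bE hE] .
  obtain y0 where y0: "(f ^^ m) y0 = y" by (rule iter_surj)
  have ey0: "e < y0" using y(1) y0 iter_less_imp_less[of m e y0] unfolding E_def by simp
  have uv': "u < v" using iter_less_imp_less[of m u v] uv a_less_b by simp
  have hy0: "h y0 \<le> 5 * d - real m * \<rho>" using arg_cong[OF y0, of h] y(2) by simp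
  have S: "(\<Sum>j<m. (f ^^ j) y0 - (f ^^ j) u) \<le> real c * (2 * (5 + 1))"
  proof (rule sum_lengths_le[OF sc, where t = "- real m * \<rho>"])
    fix j
    show "(f ^^ j) u \<le> (f ^^ j) y0" using uv' e ey0 by (intro iter_mono) simp
    show "(f ^^ j) y0 \<le> (f ^^ j) u + 1"
      by (rule less_imp_le, rule less_add1) (use hy0 hu d in simp)
    show "real j * \<rho> + - real m * \<rho> \<le> h ((f ^^ j) u)"
      "h ((f ^^ j) y0) \<le> real j * \<rho> + - real m * \<rho> + 5 * d"
      using hy0 hu by simp_all
  qed (use m in auto)
  have Ea: "E < a + 1" by (rule less_add1) (use hE d h_a in simp)
  have "(b - a) * (exp (- 20 * C) / 4) \<le> cr a b E y"
    unfolding cr_eq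
  proof (intro mult_mono)
    have "(b - a) * (E - a) \<le> (b - a) * 1" using Ea a_less_b by (intro mult_left_mono) auto
    then show "b - a \<le> (b - a) / (E - a)" using a_less_b bE by (simp add: le_divide_eq)
    show "exp (- 20 * C) / 4 \<le> (y - E) / (y - b)" using y(1,3) bE by (simp add: pos_le_divide_eq)
  qed (use a_less_b bE in auto)
  also have "\<dots> = cr ((f ^^ m) u) ((f ^^ m) v) ((f ^^ m) e) ((f ^^ m) y0)"
    unfolding uv y0 E_def ..
  also have "\<dots> \<le> exp (C * (\<Sum>j<m. (f ^^ j) y0 - (f ^^ j) u)) * cr u v e y0"
    by (rule cr_chain(2)[OF less_imp_le[OF uv'] e(1) less_imp_le[OF ey0]]) (rule avoid')
  also have "\<dots> \<le> exp (12 * C * real c) * ((v - u) / (e - u))"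
    using uv' e ey0 mult_left_mono[OF S C_nonneg]
    by (intro mult_mono cr_le_left cr_nonneg) (auto simp: ac_simps)
  finally have "(b - a) * (exp (- 20 * C) / 4) \<le> exp (12 * C * real c) * ((v - u) / (e - u))" .
  then have "\<kappa> c \<le> exp (- 12 * C * real c) * (exp (12 * C * real c) * ((v - u) / (e - u)))"
    unfolding \<kappa>_def by (intro mult_left_mono) auto
  also have "\<dots> = (v - u) / (e - u)" by (simp add: mult.assoc[symmetric] exp_add[symmetric])
  finally have "\<kappa> c * (e - u) \<le> v - u" using uv' e by (simp add: pos_le_divide_eq)
  moreover have "\<kappa> c * (e - v) \<le> \<kappa> c * (e - u)" using uv' \<kappa>_pos[of c] by (intro mult_left_mono) auto
  ultimately show ?thesis by linarith
qed

section \<open>Comparing a preimage of the flat spot with the interval next to it\<close>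

lemma rotation_points_unique:
  assumes "of_int p - real i * \<rho> = of_int q - real j * \<rho>"
  shows "i = j" "p = q"
proof -
  have eq: "(real i - real j) * \<rho> = of_int (p - q)" using assms by (simp add: algebra_simps)
  show "i = j"
  proof (rule ccontr)
    assume "i \<noteq> j"
    then have "\<rho> = of_int (p - q) / (real i - real j)" using eq by (simp add: field_simps)
    then show False using irrational by (auto intro: Rats_divide Rats_diff)
  qed
  then show "p = q" using assms by simp
qed

text \<open>This replaces avoidance by conditions on the rotation. A hit at time \<open>j\<close>
  has a height \<open>q - j * \<rho>\<close>. Strictly between \<open>h v\<close> and
  \<open>h r\<close> it contradicts \<open>first\<close>, at \<open>h v\<close> it contradicts
  irrationality, and at \<open>h r\<close> it contradicts \<open>good\<close>.\<close>

lemma preimage_left_of_point: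
  assumes sc: "rotation_scale \<rho> Q d" and d: "d \<le> 1 / 20" and m: "m \<le> c * Q"
    and u: "(f ^^ m) u = a + of_int p" and v: "(f ^^ m) v = b + of_int p"
    and vr: "h v < h r" "h r - h v < d"
    and first: "\<And>j (q::int). j < m \<Longrightarrow> h v < of_int q - real j * \<rho> \<Longrightarrow> \<not> of_int q - real j * \<rho> < h r"
    and good: "\<And>x j. x < r \<Longrightarrow> h x = h r \<Longrightarrow> \<not> flat_hit a b ((f ^^ j) x)"
  shows "\<kappa> c * (r - v) \<le> v - u"
proof -
  have hv: "h v = of_int p - real m * \<rho>" using arg_cong[OF v, of h] h_b by simp
  have "\<kappa> c * ((r + of_int (-p)) - (v + of_int (-p))) \<le> (v + of_int (-p)) - (u + of_int (-p))"
  proof (rule preimage_comparable[OF sc d m])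
    show "(f ^^ m) (u + of_int (-p)) = a" "(f ^^ m) (v + of_int (-p)) = b"
      unfolding iter_add_int u v by simp_all
    show "v + of_int (-p) < r + of_int (-p)" using h_less_imp_less[OF vr(1)] by simp
    show "h (r + of_int (-p)) - h (v + of_int (-p)) < d" using vr(2) unfolding h_add_int by simp
    fix j x assume j: "j < m" and x: "v + of_int (-p) < x" "x < r + of_int (-p)"
    show "\<not> flat_hit a b ((f ^^ j) x)"
    proof
      assume hit0: "flat_hit a b ((f ^^ j) x)"
      define z where "z = x + of_int p"
      have z: "v < z" "z < r" using x unfolding z_def by auto
      have hit: "flat_hit a b ((f ^^ j) z)"
        using hit0 unfolding z_def iter_add_int flat_hit_add_int .
      obtain q :: int where "h ((f ^^ j) z) = of_int q" using h_flat_hit[OF hit] .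
      then have q: "h z = of_int q - real j * \<rho>" by simp
      have "h v \<noteq> h z" using rotation_points_unique(1)[of p m q j] j q hv by auto
      moreover have "h z \<noteq> h r" using good[OF z(2)] hit by auto
      moreover have "h v \<le> h z" "h z \<le> h r" using z by (auto intro: monoD[OF h_mono])
      ultimately show False using first[OF j, of q] q by auto
    qed
  qed
  then show ?thesis by simp
qed

text \<open>Reflection exchanges \<open>a\<close> and \<open>b\<close> and reverses the rotation,
  but keeps \<open>C\<close> and the length of the flat spot. Hence \<open>\<kappa>\<close> is the
  same for the mirror image of each one-sided result.\<close>

lemma reflected: "flat_dynamics (\<lambda>x. - f (- x)) (- b) (- a) C (- \<rho>) (\<lambda>x. - h (- x))"
proof
  show "continuous_on UNIV (\<lambda>x. - f (- x))"
    by (intro continuous_intros continuous_on_compose2[OF f_cont]) auto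
  show "mono (\<lambda>x. - f (- x))" "mono (\<lambda>x. - h (- x))"
    by (auto intro!: monoI monoD[OF f_mono] monoD[OF h_mono])
  fix x
  show "- f (- (x + 1)) = - f (- x) + 1" using f_add1[of "-x - 1"] by simp
  show "- h (- (x + 1)) = - h (- x) + 1" using h_add1[of "-x - 1"] by simp
  show "- h (- (- f (- x))) = - h (- x) + - \<rho>" using h_f by simp
next
  show "- \<rho> \<notin> \<rat>" using irrational by simp
  fix \<alpha> \<beta> \<gamma> \<delta> assume o: "\<alpha> \<le> \<beta>" "- a \<le> \<beta>" "\<beta> < \<gamma>" "\<gamma> \<le> - b + 1" "\<gamma> \<le> \<delta>"
  \<comment> \<open>The mirror image of \<open>{b..a + 1}\<close> has to be translated by 1 to start
    at \<open>-a\<close>; this is why the points below are of the form 1 - x.\<close>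
  have sh: "f (1 - x) = f (- x) + 1" for x using f_add1[of "- x"] by (simp add: add.commute)
  have c1: "cr (1 - \<delta>) (1 - \<gamma>) (1 - \<beta>) (1 - \<alpha>) = cr \<alpha> \<beta> \<gamma> \<delta>"
    using cr_uminus[of \<delta> \<gamma> \<beta> \<alpha>] cr_add[of "-\<delta>" 1 "-\<gamma>" "-\<beta>" "-\<alpha>"] by simp
  have c2: "cr (f (1 - \<delta>)) (f (1 - \<gamma>)) (f (1 - \<beta>)) (f (1 - \<alpha>)) =
      cr (- f (- \<alpha>)) (- f (- \<beta>)) (- f (- \<gamma>)) (- f (- \<delta>))"
    unfolding sh cr_add by (rule cr_uminus[symmetric])
  show "- f (- \<beta>) < - f (- \<gamma>) \<and>
       cr (- f (- \<alpha>)) (- f (- \<beta>)) (- f (- \<gamma>)) (- f (- \<delta>)) \<le> exp (C * (\<delta> - \<alpha>)) * cr \<alpha> \<beta> \<gamma> \<delta>"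
    using cr_step[of "1 - \<delta>" "1 - \<gamma>" "1 - \<beta>" "1 - \<alpha>"] o unfolding c1 c2 by (simp add: sh)
qed (use a_less_b b_less f_flat C_nonneg h_a in auto)

lemma preimage_right_of_point:
  assumes sc: "rotation_scale \<rho> Q d" and d: "d \<le> 1 / 20" and m: "m \<le> c * Q"
    and u: "(f ^^ m) u = a + of_int p" and v: "(f ^^ m) v = b + of_int p"
    and lu: "h l < h u" "h u - h l < d"
    and first: "\<And>j (q::int). j < m \<Longrightarrow> h l < of_int q - real j * \<rho> \<Longrightarrow> \<not> of_int q - real j * \<rho> < h u"
    and good: "\<And>x j. l < x \<Longrightarrow> h x = h l \<Longrightarrow> \<not> flat_hit a b ((f ^^ j) x)"
  shows "\<kappa> c * (u - l) \<le> v - u"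
proof -
  interpret R: flat_dynamics "\<lambda>x. - f (- x)" "- b" "- a" C "- \<rho>" "\<lambda>x. - h (- x)"
    by (rule reflected)
  have it: "((\<lambda>x. - f (- x)) ^^ n) x = - (f ^^ n) (- x)" for n x
    by (induction n) auto
  have "R.\<kappa> c * (- l - (- u)) \<le> - u - (- v)"
  proof (rule R.preimage_left_of_point[OF rotation_scale_uminus[OF sc] d m, where p = "- p"])
    fix j :: nat and q :: int
    assume j: "j < m" "- h (- (- u)) < of_int q - real j * - \<rho>"
    show "\<not> of_int q - real j * - \<rho> < - h (- (- l))"
    proof
      assume "of_int q - real j * - \<rho> < - h (- (- l))"
      then show False using first[OF j(1), of "- q"] j(2) by simp
    qed
  next
    fix x j assume "x < - l" "- h (- x) = - h (- (- l))"
    then show "\<not> flat_hit (- b) (- a) (((\<lambda>x. - f (- x)) ^^ j) x)"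
      unfolding it flat_hit_uminus using good[of "- x" j] by simp
  qed (use u v lu in \<open>simp_all add: it\<close>)
  moreover have "R.\<kappa> c = \<kappa> c" unfolding R.\<kappa>_def \<kappa>_def by simp
  ultimately show ?thesis by simp
qed

end

section \<open>Rotation number and semiconjugacy\<close>

text \<open>The displacement of \<open>f ^^ n\<close> varies by at most 1 with the point, so
  \<open>s\<close> is multiplicative along multiples up to an error 1 per block and its averages are
  Cauchy. The uniform bound, beyond the existence of the limit, makes the upper limit in
  \<open>semiconjugacy_exists\<close> finite.\<close>

lemma translation_number_bound:
  fixes f :: "real \<Rightarrow> real"
  assumes f: "mono f" "\<And>x. f (x + 1) = f x + 1"
  obtains L where "\<And>n x. \<bar>(f ^^ n) x - x - real n * L\<bar> \<le> 2"
proof -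
  have fa: "f (x + of_int p) = f x + of_int p" for x p
    using f(2) by (rule add_int_of_add1)
  have it: "(f ^^ n) (x + of_int p) = (f ^^ n) x + of_int p" for n x p
    by (induction n) (auto simp: fa)
  define s where "s = (\<lambda>n. (f ^^ n) 0)"
  have near: "\<bar>(f ^^ n) x - x - s n\<bar> \<le> 1" for n x
  proof -
    define t where "t = x - of_int \<lfloor>x\<rfloor>"
    have t: "0 \<le> t" "t < 1" unfolding t_def by linarith+
    have "(f ^^ n) 0 \<le> (f ^^ n) t" "(f ^^ n) t \<le> (f ^^ n) 1"
      using t by (auto intro!: funpow_mono[OF f(1)])
    moreover have "(f ^^ n) 1 = s n + 1" using it[of n 0 1] by (simp add: s_def)
    moreover have "(f ^^ n) x = (f ^^ n) t + of_int \<lfloor>x\<rfloor>" using it[of n t "\<lfloor>x\<rfloor>"] by (simp add: t_def)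
    ultimately show ?thesis using t unfolding s_def t_def by linarith
  qed
  have mult: "\<bar>s (k * n) - real k * s n\<bar> \<le> real k" for k n
  proof (induction k)
    case (Suc k)
    have "s (Suc k * n) = (f ^^ n) (s (k * n))" unfolding s_def by (simp add: funpow_add)
    then show ?case using near[of n "s (k * n)"] Suc.IH by (simp add: algebra_simps)
  qed (simp add: s_def)
  have scale: "\<bar>z / (k * n) - w / n\<bar> = \<bar>z - k * w\<bar> / (k * n)" if "k > 0" "n > 0" for z w k n :: real
  proof -
    have "z / (k * n) - w / n = (z - k * w) / (k * n)" using that by (simp add: field_simps)
    then show ?thesis using that by (simp add: abs_divide abs_mult)
  qed
  have close: "\<bar>s n / real n - s m / real m\<bar> \<le> 1 / real n + 1 / real m" if "n > 0" "m > 0" for n m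
  proof -
    have "\<bar>s (m * n) / (real m * real n) - s n / real n\<bar> = \<bar>s (m * n) - real m * s n\<bar> / (real m * real n)"
      using that by (intro scale) auto
    also have "\<dots> \<le> real m / (real m * real n)" using mult[of m n] by (intro divide_right_mono) auto
    finally have 1: "\<bar>s (m * n) / (real m * real n) - s n / real n\<bar> \<le> 1 / real n" using that by simp
    have "\<bar>s (n * m) / (real n * real m) - s m / real m\<bar> = \<bar>s (n * m) - real n * s m\<bar> / (real n * real m)"
      using that by (intro scale) auto
    also have "\<dots> \<le> real n / (real n * real m)" using mult[of n m] by (intro divide_right_mono) auto
    finally have 2: "\<bar>s (n * m) / (real n * real m) - s m / real m\<bar> \<le> 1 / real m" using that by simp
    show ?thesis using 1 2 by (simp add: mult.commute)
  qed
  have "Cauchy (\<lambda>n. s (Suc n) / real (Suc n))"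
  proof (rule metric_CauchyI)
    fix e :: real assume "e > 0"
    obtain N :: nat where N: "2 / e < real N" using reals_Archimedean2 by blast
    have "N > 0" using N \<open>e > 0\<close> by (metis divide_pos_pos gr0I less_trans of_nat_0 less_irrefl zero_less_numeral)
    have small: "1 / real (Suc n) < e / 2" if "n \<ge> N" for n
    proof -
      have "2 / e < real (Suc n)" using N that by simp
      then show ?thesis using \<open>e > 0\<close> by (simp add: field_simps)
    qed
    show "\<exists>M. \<forall>m\<ge>M. \<forall>n\<ge>M. dist (s (Suc m) / real (Suc m)) (s (Suc n) / real (Suc n)) < e"
    proof (intro exI allI impI)
      fix m n assume "m \<ge> N" "n \<ge> N"
      then show "dist (s (Suc m) / real (Suc m)) (s (Suc n) / real (Suc n)) < e"
        using close[of "Suc m" "Suc n"] small[of m] small[of n] unfolding dist_real_def by linarith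
    qed
  qed
  then obtain L where L: "(\<lambda>n. s (Suc n) / real (Suc n)) \<longlonglongrightarrow> L"
    using Cauchy_convergent convergent_def by blast
  have sL: "\<bar>s n - real n * L\<bar> \<le> 1" for n
  proof (cases "n = 0")
    case False
    have t1: "(\<lambda>m. 1 / real n + inverse (real (Suc m))) \<longlonglongrightarrow> 1 / real n + 0"
      by (intro tendsto_intros LIMSEQ_inverse_real_of_nat)
    have t2: "(\<lambda>m. \<bar>s n / real n - s (Suc m) / real (Suc m)\<bar>) \<longlonglongrightarrow> \<bar>s n / real n - L\<bar>"
      by (intro tendsto_intros L)
    have "\<bar>s n / real n - L\<bar> \<le> 1 / real n + 0"
      by (rule LIMSEQ_le[OF t2 t1]) (use close[of n "Suc _"] False in \<open>auto simp: inverse_eq_divide\<close>)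
    then have "real n * \<bar>s n / real n - L\<bar> \<le> real n * (1 / real n)" by (intro mult_left_mono) auto
    moreover have "real n * \<bar>s n / real n - L\<bar> = \<bar>s n - real n * L\<bar>"
      using False abs_mult_pos[of "real n" "s n / real n - L"] by (simp add: algebra_simps)
    ultimately show ?thesis using False by simp
  qed (simp add: s_def)
  show ?thesis
  proof (rule that)
    fix n x show "\<bar>(f ^^ n) x - x - real n * L\<bar> \<le> 2" using near[of n x] sL[of n] by linarith
  qed
qed

lemma translation_number_limit:
  fixes f :: "real \<Rightarrow> real"
  assumes "\<And>n x. \<bar>(f ^^ n) x - x - real n * L\<bar> \<le> 2"
  shows "(\<lambda>n. (f ^^ n) x / real n) \<longlonglongrightarrow> L"
proof -
  have "(\<lambda>n. (f ^^ n) x / real n - L) \<longlonglongrightarrow> 0"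
  proof (rule Lim_null_comparison)
    show "(\<lambda>n. (\<bar>x\<bar> + 2) / real n) \<longlonglongrightarrow> 0" by (rule lim_const_over_n)
    show "\<forall>\<^sub>F n in sequentially. norm ((f ^^ n) x / real n - L) \<le> (\<bar>x\<bar> + 2) / real n"
    proof (rule eventually_sequentiallyI[of 1])
      fix n :: nat assume "1 \<le> n"
      then have "(f ^^ n) x / real n - L = ((f ^^ n) x - real n * L) / real n" by (simp add: field_simps)
      moreover have "\<bar>(f ^^ n) x - real n * L\<bar> \<le> \<bar>x\<bar> + 2" using assms[of n x] by linarith
      ultimately show "norm ((f ^^ n) x / real n - L) \<le> (\<bar>x\<bar> + 2) / real n"
        by (simp add: abs_divide divide_right_mono)
    qed
  qed
  then show ?thesis by (simp add: LIM_zero_iff)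
qed

text \<open>The upper limit of \<open>(f ^^ n) x - real n * L\<close> is monotone in
  \<open>x\<close> and insensitive to a shift of the index, which yields the functional equation;
  subtracting a constant normalises it at \<open>b\<close>.\<close>

lemma semiconjugacy_exists:
  fixes f :: "real \<Rightarrow> real"
  assumes f: "mono f" "\<And>x. f (x + 1) = f x + 1"
    and L: "\<And>n x. \<bar>(f ^^ n) x - x - real n * L\<bar> \<le> 2"
  obtains h where "mono h" "\<And>x. h (f x) = h x + L" "\<And>x. h (x + 1) = h x + 1" "h (b::real) = 0"
proof -
  define u where "u = (\<lambda>x n. (f ^^ n) x - real n * L)"
  define H where "H = (\<lambda>x. limsup (\<lambda>n. ereal (u x n)))"
  define h where "h = (\<lambda>x. real_of_ereal (H x))"
  have fin: "\<bar>H x\<bar> \<noteq> \<infinity>" for x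
  proof -
    have bd: "x - 2 \<le> u x n" "u x n \<le> x + 2" for n using L[of n x] unfolding u_def by linarith+
    have "H x \<le> ereal (x + 2)" unfolding H_def
      using bd by (intro Limsup_bounded) auto
    moreover have "ereal (x - 2) \<le> H x" unfolding H_def
      using bd by (intro le_Limsup) auto
    ultimately show ?thesis by auto
  qed
  have Hh: "H x = ereal (h x)" for x unfolding h_def using fin by (simp add: ereal_real')
  have "mono h"
  proof (rule monoI)
    fix x y :: real assume "x \<le> y"
    then have "u x n \<le> u y n" for n unfolding u_def using funpow_mono[OF f(1), of x y n] by simp
    then have "H x \<le> H y" unfolding H_def by (intro Limsup_mono) auto
    then show "h x \<le> h y" unfolding Hh by simp
  qed
  moreover have "h (f x) = h x + L" for x
  proof -
    have "H (f x) = limsup (\<lambda>n. ereal (u x (Suc n)) + ereal L)"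
      unfolding H_def u_def by (intro arg_cong[of _ _ limsup] ext) (simp add: funpow_swap1 algebra_simps)
    also have "\<dots> = limsup (\<lambda>n. ereal (u x (Suc n))) + ereal L"
      by (rule Limsup_add_ereal_right) auto
    also have "limsup (\<lambda>n. ereal (u x (Suc n))) = H x"
      unfolding H_def using limsup_shift[of "\<lambda>n. ereal (u x n)"] by simp
    finally show ?thesis unfolding Hh by simp
  qed
  moreover have "h (x + 1) = h x + 1" for x
  proof -
    have it: "(f ^^ n) (x + 1) = (f ^^ n) x + 1" for n
      by (induction n) (auto simp: f(2))
    have "H (x + 1) = limsup (\<lambda>n. ereal (u x n) + ereal 1)"
      unfolding H_def u_def by (intro arg_cong[of _ _ limsup] ext) (simp add: it)
    also have "\<dots> = H x + ereal 1"
      unfolding H_def by (rule Limsup_add_ereal_right) auto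
    finally show ?thesis unfolding Hh by simp
  qed
  ultimately show ?thesis
    using that[of "\<lambda>x. h x - h b"] by (auto simp: mono_def)
qed

section \<open>Lifts of circle maps and their rotation number\<close>

lemma circ_proj_eq_iff: "circ_proj x = circ_proj y \<longleftrightarrow> (\<exists>n::int. x = y + of_int n)"
proof -
  have "circ_proj x = circ_proj y \<longleftrightarrow>
      sin (2 * pi * x) = sin (2 * pi * y) \<and> cos (2 * pi * x) = cos (2 * pi * y)"
    unfolding circ_proj_def by (auto simp: complex_eq_iff)
  also have "\<dots> \<longleftrightarrow> (\<exists>n::int. 2 * pi * x = 2 * pi * y + 2 * pi * of_int n)"
    by (rule sin_cos_eq_iff)
  also have "\<dots> \<longleftrightarrow> (\<exists>n::int. x = y + of_int n)"
  proof -
    have "2 * pi * x = 2 * pi * y + 2 * pi * of_int n \<longleftrightarrow> x = y + of_int n" for n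
      unfolding distrib_left[symmetric] by simp
    then show ?thesis by simp
  qed
  finally show ?thesis .
qed

lemma integer_valued_constant:
  fixes D :: "real \<Rightarrow> real"
  assumes "connected S" "continuous_on S D" "\<And>x. x \<in> S \<Longrightarrow> \<exists>n::int. D x = of_int n"
    and "x \<in> S" "y \<in> S"
  shows "D x = D y"
proof -
  have "D constant_on S"
  proof (rule continuous_discrete_range_constant[OF assms(1,2)])
    fix x assume x: "x \<in> S"
    show "\<exists>e>0. \<forall>y. y \<in> S \<and> D y \<noteq> D x \<longrightarrow> e \<le> norm (D y - D x)"
    proof (intro exI[of _ 1] conjI allI impI)
      fix y assume y: "y \<in> S \<and> D y \<noteq> D x"
      obtain m n :: int where mn: "D y = of_int m" "D x = of_int n" using assms(3) x y by meson
      then have "1 \<le> \<bar>m - n\<bar>" using y by auto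
      then have "(1 :: real) \<le> of_int \<bar>m - n\<bar>" by linarith
      then show "1 \<le> norm (D y - D x)" using mn by simp
    qed simp
  qed
  then show ?thesis using assms(4,5) unfolding constant_on_def by auto
qed

lemma lifts_differ_by_int:
  assumes "is_lift f F" "is_lift g F"
  obtains k :: int where "\<And>x. g x = f x + of_int k"
proof -
  define D where "D = (\<lambda>x. g x - f x)"
  have int: "\<exists>n::int. D x = of_int n" for x
  proof -
    have "circ_proj (g x) = circ_proj (f x)" using assms unfolding is_lift_def by simp
    then show ?thesis unfolding circ_proj_eq_iff D_def by (auto simp: algebra_simps)
  qed
  have cont: "continuous_on UNIV D"
    using assms unfolding D_def is_lift_def by (auto intro: continuous_intros)
  have c: "D x = D 0" for x
    by (rule integer_valued_constant[OF connected_UNIV cont int]) auto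
  obtain k :: int where "D 0 = of_int k" using int by blast
  then have "g x = f x + of_int k" for x using c[of x] unfolding D_def by simp
  then show ?thesis by (rule that)
qed

text \<open>Another lift differs by an integer constant, which is added to the limit and disappears
  in the fractional part.\<close>

lemma rotation_number_eq:
  assumes f: "is_lift f F" "\<And>x. f (x + 1) = f x + 1"
    and L: "\<And>n x. \<bar>(f ^^ n) x - x - real n * L\<bar> \<le> 2"
  shows "rotation_number F = frac L"
  unfolding rotation_number_def
proof (rule the_equality)
  show "\<forall>g x. is_lift g F \<longrightarrow> (\<exists>L'. (\<lambda>n. (g ^^ n) x / real n) \<longlonglongrightarrow> L' \<and> frac L = frac L')"
  proof (intro allI impI)
    fix g x assume "is_lift g F"
    then obtain k :: int where k: "\<And>x. g x = f x + of_int k" using lifts_differ_by_int[OF f(1)] by blast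
    have fa: "f (x + of_int p) = f x + of_int p" for x p
      using f(2) by (rule add_int_of_add1)
    have it: "(g ^^ n) x = (f ^^ n) x + real n * of_int k" for n
    proof (induction n)
      case (Suc n)
      have "real n * of_int k = of_int (int n * k)" by simp
      then show ?case using Suc by (simp only: funpow.simps o_apply k fa) (simp add: algebra_simps)
    qed simp
    have "(\<lambda>n. (g ^^ n) x / real n) \<longlonglongrightarrow> L + of_int k"
    proof (rule Lim_transform_eventually)
      show "(\<lambda>n. (f ^^ n) x / real n + of_int k) \<longlonglongrightarrow> L + of_int k"
        by (intro tendsto_intros translation_number_limit[OF L])
      show "\<forall>\<^sub>F n in sequentially. (f ^^ n) x / real n + of_int k = (g ^^ n) x / real n"
        by (rule eventually_sequentiallyI[of 1]) (simp add: it add_divide_distrib)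
    qed
    then show "\<exists>L'. (\<lambda>n. (g ^^ n) x / real n) \<longlonglongrightarrow> L' \<and> frac L = frac L'"
      by (intro exI[of _ "L + of_int k"]) (simp add: frac_def)
  qed
  fix r assume "\<forall>g x. is_lift g F \<longrightarrow> (\<exists>L'. (\<lambda>n. (g ^^ n) x / real n) \<longlonglongrightarrow> L' \<and> r = frac L')"
  then obtain L' where "(\<lambda>n. (f ^^ n) 0 / real n) \<longlonglongrightarrow> L'" "r = frac L'" using f(1) by blast
  then show "r = frac L" using translation_number_limit[OF L, of 0] LIMSEQ_unique by blast
qed

section \<open>Continued fractions\<close>

fun cf_num :: "real \<Rightarrow> nat \<Rightarrow> int" where
  "cf_num r 0 = cf_digit r 0"
| "cf_num r (Suc 0) = cf_digit r 1 * cf_digit r 0 + 1"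
| "cf_num r (Suc (Suc n)) = cf_digit r (Suc (Suc n)) * cf_num r (Suc n) + cf_num r n"

text \<open>By \<open>cf_denom_error\<close> this is the distance from
  \<open>cf_denom r n * r\<close> to \<open>cf_num r n\<close>. In the product form positivity and
  monotonicity are immediate.\<close>

definition cf_error :: "real \<Rightarrow> nat \<Rightarrow> real" where
  "cf_error r n = (\<Prod>i\<le>n. frac (cf_tail r i))"

context
  fixes r :: real
  assumes irr: "r \<notin> \<rat>"
begin

lemma cf_tail_irrational: "cf_tail r n \<notin> \<rat>"
proof (induction n)
  case (Suc n)
  show ?case
  proof
    assume "cf_tail r (Suc n) \<in> \<rat>"
    then have "1 / cf_tail r (Suc n) \<in> \<rat>" by (intro Rats_divide) auto
    then have "frac (cf_tail r n) \<in> \<rat>" by simp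
    then have "frac (cf_tail r n) + of_int \<lfloor>cf_tail r n\<rfloor> \<in> \<rat>" by (intro Rats_add) auto
    then show False using Suc by (simp add: frac_def)
  qed
qed (simp add: irr)

lemma frac_cf_tail: "0 < frac (cf_tail r n)" "frac (cf_tail r n) < 1"
proof -
  have "frac (cf_tail r n) \<noteq> 0"
    using cf_tail_irrational[of n] by (auto simp: frac_eq_0_iff dest: Ints_subset_Rats[THEN subsetD])
  then show "0 < frac (cf_tail r n)" "frac (cf_tail r n) < 1"
    using frac_ge_0[of "cf_tail r n"] frac_lt_1[of "cf_tail r n"] by linarith+
qed

lemma cf_digit_pos: "cf_digit r (Suc n) \<ge> 1"
proof -
  have "1 \<le> cf_tail r (Suc n)" using frac_cf_tail[of n] by simp
  then show ?thesis unfolding cf_digit_def by (simp add: le_floor_iff)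
qed

lemma cf_error_pos: "cf_error r n > 0"
  unfolding cf_error_def using frac_cf_tail by (intro prod_pos) auto

lemma cf_error_Suc: "cf_error r (Suc n) = cf_error r n * frac (cf_tail r (Suc n))"
  unfolding cf_error_def by simp

lemma cf_error_decreasing: "cf_error r (Suc n) < cf_error r n"
  unfolding cf_error_Suc using cf_error_pos[of n] frac_cf_tail[of "Suc n"] by simp

lemma frac_mult_frac: "frac (cf_tail r n) * frac (cf_tail r (Suc n)) =
    1 - of_int (cf_digit r (Suc n)) * frac (cf_tail r n)"
proof -
  have "frac (cf_tail r (Suc n)) = 1 / frac (cf_tail r n) - of_int (cf_digit r (Suc n))"
    unfolding cf_digit_def by (simp add: frac_def)
  then show ?thesis
    using frac_cf_tail(1)[of n] by (simp only: right_diff_distrib) (simp add: mult.commute)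
qed

lemma cf_error_rec:
  "cf_error r (Suc (Suc n)) = cf_error r n - of_int (cf_digit r (Suc (Suc n))) * cf_error r (Suc n)"
proof -
  have "cf_error r (Suc (Suc n)) =
      cf_error r n * (frac (cf_tail r (Suc n)) * frac (cf_tail r (Suc (Suc n))))"
    by (simp add: cf_error_Suc)
  also have "\<dots> = cf_error r n - of_int (cf_digit r (Suc (Suc n))) * cf_error r (Suc n)"
    unfolding frac_mult_frac cf_error_Suc[of n] by (simp add: algebra_simps)
  finally show ?thesis .
qed

lemma cf_denom_error:
  "of_int (cf_denom r n) * r - of_int (cf_num r n) = (-1) ^ n * cf_error r n"
proof (induction n rule: induct_nat_012)
  case 0
  then show ?case by (simp add: cf_error_def cf_digit_def frac_def)
next
  case 1
  show ?case
    using frac_mult_frac[of 0] unfolding cf_error_def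
    by (simp add: cf_digit_def frac_def algebra_simps)
next
  case (ge2 n)
  have "of_int (cf_denom r (Suc (Suc n))) * r - of_int (cf_num r (Suc (Suc n))) =
     of_int (cf_digit r (Suc (Suc n))) * (of_int (cf_denom r (Suc n)) * r - of_int (cf_num r (Suc n))) +
     (of_int (cf_denom r n) * r - of_int (cf_num r n))"
    by (simp add: algebra_simps)
  also have "\<dots> = (-1) ^ Suc (Suc n) * cf_error r (Suc (Suc n))"
    unfolding ge2 cf_error_rec[of n] by (simp add: algebra_simps)
  finally show ?case .
qed

lemma cf_denom_pos: "cf_denom r n \<ge> 1"
proof (induction n rule: induct_nat_012)
  case (ge2 n)
  have "1 * 1 \<le> cf_digit r (Suc (Suc n)) * cf_denom r (Suc n)"
    using cf_digit_pos[of "Suc n"] ge2 by (intro mult_mono) auto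
  then show ?case using ge2 by simp
qed (use cf_digit_pos[of 0] in auto)

lemma cf_denom_rec_le: "cf_denom r (Suc n) + cf_denom r n \<le> cf_denom r (Suc (Suc n))"
  using mult_right_mono[OF cf_digit_pos[of "Suc n"], of "cf_denom r (Suc n)"] cf_denom_pos[of "Suc n"] by simp

lemma cf_denom_mono: "cf_denom r n \<le> cf_denom r (Suc n)"
proof (cases n)
  case 0 then show ?thesis using cf_digit_pos[of 0] by simp
next
  case (Suc m)
  then show ?thesis using cf_denom_rec_le[of m] cf_denom_pos[of m] by simp
qed

lemma cf_denom_ge: "int n \<le> cf_denom r n"
proof (induction n rule: induct_nat_012)
  case (ge2 n)
  then show ?case using cf_denom_rec_le[of n] cf_denom_pos[of n] by (simp del: cf_denom.simps)
qed (use cf_denom_pos[of "Suc 0"] in auto)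

lemma cf_error_tendsto_0: "cf_error r \<longlonglongrightarrow> 0"
proof -
  have half: "cf_error r (Suc (Suc n)) \<le> cf_error r n / 2" for n
  proof -
    have "1 * cf_error r (Suc n) \<le> of_int (cf_digit r (Suc (Suc n))) * cf_error r (Suc n)"
      using cf_digit_pos[of "Suc n"] cf_error_pos[of "Suc n"] by (intro mult_right_mono) auto
    then have "cf_error r (Suc (Suc n)) \<le> cf_error r n - cf_error r (Suc n)"
      using cf_error_rec[of n] by simp
    then show ?thesis using cf_error_decreasing[of "Suc n"] by linarith
  qed
  have dec: "decseq (cf_error r)"
    using cf_error_decreasing by (intro decseq_SucI less_imp_le)
  obtain l where l: "cf_error r \<longlonglongrightarrow> l"
    using decseq_convergent[OF dec, of 0] cf_error_pos less_imp_le by metis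
  have "l \<le> l / 2"
  proof (rule LIMSEQ_le)
    show "(\<lambda>n. cf_error r (Suc (Suc n))) \<longlonglongrightarrow> l" using l LIMSEQ_Suc by blast
    show "(\<lambda>n. cf_error r n / 2) \<longlonglongrightarrow> l / 2" by (intro tendsto_intros l) simp
  qed (use half in auto)
  moreover have "l \<ge> 0" using l cf_error_pos less_imp_le by (intro LIMSEQ_le_const[OF l]) blast
  ultimately have "l = 0" by simp
  then show ?thesis using l by simp
qed

lemma cf_det: "cf_num r (Suc n) * cf_denom r n - cf_num r n * cf_denom r (Suc n) = (-1) ^ n"
proof (induction n)
  case (Suc n)
  then show ?case by (simp add: algebra_simps)
qed simp

text \<open>Two consecutive convergents form a basis of the integer lattice. The bounds on
  \<open>j\<close> force the first coefficient to be nonzero and the two coefficients to have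
  opposite weak signs. Since the errors of the convergents alternate in sign, the two contributions
  add up instead of cancelling.\<close>

lemma best_approximation:
  assumes j: "0 < j" "j < cf_denom r (Suc n)"
  shows "cf_error r n \<le> \<bar>of_int j * r - of_int p\<bar>"
proof -
  define q0 q1 p0 p1 where "q0 = cf_denom r n" "q1 = cf_denom r (Suc n)"
    "p0 = cf_num r n" "p1 = cf_num r (Suc n)"
  note d = q0_q1_p0_p1_def
  define s where "s = (-1 :: int) ^ n"
  have ss: "s * s = 1" unfolding s_def by (simp flip: power_add)
  have det: "p1 * q0 - p0 * q1 = s" unfolding d s_def using cf_det .
  \<comment> \<open>Cramer's rule; the determinant \<open>s\<close> is 1 or -1, so multiplication by
    \<open>s\<close> is division by it.\<close>
  define x y where "x = s * (p1 * j - q1 * p)" "y = s * (q0 * p - p0 * j)"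
  have "x * q0 + y * q1 = s * (p1 * q0 - p0 * q1) * j" unfolding x_y_def by (simp add: algebra_simps)
  then have jj: "j = x * q0 + y * q1" using ss unfolding det by simp
  have "x * p0 + y * p1 = s * (p1 * q0 - p0 * q1) * p" unfolding x_y_def by (simp add: algebra_simps)
  then have pp: "p = x * p0 + y * p1" using ss unfolding det by simp
  have q: "q0 \<ge> 1" "q1 \<ge> 1" unfolding d using cf_denom_pos by auto
  have j': "0 < j" "j < q1" using j unfolding d .
  have x0: "x \<noteq> 0"
  proof
    assume "x = 0"
    then have "0 < y * q1" "y * q1 < q1" using j' jj by auto
    then have "0 < y" "y < 1" using q by (auto simp: zero_less_mult_iff)
    then show False by simp
  qed
  have opp: "(x > 0 \<and> y \<le> 0) \<or> (x < 0 \<and> y \<ge> 0)"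
  proof (rule ccontr)
    assume "\<not> ?thesis"
    then have "(x > 0 \<and> y > 0) \<or> (x < 0 \<and> y < 0)" using x0 by auto
    then show False
    proof
      assume xy: "x > 0 \<and> y > 0"
      then have "1 * q1 \<le> y * q1" "0 < x * q0" using q by (auto intro: mult_right_mono)
      then show False using j' jj by linarith
    next
      assume "x < 0 \<and> y < 0"
      then have "x * q0 < 0" "y * q1 < 0" using q by (auto simp: mult_less_0_iff)
      then show False using j' jj by linarith
    qed
  qed
  define A B where "A = of_int x * cf_error r n" "B = of_int y * cf_error r (Suc n)"
  have "of_int j * r - of_int p = of_int x * (of_int q0 * r - of_int p0) + of_int y * (of_int q1 * r - of_int p1)"
    unfolding jj pp by (simp add: algebra_simps)
  also have "\<dots> = (-1) ^ n * (A - B)"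
    unfolding d cf_denom_error A_B_def by (simp add: algebra_simps)
  finally have eq: "\<bar>of_int j * r - of_int p\<bar> = \<bar>A - B\<bar>" by (simp add: abs_mult power_abs)
  have e: "cf_error r n > 0" "cf_error r (Suc n) > 0" using cf_error_pos by auto
  show ?thesis
  proof (cases "x > 0")
    case True
    then have "1 \<le> (of_int x :: real)" "(of_int y :: real) \<le> 0" using opp by auto
    then have "1 * cf_error r n \<le> A" "B \<le> 0" unfolding A_B_def using e
      by (auto intro!: mult_right_mono simp: mult_le_0_iff)
    then show ?thesis unfolding eq by linarith
  next
    case False
    then have "x \<le> - 1" "y \<ge> 0" using opp by auto
    then have "(of_int x :: real) \<le> - 1" "(of_int y :: real) \<ge> 0" by linarith+
    then have "B \<ge> 0" unfolding A_B_def using e by simp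
    moreover have "A \<le> (- 1) * cf_error r n"
      unfolding A_B_def using \<open>of_int x \<le> (- 1 :: real)\<close> e by (intro mult_right_mono) auto
    ultimately show ?thesis unfolding eq by linarith
  qed
qed

end

section \<open>Hitting times of the rotation\<close>

lemma walk_hits_interval:
  fixes S :: "real set"
  assumes s0: "s0 \<in> S" "s0 < t" and e: "e > 0"
    and step: "\<And>s. s \<in> S \<Longrightarrow> \<exists>s'\<in>S. s + e \<le> s' \<and> s' \<le> s + D"
  shows "\<exists>s\<in>S. t \<le> s \<and> s < t + D"
proof -
  obtain g where g: "\<And>s. s \<in> S \<Longrightarrow> g s \<in> S \<and> s + e \<le> g s \<and> g s \<le> s + D"
    using step by metis
  have inS: "(g ^^ n) s0 \<in> S" for n by (induction n) (use s0 g in auto)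
  have grow: "s0 + real n * e \<le> (g ^^ n) s0" for n
  proof (induction n)
    case (Suc n)
    then show ?case using g[OF inS[of n]] by (simp add: algebra_simps)
  qed simp
  obtain N :: nat where N: "(t - s0) / e < real N" using reals_Archimedean2 by blast
  then have "t \<le> (g ^^ N) s0" using grow[of N] e by (simp add: field_simps)
  \<comment> \<open>First passage: the predecessor is still below \<open>t\<close>, so
    \<open>t\<close> is overshot by less than one step.\<close>
  define n where "n = (LEAST n. t \<le> (g ^^ n) s0)"
  have n: "t \<le> (g ^^ n) s0" unfolding n_def using \<open>t \<le> (g ^^ N) s0\<close> by (rule LeastI)
  then obtain k where k: "n = Suc k" using s0 by (cases n) auto
  have "(g ^^ k) s0 < t" using not_less_Least[of k "\<lambda>n. t \<le> (g ^^ n) s0"] k unfolding n_def by auto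
  then show ?thesis using n g[OF inS[of k]] inS[of n] unfolding k by (intro bexI[of _ "(g ^^ Suc k) s0"]) auto
qed

text \<open>Separation is best approximation. For density, walk on the points with 1 \<le> j \<le>
  q1: a change of \<open>j\<close> by \<open>q0\<close> moves by \<open>\<delta>\<close>, and if it
  leaves the range, a change by \<open>q1\<close> repairs this and adds \<open>\<delta>'\<close>,
  which is less than \<open>\<delta>\<close>. The parity of \<open>n\<close> decides the direction.
  The integer \<open>z\<close> accounts for the difference between a translation number and its
  fractional part.\<close>

lemma cf_rotation_scale:
  fixes r :: real
  assumes irr: "r \<notin> \<rat>"
  shows "rotation_scale (r + of_int z) (nat (cf_denom r (Suc n))) (cf_error r n)"
proof -
  define q0 q1 p0 p1 where "q0 = cf_denom r n" "q1 = cf_denom r (Suc n)"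
    "p0 = cf_num r n" "p1 = cf_num r (Suc n)"
  note d = q0_q1_p0_p1_def
  define \<delta> \<delta>' where "\<delta> = cf_error r n" "\<delta>' = cf_error r (Suc n)"
  note e = \<delta>_\<delta>'_def
  have q: "1 \<le> q0" "1 \<le> q1" "q0 \<le> q1"
    unfolding d using cf_denom_pos[OF irr] cf_denom_mono[OF irr] by auto
  have \<delta>: "0 < \<delta>" "0 < \<delta>'" "\<delta>' < \<delta>"
    unfolding e using cf_error_pos[OF irr] cf_error_decreasing[OF irr] by auto
  have er: "of_int q0 * r = of_int p0 + (-1) ^ n * \<delta>" "of_int q1 * r = of_int p1 - (-1) ^ n * \<delta>'"
    using cf_denom_error[OF irr, of n] cf_denom_error[OF irr, of "Suc n"] unfolding d e by auto
  define S where "S = {x. \<exists>j p. 1 \<le> j \<and> j \<le> q1 \<and> x = of_int j * r + of_int p}"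
  have SI: "of_int j * r + of_int p \<in> S" if "1 \<le> j" "j \<le> q1" for j p
    using that unfolding S_def by blast
  have step: "\<exists>s'\<in>S. s + \<delta> \<le> s' \<and> s' \<le> s + 2 * \<delta>" if "s \<in> S" for s
  proof -
    obtain j p where j: "1 \<le> j" "j \<le> q1" and s: "s = of_int j * r + of_int p"
      using \<open>s \<in> S\<close> unfolding S_def by blast
    consider (a) "even n" "j + q0 \<le> q1" | (b) "even n" "q1 < j + q0" | (c) "odd n" "q0 < j" | (d) "odd n" "j \<le> q0"
      by linarith
    then obtain j' p' where "1 \<le> j'" "j' \<le> q1"
      "s + \<delta> \<le> of_int j' * r + of_int p'" "of_int j' * r + of_int p' \<le> s + 2 * \<delta>"
    proof cases
      case a
      show ?thesis by (rule that[of "j + q0" "p - p0"]) (use a j q \<delta> er s in \<open>auto simp: distrib_right\<close>)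
    next
      case b
      show ?thesis by (rule that[of "j + q0 - q1" "p - p0 + p1"])
        (use b j q \<delta> er s in \<open>auto simp: distrib_right left_diff_distrib\<close>)
    next
      case c
      show ?thesis by (rule that[of "j - q0" "p + p0"]) (use c j q \<delta> er s in \<open>auto simp: left_diff_distrib\<close>)
    next
      case d
      show ?thesis by (rule that[of "j - q0 + q1" "p + p0 - p1"])
        (use d j q \<delta> er s in \<open>auto simp: distrib_right left_diff_distrib\<close>)
    qed
    then show ?thesis using SI[of j' p'] by blast
  qed
  have hit: "\<exists>j p. 1 \<le> j \<and> j \<le> q1 \<and> t \<le> of_int j * r + of_int p \<and> of_int j * r + of_int p \<le> t + 2 * \<delta>" for t
  proof -
    have "of_int 1 * r + of_int (\<lfloor>t - r\<rfloor> - 1) \<in> S" using q by (intro SI) auto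
    moreover have "of_int 1 * r + of_int (\<lfloor>t - r\<rfloor> - 1) < t" by simp linarith
    ultimately have "\<exists>s\<in>S. t \<le> s \<and> s < t + 2 * \<delta>"
      using \<delta>(1) step by (rule walk_hits_interval)
    then show ?thesis unfolding S_def by fastforce
  qed
  show ?thesis
    unfolding rotation_scale_def
  proof (intro conjI allI impI)
    show "cf_error r n > 0" using \<delta> e by simp
    show "nat (cf_denom r (Suc n)) \<ge> 1" using q d by simp
    fix j :: nat and p :: int assume j: "0 < j \<and> j < nat (cf_denom r (Suc n))"
    have "cf_error r n \<le> \<bar>of_int (int j) * r - of_int (p - int j * z)\<bar>"
      using j by (intro best_approximation[OF irr]) auto
    then show "cf_error r n \<le> \<bar>real j * (r + of_int z) - of_int p\<bar>" by (simp add: algebra_simps)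
  next
    fix t
    obtain j p where j: "1 \<le> j" "j \<le> q1" "t \<le> of_int j * r + of_int p" "of_int j * r + of_int p \<le> t + 2 * \<delta>"
      using hit by blast
    show "\<exists>j p. 1 \<le> j \<and> j \<le> nat (cf_denom r (Suc n)) \<and> t \<le> real j * (r + of_int z) + of_int p \<and>
        real j * (r + of_int z) + of_int p \<le> t + 2 * cf_error r n"
      by (rule exI[of _ "nat j"], rule exI[of _ "p - j * z"])
         (use j d e in \<open>auto simp: algebra_simps nat_le_eq_zle\<close>)
  qed
qed

text \<open>Restricting \<open>j\<close> to the range below \<open>q0 + q1\<close> makes a step of
  exactly \<open>\<delta>\<close> or \<open>\<delta>'\<close> to the right always possible, so the
  walk meets each window of length \<open>\<delta>\<close>.\<close>

lemma cf_backward_hit: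
  fixes r t :: real
  assumes irr: "r \<notin> \<rat>"
  obtains m and p :: int where "m \<le> 4 * nat (cf_denom r (Suc n))"
    "t < of_int p - real m * (r + of_int z)" "of_int p - real m * (r + of_int z) < t + cf_error r n"
proof -
  define q0 q1 p0 p1 where "q0 = cf_denom r n" "q1 = cf_denom r (Suc n)"
    "p0 = cf_num r n" "p1 = cf_num r (Suc n)"
  note d = q0_q1_p0_p1_def
  define \<delta> \<delta>' where "\<delta> = cf_error r n" "\<delta>' = cf_error r (Suc n)"
  note e = \<delta>_\<delta>'_def
  have q: "1 \<le> q0" "1 \<le> q1" "q0 \<le> q1"
    unfolding d using cf_denom_pos[OF irr] cf_denom_mono[OF irr] by auto
  have \<delta>: "0 < \<delta>" "0 < \<delta>'" "\<delta>' < \<delta>"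
    unfolding e using cf_error_pos[OF irr] cf_error_decreasing[OF irr] by auto
  have er: "of_int q0 * r = of_int p0 + (-1) ^ n * \<delta>" "of_int q1 * r = of_int p1 - (-1) ^ n * \<delta>'"
    using cf_denom_error[OF irr, of n] cf_denom_error[OF irr, of "Suc n"] unfolding d e by auto
  define S where "S = {x. \<exists>j p. 0 \<le> j \<and> j < q0 + q1 \<and> x = of_int p - of_int j * r}"
  have SI: "of_int p - of_int j * r \<in> S" if "0 \<le> j" "j < q0 + q1" for j p
    using that unfolding S_def by blast
  have step: "\<exists>s'\<in>S. s + \<delta>' \<le> s' \<and> s' \<le> s + \<delta>" if "s \<in> S" for s
  proof -
    obtain j p where j: "0 \<le> j" "j < q0 + q1" and s: "s = of_int p - of_int j * r"
      using \<open>s \<in> S\<close> unfolding S_def by blast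
    consider (a) "odd n" "j < q1" | (b) "odd n" "q1 \<le> j" | (c) "even n" "q0 \<le> j" | (d) "even n" "j < q0"
      by linarith
    then obtain j' p' where "0 \<le> j'" "j' < q0 + q1"
      "s + \<delta>' \<le> of_int p' - of_int j' * r" "of_int p' - of_int j' * r \<le> s + \<delta>"
    proof cases
      case a
      show ?thesis by (rule that[of "j + q0" "p + p0"]) (use a j q \<delta> er s in \<open>auto simp: distrib_right\<close>)
    next
      case b
      show ?thesis by (rule that[of "j - q1" "p - p1"]) (use b j q \<delta> er s in \<open>auto simp: left_diff_distrib\<close>)
    next
      case c
      show ?thesis by (rule that[of "j - q0" "p - p0"]) (use c j q \<delta> er s in \<open>auto simp: left_diff_distrib\<close>)
    next
      case d
      show ?thesis by (rule that[of "j + q1" "p + p1"]) (use d j q \<delta> er s in \<open>auto simp: distrib_right\<close>)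
    qed
    then show ?thesis using SI[of j' p'] by blast
  qed
  have "of_int (\<lceil>t\<rceil> - 1) - of_int 0 * r \<in> S" using q by (intro SI) auto
  moreover have "of_int (\<lceil>t\<rceil> - 1) - of_int 0 * r < t" by simp linarith
  ultimately have "\<exists>s\<in>S. t \<le> s \<and> s < t + \<delta>"
    using \<delta>(2) step by (rule walk_hits_interval)
  then obtain j p where j: "0 \<le> j" "j < q0 + q1" "t \<le> of_int p - of_int j * r" "of_int p - of_int j * r < t + \<delta>"
    unfolding S_def by auto
  \<comment> \<open>If the walk lands on \<open>t\<close> itself, a further move by
    \<open>\<delta>'\<close> or \<open>\<delta> - \<delta>'\<close> makes both inequalities strict.
    Afterwards \<open>j\<close> is still below 2 * (q0 + q1), hence at most 4 * q1; this is the
    origin of the 4.\<close>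
  consider (a) "t < of_int p - of_int j * r" | (b) "t = of_int p - of_int j * r" "even n"
    | (c) "t = of_int p - of_int j * r" "odd n"
    using j(3) by linarith
  then obtain j' p' where j': "0 \<le> j'" "j' \<le> 4 * q1" "t < of_int p' - of_int j' * r"
    "of_int p' - of_int j' * r < t + \<delta>"
  proof cases
    case a
    then show ?thesis using that[of j p] j q by auto
  next
    case b
    show ?thesis by (rule that[of "j + q1" "p + p1"]) (use b j q \<delta> er in \<open>auto simp: distrib_right\<close>)
  next
    case c
    show ?thesis by (rule that[of "j + q0 + q1" "p + p0 + p1"])
      (use c j q \<delta> er in \<open>auto simp: distrib_right\<close>)
  qed
  have "of_int (p' + j' * z) - real (nat j') * (r + of_int z) = of_int p' - of_int j' * r"
    using j'(1) by (simp add: algebra_simps)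
  then show ?thesis using that[of "nat j'" "p' + j' * z"] j' d e by auto
qed

section \<open>Points that never enter the flat spot\<close>

text \<open>The interface between arithmetic and geometry. As preimages of order \<open>m\<close>
  have heights \<open>p - m * \<rho>\<close>, the last clause provides a preimage of order at most
  \<open>4 * Q n\<close> in every open h-window of length \<open>d n\<close>.\<close>

definition scale_sequence :: "real \<Rightarrow> (nat \<Rightarrow> nat) \<Rightarrow> (nat \<Rightarrow> real) \<Rightarrow> bool" where
  "scale_sequence \<rho> Q d \<longleftrightarrow>
     (\<forall>n. rotation_scale \<rho> (Q n) (d n)) \<and> d \<longlonglongrightarrow> 0 \<and> (\<forall>N. \<exists>n. N \<le> Q n) \<and>
     (\<forall>n t. \<exists>m (p::int). m \<le> 4 * Q n \<and> t < of_int p - real m * \<rho> \<and> of_int p - real m * \<rho> < t + d n)"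

text \<open>Traversing the orbit segment of length \<open>4 * Q n\<close> in the opposite direction
  exchanges \<open>m\<close> with \<open>4 * Q n - m\<close> and shifts the window by
  \<open>4 * Q n * \<rho>\<close>.\<close>

lemma scale_sequence_uminus:
  assumes "scale_sequence \<rho> Q d"
  shows "scale_sequence (- \<rho>) Q d"
  unfolding scale_sequence_def
proof (intro conjI allI)
  fix n t
  obtain m and p :: int where m: "m \<le> 4 * Q n"
      "t - real (4 * Q n) * \<rho> < of_int p - real m * \<rho>"
      "of_int p - real m * \<rho> < t - real (4 * Q n) * \<rho> + d n"
    using assms unfolding scale_sequence_def by blast
  have "of_int p - real (4 * Q n - m) * - \<rho> = of_int p - real m * \<rho> + real (4 * Q n) * \<rho>"
    using m(1) by (simp add: of_nat_diff algebra_simps)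
  then show "\<exists>m (p::int). m \<le> 4 * Q n \<and> t < of_int p - real m * - \<rho> \<and> of_int p - real m * - \<rho> < t + d n"
    using m by (intro exI[of _ "4 * Q n - m"] exI[of _ p]) linarith
qed (use assms rotation_scale_uminus in \<open>auto simp: scale_sequence_def\<close>)

text \<open>A Vitali covering is chosen inside an open set of measure below
  \<open>\<mu> + e\<close>. Removing from each interval its gap leaves at most the proportion
  \<open>1 - k\<close>, whence \<open>\<mu> \<le> (1 - k) * (\<mu> + e)\<close>. The intervals need
  not be centred at the point, so gaps on one side suffice.\<close>

lemma negligible_of_uniform_gaps:
  fixes S :: "real set"
  assumes S: "compact S" and k: "0 < k" "k \<le> 1"
    and gaps: "\<And>x e. x \<in> S \<Longrightarrow> 0 < e \<Longrightarrow> \<exists>y r u v. 0 < r \<and> r < e \<and> x \<in> cball y r \<and>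
      {u<..<v} \<subseteq> cball y r \<and> S \<inter> {u<..<v} = {} \<and> k * (2 * r) \<le> v - u"
  shows "negligible S"
proof -
  have lS: "S \<in> lmeasurable" using S by (rule lmeasurable_compact)
  define \<mu> where "\<mu> = measure lebesgue S"
  have \<mu>0: "\<mu> \<ge> 0" unfolding \<mu>_def by simp
  have bound: "\<mu> \<le> (1 - k) * (\<mu> + e)" if "e > 0" for e
  proof -
    obtain T where T0: "open T" "S \<subseteq> T" "T - S \<in> lmeasurable" "emeasure lebesgue (T - S) < ennreal e"
      using sets_lebesgue_outer_open[OF fmeasurableD[OF lS] \<open>e > 0\<close>] by blast
    have Teq: "T = S \<union> (T - S)" using T0(2) by blast
    have "T \<in> lmeasurable" by (subst Teq) (intro fmeasurable.Un lS T0(3))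
    moreover have "measure lebesgue (T - S) < e"
      using T0(3,4) \<open>e > 0\<close> by (simp add: emeasure_eq_measure2 ennreal_less_iff)
    then have "measure lebesgue T < \<mu> + e"
      using measure_Un_le[of S lebesgue "T - S"] lS T0(3) Teq unfolding \<mu>_def by auto
    ultimately have T: "open T" "S \<subseteq> T" "T \<in> lmeasurable" "measure lebesgue T < \<mu> + e"
      using T0 by auto
    define I where "I = {((y, r), (u, v)) | y r u v :: real. 0 < r \<and> cball y r \<subseteq> T \<and>
      {u<..<v} \<subseteq> cball y r \<and> S \<inter> {u<..<v} = {} \<and> k * (2 * r) \<le> v - u}"
    define c where "c = (\<lambda>i :: (real \<times> real) \<times> (real \<times> real). fst (fst i))"
    define R where "R = (\<lambda>i :: (real \<times> real) \<times> (real \<times> real). snd (fst i))"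
    define G where "G = (\<lambda>i :: (real \<times> real) \<times> (real \<times> real). {fst (snd i)<..<snd (snd i)})"
    have I: "0 < R i" "cball (c i) (R i) \<subseteq> T" "G i \<subseteq> cball (c i) (R i)" "S \<inter> G i = {}"
        "k * (2 * R i) \<le> snd (snd i) - fst (snd i)" if "i \<in> I" for i
      using that unfolding I_def c_def R_def G_def by auto
    obtain C where C: "countable C" "C \<subseteq> I"
      and disj: "pairwise (\<lambda>i j. disjnt (cball (c i) (R i)) (cball (c j) (R j))) C"
      and neg: "negligible (S - (\<Union>i\<in>C. cball (c i) (R i)))"
    proof (rule Vitali_covering_theorem_cballs[of I R S c])
      show "0 < R i" if "i \<in> I" for i using I(1)[OF that] .
      fix x d :: real assume x: "x \<in> S" "0 < d"
      obtain d' where d': "d' > 0" "cball x d' \<subseteq> T"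
        using T(1,2) x(1) open_contains_cball by (metis subsetD)
      obtain y r u v where g: "0 < r" "r < min d (d' / 2)" "x \<in> cball y r"
        "{u<..<v} \<subseteq> cball y r" "S \<inter> {u<..<v} = {}" "k * (2 * r) \<le> v - u"
        using gaps[OF x(1), of "min d (d' / 2)"] x(2) d'(1) by auto
      have "cball y r \<subseteq> cball x d'"
        using g by (intro subsetI) (auto simp: dist_real_def)
      then have "((y, r), (u, v)) \<in> I" using g d' unfolding I_def by auto
      then show "\<exists>i. i \<in> I \<and> x \<in> cball (c i) (R i) \<and> R i < d"
        using g by (intro exI[of _ "((y, r), (u, v))"]) (auto simp: c_def R_def)
    qed
    define B where "B = (\<lambda>i. cball (c i) (R i))"
    have dB: "disjoint_family_on B C"
      using disj unfolding disjoint_family_on_def pairwise_def disjnt_def B_def by blast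
    then have dBG: "disjoint_family_on (\<lambda>i. B i - G i) C"
      unfolding disjoint_family_on_def by blast
    have mB: "B i \<in> sets lebesgue" "G i \<in> sets lebesgue" for i unfolding B_def G_def by auto
    have size: "emeasure lebesgue (B i - G i) \<le> ennreal (1 - k) * emeasure lebesgue (B i)" if "i \<in> C" for i
    proof -
      note Ii = I[OF subsetD[OF C(2) that]]
      have eB: "emeasure lebesgue (B i) = ennreal (2 * R i)"
        unfolding B_def cball_eq_atLeastAtMost using Ii(1) by (simp add: emeasure_lborel_Icc_eq)
      have uv: "0 \<le> snd (snd i) - fst (snd i)" using Ii(1,5) k
        by (meson less_imp_le mult_nonneg_nonneg order_trans zero_le_numeral)
      have eG: "emeasure lebesgue (G i) = ennreal (snd (snd i) - fst (snd i))"
        unfolding G_def using uv by simp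
      have "emeasure lebesgue (B i - G i) = emeasure lebesgue (B i) - emeasure lebesgue (G i)"
        using Ii(3) mB eG by (intro emeasure_Diff) (auto simp: B_def)
      also have "\<dots> = ennreal (2 * R i - (snd (snd i) - fst (snd i)))"
        unfolding eB eG using uv by (rule ennreal_minus)
      also have "\<dots> \<le> ennreal ((1 - k) * (2 * R i))"
        using Ii(5) by (intro ennreal_leI) (simp add: algebra_simps)
      also have "\<dots> = ennreal (1 - k) * emeasure lebesgue (B i)"
        unfolding eB using k by (intro ennreal_mult) (use Ii(1) in auto)
      finally show ?thesis .
    qed
    have "emeasure lebesgue S \<le> emeasure lebesgue ((\<Union>i\<in>C. B i - G i) \<union> (S - (\<Union>i\<in>C. B i)))"
    proof (rule emeasure_mono)
      show "S \<subseteq> (\<Union>i\<in>C. B i - G i) \<union> (S - (\<Union>i\<in>C. B i))"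
        using I(4) C(2) by blast
      show "(\<Union>i\<in>C. B i - G i) \<union> (S - (\<Union>i\<in>C. B i)) \<in> sets lebesgue"
        using mB C(1) lS by (intro sets.Un sets.Diff sets.countable_UN') auto
    qed
    also have "\<dots> \<le> emeasure lebesgue (\<Union>i\<in>C. B i - G i) + emeasure lebesgue (S - (\<Union>i\<in>C. B i))"
      using mB C(1) lS by (intro emeasure_subadditive sets.Diff sets.countable_UN') auto
    also have "emeasure lebesgue (S - (\<Union>i\<in>C. B i)) = 0"
      using neg unfolding negligible_iff_null_sets B_def by auto
    also have "emeasure lebesgue (\<Union>i\<in>C. B i - G i) = (\<integral>\<^sup>+i. emeasure lebesgue (B i - G i) \<partial>count_space C)"
      using mB C(1) dBG by (intro emeasure_UN_countable) auto
    also have "\<dots> \<le> (\<integral>\<^sup>+i. ennreal (1 - k) * emeasure lebesgue (B i) \<partial>count_space C)"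
      using size by (intro nn_integral_mono) auto
    also have "\<dots> = ennreal (1 - k) * (\<integral>\<^sup>+i. emeasure lebesgue (B i) \<partial>count_space C)"
      by (rule nn_integral_cmult) auto
    also have "(\<integral>\<^sup>+i. emeasure lebesgue (B i) \<partial>count_space C) = emeasure lebesgue (\<Union>i\<in>C. B i)"
      using mB C(1) dB by (intro emeasure_UN_countable[symmetric]) auto
    also have "ennreal (1 - k) * emeasure lebesgue (\<Union>i\<in>C. B i) \<le> ennreal (1 - k) * emeasure lebesgue T"
    proof (intro mult_left_mono emeasure_mono)
      show "(\<Union>i\<in>C. B i) \<subseteq> T" using I(2) C(2) unfolding B_def by blast
    qed (use T in auto)
    also have "emeasure lebesgue T = ennreal (measure lebesgue T)"
      using T(3) by (intro emeasure_eq_measure2) auto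
    also have "ennreal (1 - k) * \<dots> = ennreal ((1 - k) * measure lebesgue T)"
      using k by (intro ennreal_mult[symmetric]) auto
    finally have "ennreal \<mu> \<le> ennreal ((1 - k) * measure lebesgue T)"
      unfolding \<mu>_def using lS by (simp add: emeasure_eq_measure2)
    then have "\<mu> \<le> (1 - k) * measure lebesgue T"
      using k by (simp add: ennreal_le_iff)
    also have "\<dots> \<le> (1 - k) * (\<mu> + e)" using T(4) k by (intro mult_left_mono) auto
    finally show ?thesis .
  qed
  have "\<mu> = 0"
  proof (rule ccontr)
    assume "\<mu> \<noteq> 0"
    then have "\<mu> > 0" using \<mu>0 by simp
    \<comment> \<open>For this \<open>e\<close> the bound reads
      \<open>\<mu> \<le> (1 - k) * (1 + k) * \<mu>\<close>.\<close>
    define e where "e = k * \<mu>"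
    have "e > 0" unfolding e_def using k \<open>\<mu> > 0\<close> by simp
    from bound[OF this] have "\<mu> \<le> (1 - k) * (1 + k) * \<mu>" unfolding e_def by (simp add: algebra_simps)
    then have "k * k * \<mu> \<le> 0" by (simp add: algebra_simps)
    then show False using k \<open>\<mu> > 0\<close> by (simp add: mult_le_0_iff)
  qed
  then show ?thesis using lS unfolding \<mu>_def
    by (simp add: negligible_iff_measure)
qed

context flat_dynamics
begin

definition survivors :: "real set" where
  "survivors = {x. \<forall>j. \<not> flat_hit a b ((f ^^ j) x)}"

text \<open>The interval from \<open>lo m\<close> to \<open>hi m\<close> is a component of the m-th
  preimage of the lifted flat spot. The choice is unambiguous, since \<open>f ^^ m\<close> is
  injective on the fibre of \<open>h\<close> in question by
  \<open>iter_less_of_same_fiber\<close>.\<close>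

definition lo :: "nat \<Rightarrow> real" where "lo m = (SOME u. (f ^^ m) u = a)"
definition hi :: "nat \<Rightarrow> real" where "hi m = (SOME v. (f ^^ m) v = b)"

lemma iter_lo [simp]: "(f ^^ m) (lo m) = a" and iter_hi [simp]: "(f ^^ m) (hi m) = b"
  unfolding lo_def hi_def by (rule someI_ex, metis iter_surj)+

lemma h_lo [simp]: "h (lo m) = - (real m * \<rho>)" and h_hi [simp]: "h (hi m) = - (real m * \<rho>)"
  using h_iter[of m "lo m"] h_iter[of m "hi m"] h_a h_b by simp_all

lemma lo_less_hi: "lo m < hi m"
  using iter_less_imp_less[of m "lo m" "hi m"] a_less_b by simp

text \<open>A hit before time \<open>m\<close> would have another height, so the interval is not hit
  and \<open>cr_chain\<close> applies with empty outer intervals.\<close>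

lemma iter_less_of_same_fiber:
  assumes "x < y" "h x = h y" "h x = of_int p - real m * \<rho>"
  shows "(f ^^ m) x < (f ^^ m) y"
proof (rule cr_chain(1)[of x x y y m])
  fix j z assume j: "j < m" "(f ^^ j) x < z" "z < (f ^^ j) y"
  show "\<not> flat_hit a b z"
  proof
    assume "flat_hit a b z"
    then obtain q :: int where q: "h z = of_int q" by (rule h_flat_hit)
    have "h ((f ^^ j) x) \<le> h z" "h z \<le> h ((f ^^ j) y)" using j by (auto intro!: monoD[OF h_mono] simp del: h_iter)
    then have "of_int q - real j * \<rho> = of_int p - real m * \<rho>" using assms q by simp
    then show False using rotation_points_unique(1)[of q j p m] j(1) by simp
  qed
qed (use assms in auto)

lemma not_survivor:
  assumes "lo m + of_int p < x" "x < hi m + of_int p"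
  shows "x \<notin> survivors"
proof -
  have "h (lo m + of_int p) \<le> h x" "h x \<le> h (hi m + of_int p)"
    using assms by (auto intro!: monoD[OF h_mono] simp del: h_add_int)
  then have hx: "h x = of_int p - real m * \<rho>" by simp
  have "(f ^^ m) (lo m + of_int p) < (f ^^ m) x" "(f ^^ m) x < (f ^^ m) (hi m + of_int p)"
    by (rule iter_less_of_same_fiber[of _ _ p]; use assms hx in simp)+
  then have "flat_hit a b ((f ^^ m) x)" unfolding flat_hit_def by (intro exI[of _ p]) simp
  then show ?thesis unfolding survivors_def by blast
qed

text \<open>Wandering intervals are not excluded beforehand, so the fibres of \<^term>\<open>h\<close> may be
  nondegenerate and the endpoints of a gap have to be recorded by the next two conditions.\<close>

definition clear_right :: "real \<Rightarrow> bool" where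
  "clear_right l \<longleftrightarrow> (\<forall>x j. l < x \<and> h x = h l \<longrightarrow> \<not> flat_hit a b ((f ^^ j) x))"

definition clear_left :: "real \<Rightarrow> bool" where
  "clear_left r \<longleftrightarrow> (\<forall>x j. x < r \<and> h x = h r \<longrightarrow> \<not> flat_hit a b ((f ^^ j) x))"

lemma flat_hit_in_fiber:
  assumes hit: "flat_hit a b ((f ^^ j) x)" and hx: "h x = of_int p - real m * \<rho>"
  shows "j = m" "a + of_int p < (f ^^ m) x" "(f ^^ m) x < b + of_int p"
proof -
  obtain q :: int where q: "a + of_int q < (f ^^ j) x" "(f ^^ j) x < b + of_int q"
    using hit unfolding flat_hit_def by auto
  have "h (a + of_int q) \<le> h ((f ^^ j) x)" "h ((f ^^ j) x) \<le> h (b + of_int q)"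
    using q by (auto intro!: monoD[OF h_mono] simp del: h_add_int h_iter)
  then have "h x = of_int q - real j * \<rho>" using h_a h_b by simp
  then have "of_int p - real m * \<rho> = of_int q - real j * \<rho>" using hx by simp
  from rotation_points_unique[OF this] have "m = j" "p = q" .
  then show "j = m" "a + of_int p < (f ^^ m) x" "(f ^^ m) x < b + of_int p" using q by auto
qed

lemma clear_left_lo: "clear_left (lo m + of_int p)"
  unfolding clear_left_def
proof (intro allI impI notI)
  fix x j assume x: "x < lo m + of_int p \<and> h x = h (lo m + of_int p)" and hit: "flat_hit a b ((f ^^ j) x)"
  have "a + of_int p < (f ^^ m) x" using flat_hit_in_fiber(2)[OF hit, of p m] x by simp
  moreover have "(f ^^ m) x \<le> (f ^^ m) (lo m + of_int p)" using x by (intro iter_mono) simp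
  ultimately show False by simp
qed

lemma clear_right_hi: "clear_right (hi m + of_int p)"
  unfolding clear_right_def
proof (intro allI impI notI)
  fix x j assume x: "hi m + of_int p < x \<and> h x = h (hi m + of_int p)" and hit: "flat_hit a b ((f ^^ j) x)"
  have "(f ^^ m) x < b + of_int p" using flat_hit_in_fiber(3)[OF hit, of p m] x by simp
  moreover have "(f ^^ m) (hi m + of_int p) \<le> (f ^^ m) x" using x by (intro iter_mono) simp
  ultimately show False by simp
qed

text \<open>Hits on both sides of \<open>x\<close> in its fibre would happen at the same time and in
  the same translate of the flat spot; by monotonicity \<open>x\<close>, lying between them, would
  be hit too.\<close>

lemma survivor_clear:
  assumes "x \<in> survivors"
  shows "clear_left x \<or> clear_right x"
proof (rule ccontr)
  assume "\<not> ?thesis"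
  then obtain y z i j where y: "y < x" "h y = h x" "flat_hit a b ((f ^^ i) y)"
    and z: "x < z" "h z = h x" "flat_hit a b ((f ^^ j) z)"
    unfolding clear_left_def clear_right_def by blast
  obtain p :: int where "h ((f ^^ i) y) = of_int p" using y(3) by (rule h_flat_hit)
  then have p: "h y = of_int p - real i * \<rho>" by simp
  have "a + of_int p < (f ^^ i) y" using flat_hit_in_fiber(2)[OF y(3) p] .
  moreover have "(f ^^ i) z < b + of_int p" using flat_hit_in_fiber(3)[OF z(3), of p i] p y z by simp
  moreover have "(f ^^ i) y \<le> (f ^^ i) x" "(f ^^ i) x \<le> (f ^^ i) z" using y z by (auto intro!: iter_mono)
  ultimately have "flat_hit a b ((f ^^ i) x)" unfolding flat_hit_def by (intro exI[of _ p]) simp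
  then show False using assms unfolding survivors_def by blast
qed

section \<open>Gaps of definite relative size next to a survivor\<close>

lemma preimage_lengths_tendsto_0:
  assumes "scale_sequence \<rho> Q d"
  shows "(\<lambda>m. hi m - lo m) \<longlonglongrightarrow> 0"
proof (rule summable_LIMSEQ_zero, rule summableI_nonneg_bounded)
  show "0 \<le> hi m - lo m" for m using lo_less_hi[of m] by simp
  fix N
  obtain n where n: "N \<le> Q n" using assms unfolding scale_sequence_def by blast
  have sc: "rotation_scale \<rho> (Q n) (d n)" using assms unfolding scale_sequence_def by blast
  \<comment> \<open>Counted backwards, the preimages have the heights
    \<open>(j - (N - 1)) * \<rho>\<close> and move with the rotation. Their h-width is 0, so the
    block estimate with \<open>w = 0\<close> bounds the total length by 2.\<close>
  have "(\<Sum>j<N. hi (N - Suc j) - lo (N - Suc j)) \<le> 2 * (0 + 1)"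
  proof (rule sum_lengths_le_block[OF sc, where t = "- (real N - 1) * \<rho>"])
    fix j assume j: "j \<in> {..<N}"
    then have e: "real (N - Suc j) = real N - 1 - real j" by (simp add: of_nat_diff)
    show "lo (N - Suc j) \<le> hi (N - Suc j)" using lo_less_hi less_imp_le by blast
    show "hi (N - Suc j) \<le> lo (N - Suc j) + 1"
      by (rule less_imp_le, rule less_add1) simp
    show "real j * \<rho> + - (real N - 1) * \<rho> \<le> h (lo (N - Suc j))"
      "h (hi (N - Suc j)) \<le> real j * \<rho> + - (real N - 1) * \<rho> + 0 * d n"
      unfolding h_lo h_hi e by (simp_all add: algebra_simps)
  qed (use n in auto)
  then show "(\<Sum>m<N. hi m - lo m) \<le> 2"
    using sum.nat_diff_reindex[of "\<lambda>m. hi m - lo m" N] by simp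
qed

text \<open>The preimage of least order in a short h-window to the right of \<open>x\<close> is not
  small compared with its distance to \<open>x\<close>. To make it close to \<open>x\<close>, the
  window is chosen to omit all low orders: then its length is small, and by the comparison the
  distance is small too.\<close>

lemma gap_right_of_point:
  assumes sq: "scale_sequence \<rho> Q d" and x: "clear_right x" and \<epsilon>: "\<epsilon> > 0"
  shows "\<exists>m (p::int). x < lo m + of_int p \<and> hi m + of_int p < x + \<epsilon> \<and>
     \<kappa> 4 * (lo m + of_int p - x) \<le> hi m - lo m"
proof -
  define \<eta> where "\<eta> = \<epsilon> / (1 + 1 / \<kappa> 4)"
  have \<kappa>: "\<kappa> 4 > 0" by (rule \<kappa>_pos)
  have \<kappa>': "1 + 1 / \<kappa> 4 > 0" using \<kappa> by (simp add: add_pos_pos)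
  have \<eta>: "\<eta> > 0" unfolding \<eta>_def using \<epsilon> \<kappa>' by (rule divide_pos_pos)
  obtain M where M: "\<And>m. m \<ge> M \<Longrightarrow> hi m - lo m < \<eta>"
    using LIMSEQ_D[OF preimage_lengths_tendsto_0[OF sq] \<eta>] by fastforce
  \<comment> \<open>The h-distance from \<open>x\<close> to the next height of order
    \<open>m\<close> strictly on its right. A window shorter than all \<open>g m\<close> with
    \<open>m < M\<close> contains only orders from \<open>M\<close> on.\<close>
  define g where "g = (\<lambda>m. of_int (\<lfloor>h x + real m * \<rho>\<rfloor> + 1) - (h x + real m * \<rho>))"
  have g: "g m > 0" for m unfolding g_def by linarith
  have g': "g m \<le> of_int p - real m * \<rho> - h x" if "h x < of_int p - real m * \<rho>" for p :: int and m
  proof -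
    have "h x + real m * \<rho> < of_int p" using that by simp
    then have "\<lfloor>h x + real m * \<rho>\<rfloor> + 1 \<le> p" by (simp add: floor_less_iff add1_zle_eq)
    then have "(of_int (\<lfloor>h x + real m * \<rho>\<rfloor> + 1) :: real) \<le> of_int p" by (rule of_int_le_iff[THEN iffD2])
    then show ?thesis unfolding g_def by simp
  qed
  define \<gamma> where "\<gamma> = Min (insert (1 / 20) (g ` {..<M}))"
  have "\<gamma> > 0" unfolding \<gamma>_def using g by simp
  moreover have "\<gamma> \<le> 1 / 20" unfolding \<gamma>_def by (rule Min_le) auto
  moreover have "\<gamma> \<le> g m" if "m < M" for m unfolding \<gamma>_def using that by (intro Min_le) auto
  ultimately have \<gamma>: "\<gamma> > 0" "\<gamma> \<le> 1 / 20" "\<And>m. m < M \<Longrightarrow> \<gamma> \<le> g m" by blast+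
  have "\<forall>\<^sub>F n in sequentially. d n < \<gamma>"
    using sq \<gamma>(1) unfolding scale_sequence_def by (blast intro: order_tendstoD)
  then obtain n where n: "d n < \<gamma>" by (auto simp: eventually_sequentially)
  have sc: "rotation_scale \<rho> (Q n) (d n)" using sq unfolding scale_sequence_def by blast
  define P where "P = (\<lambda>m. \<exists>p::int. h x < of_int p - real m * \<rho> \<and> of_int p - real m * \<rho> < h x + d n)"
  obtain m0 where m0: "m0 \<le> 4 * Q n" "P m0"
    using sq unfolding scale_sequence_def P_def by blast
  define m where "m = (LEAST m. P m)"
  have "P m" unfolding m_def using m0(2) by (rule LeastI)
  then obtain p :: int where p: "h x < of_int p - real m * \<rho>" "of_int p - real m * \<rho> < h x + d n"
    unfolding P_def by blast
  have mQ: "m \<le> 4 * Q n" unfolding m_def using Least_le[of P, OF m0(2)] m0(1) by simp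
  have mM: "m \<ge> M"
  proof (rule ccontr)
    assume "\<not> m \<ge> M"
    then show False using g'[OF p(1)] \<gamma>(3)[of m] p(2) n by simp
  qed
  have K: "\<kappa> 4 * (lo m + of_int p - x) \<le> (hi m + of_int p) - (lo m + of_int p)"
  proof (rule preimage_right_of_point[OF sc _ mQ])
    show "d n \<le> 1 / 20" using n \<gamma> by simp
    fix j :: nat and q :: int assume j: "j < m" "h x < of_int q - real j * \<rho>"
    show "\<not> of_int q - real j * \<rho> < h (lo m + of_int p)"
    proof
      assume "of_int q - real j * \<rho> < h (lo m + of_int p)"
      then have "P j" unfolding P_def using j p by (intro exI[of _ q]) simp
      then show False using not_less_Least[of j P] j(1) unfolding m_def by blast
    qed
  next
    fix y j assume "x < y" "h y = h x"
    then show "\<not> flat_hit a b ((f ^^ j) y)" using x unfolding clear_right_def by blast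
  qed (use p in simp_all)
  have xl: "x < lo m + of_int p" by (rule h_less_imp_less) (use p in simp)
  have "lo m + of_int p - x \<le> (hi m - lo m) / \<kappa> 4" using K \<kappa> by (simp add: field_simps)
  then have "hi m + of_int p - x \<le> (1 + 1 / \<kappa> 4) * (hi m - lo m)" by (simp add: algebra_simps)
  also have "\<dots> < (1 + 1 / \<kappa> 4) * \<eta>" using M[OF mM] \<kappa>' by (rule mult_strict_left_mono)
  also have "\<dots> = \<epsilon>" unfolding \<eta>_def using \<kappa>' by (simp only: times_divide_eq_right nonzero_mult_div_cancel_left less_imp_neq[THEN not_sym] not_False_eq_True)
  finally show ?thesis using K xl by (intro exI[of _ m] exI[of _ p]) auto
qed

lemma gap_left_of_point:
  assumes sq: "scale_sequence \<rho> Q d" and x: "clear_left x" and \<epsilon>: "\<epsilon> > 0"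
  shows "\<exists>u v. v < x \<and> x - \<epsilon> < u \<and> \<kappa> 4 * (x - v) \<le> v - u \<and> survivors \<inter> {u<..<v} = {}"
proof -
  interpret R: flat_dynamics "\<lambda>x. - f (- x)" "- b" "- a" C "- \<rho>" "\<lambda>x. - h (- x)"
    by (rule reflected)
  have it: "((\<lambda>x. - f (- x)) ^^ n) x = - (f ^^ n) (- x)" for n x
    by (induction n) auto
  have "R.clear_right (- x)"
    unfolding R.clear_right_def
  proof (intro allI impI)
    fix y j assume y: "- x < y \<and> - h (- y) = - h (- (- x))"
    then have "\<not> flat_hit a b ((f ^^ j) (- y))" using x unfolding clear_left_def by auto
    then show "\<not> flat_hit (- b) (- a) (((\<lambda>x. - f (- x)) ^^ j) y)"
      unfolding it flat_hit_uminus by simp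
  qed
  then obtain m and p :: int where m: "- x < R.lo m + of_int p" "R.hi m + of_int p < - x + \<epsilon>"
      "R.\<kappa> 4 * (R.lo m + of_int p - - x) \<le> R.hi m - R.lo m"
    using R.gap_right_of_point[OF scale_sequence_uminus[OF sq] _ \<epsilon>] by blast
  have S: "- y \<in> survivors \<Longrightarrow> y \<in> R.survivors" for y
    unfolding survivors_def R.survivors_def it flat_hit_uminus by simp
  have "R.\<kappa> 4 = \<kappa> 4" unfolding R.\<kappa>_def \<kappa>_def by simp
  moreover have "survivors \<inter> {- (R.hi m + of_int p)<..<- (R.lo m + of_int p)} = {}"
  proof (rule equals0I)
    fix y assume y: "y \<in> survivors \<inter> {- (R.hi m + of_int p)<..<- (R.lo m + of_int p)}"
    then have "- y \<notin> R.survivors" by (intro R.not_survivor[of m p]) auto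
    then show False using S[of "- y"] y by simp
  qed
  ultimately show ?thesis using m
    by (intro exI[of _ "- (R.hi m + of_int p)"] exI[of _ "- (R.lo m + of_int p)"]) (auto simp: algebra_simps)
qed

lemma closed_survivors: "closed survivors"
proof -
  have "open {x. flat_hit a b x}"
  proof -
    have "{x. flat_hit a b x} = (\<Union>p::int. {a + of_int p<..<b + of_int p})"
      by (auto simp: flat_hit_def)
    then show ?thesis by auto
  qed
  moreover have "continuous_on UNIV (f ^^ j)" for j
  proof (induction j)
    case (Suc j)
    then show ?case unfolding funpow.simps
      by (intro continuous_on_compose continuous_on_subset[OF f_cont]) auto
  qed (simp add: id_def)
  ultimately have "open ((f ^^ j) -` {x. flat_hit a b x})" for j
    by (rule open_vimage)
  then have "open (\<Union>j. (f ^^ j) -` {x. flat_hit a b x})" by blast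
  moreover have "survivors = - (\<Union>j. (f ^^ j) -` {x. flat_hit a b x})"
    unfolding survivors_def by auto
  ultimately show ?thesis by (simp add: closed_def)
qed

lemma negligible_survivors:
  assumes sq: "scale_sequence \<rho> Q d"
  shows "negligible (survivors \<inter> {s..t})"
proof (rule negligible_of_uniform_gaps)
  let ?k = "\<kappa> 4 / (1 + \<kappa> 4)"
  have \<kappa>: "\<kappa> 4 > 0" by (rule \<kappa>_pos)
  show "compact (survivors \<inter> {s..t})"
    by (intro closed_Int_compact closed_survivors) auto
  show "0 < ?k" "?k \<le> 1" using \<kappa> by (auto simp: add_pos_pos)
  \<comment> \<open>For a gap of length B at distance A from the point, this is the proportion of
    the gap in the interval that joins both.\<close>
  have frac: "?k * (A + B) \<le> B" if "\<kappa> 4 * A \<le> B" for A B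
  proof -
    have "\<kappa> 4 * (A + B) \<le> (1 + \<kappa> 4) * B" using that by (simp add: algebra_simps)
    then show ?thesis using \<kappa> by (simp add: field_simps)
  qed
  have cb: "cball ((p + q) / 2) ((q - p) / 2) = {p..q}" for p q :: real
    by (simp add: cball_eq_atLeastAtMost field_simps)
  fix x e :: real assume x: "x \<in> survivors \<inter> {s..t}" and e: "e > 0"
  consider "clear_right x" | "clear_left x" using survivor_clear x by blast
  then show "\<exists>y r u v. 0 < r \<and> r < e \<and> x \<in> cball y r \<and> {u<..<v} \<subseteq> cball y r \<and>
      survivors \<inter> {s..t} \<inter> {u<..<v} = {} \<and> ?k * (2 * r) \<le> v - u"
  proof cases
    case 1
    obtain m and p :: int where m: "x < lo m + of_int p" "hi m + of_int p < x + e"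
        "\<kappa> 4 * (lo m + of_int p - x) \<le> hi m - lo m"
      using gap_right_of_point[OF sq 1 e] by blast
    define v where "v = hi m + of_int p"
    have "x < v" using m(1) lo_less_hi[of m] unfolding v_def by simp
    moreover have "?k * (2 * ((v - x) / 2)) \<le> v - (lo m + of_int p)"
    proof -
      have "2 * ((v - x) / 2) = (lo m + of_int p - x) + (hi m - lo m)"
        "v - (lo m + of_int p) = hi m - lo m" unfolding v_def by simp_all
      then show ?thesis using frac[OF m(3)] by (simp only:)
    qed
    moreover have "survivors \<inter> {s..t} \<inter> {lo m + of_int p<..<v} = {}"
      using not_survivor unfolding v_def by auto
    moreover have "v < x + e" "x < lo m + of_int p"
      using m unfolding v_def by auto
    ultimately show ?thesis using e
      by - (rule exI[of _ "(x + v) / 2"], rule exI[of _ "(v - x) / 2"],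
          rule exI[of _ "lo m + of_int p"], rule exI[of _ v],
          simp add: cb subset_eq)
  next
    case 2
    obtain u v where m: "v < x" "x - e < u" "\<kappa> 4 * (x - v) \<le> v - u" "survivors \<inter> {u<..<v} = {}"
      using gap_left_of_point[OF sq 2 e] by blast
    have "0 < \<kappa> 4 * (x - v)" using \<kappa> m(1) by (intro mult_pos_pos) auto
    then have "u < v" using m(3) by simp
    moreover have "?k * (2 * ((x - u) / 2)) \<le> v - u"
    proof -
      have "2 * ((x - u) / 2) = (x - v) + (v - u)" by simp
      then show ?thesis using frac[OF m(3)] by (simp only:)
    qed
    moreover have "survivors \<inter> {s..t} \<inter> {u<..<v} = {}" using m(4) by blast
    ultimately show ?thesis using m(1,2) e
      by - (rule exI[of _ "(u + x) / 2"], rule exI[of _ "(x - u) / 2"],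
          rule exI[of _ u], rule exI[of _ v],
          simp add: cb subset_eq)
  qed
qed

end

section \<open>Hausdorff dimension\<close>

text \<open>By concavity \<open>t powr s\<close> lies below its tangent
  \<open>s * t + (1 - s)\<close> at 1. The resulting factor tends to \<open>1 - k\<close> as
  \<open>s\<close> tends to 1, so it is below 1 for \<open>s\<close> close to 1.\<close>

lemma powr_sum_contraction:
  fixes x y w k s :: real
  assumes "0 < x" "0 < y" "0 < w" "x + y \<le> (1 - k) * w" "0 < s" "s < 1"
  shows "x powr s + y powr s \<le> (s * (1 - k) + 2 * (1 - s)) * w powr s"
proof -
  have Y: "(z / w) powr s \<le> s * (z / w) + (1 - s)" if "z > 0" for z
    using Youngs_inequality_0[of s "1 - s" "z / w" 1] that assms by simp
  have "(x / w) powr s + (y / w) powr s \<le> s * ((x + y) / w) + 2 * (1 - s)"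
    using Y[OF assms(1)] Y[OF assms(2)] by (simp add: add_divide_distrib distrib_left)
  also have "\<dots> \<le> s * (1 - k) + 2 * (1 - s)"
    using assms by (intro add_right_mono mult_left_mono) (auto simp: divide_le_eq)
  finally have "((x / w) powr s + (y / w) powr s) * w powr s \<le> (s * (1 - k) + 2 * (1 - s)) * w powr s"
    by (intro mult_right_mono) auto
  moreover have "((x / w) powr s + (y / w) powr s) * w powr s = x powr s + y powr s"
    using assms by (simp add: powr_divide distrib_right)
  ultimately show ?thesis by simp
qed

lemma pairs_le_weaken:
  fixes A B :: real
  assumes "\<forall>(p, q)\<in>S. p \<le> q \<and> q - p \<le> A" "A \<le> B"
  shows "\<forall>(p, q)\<in>S. p \<le> q \<and> q - p \<le> B"
proof
  fix z assume "z \<in> S"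
  then have "fst z \<le> snd z \<and> snd z - fst z \<le> A" using assms(1) by (auto simp: case_prod_beta)
  then show "case z of (p, q) \<Rightarrow> p \<le> q \<and> q - p \<le> B" using assms(2) by (simp add: case_prod_beta)
qed

section \<open>Splitting the intervals of the dynamical partition\<close>

context flat_dynamics
begin

text \<open>The intervals left after removing finitely many preimages of the flat spot. Clear ends
  are what the two comparison lemmas ask for, and \<open>h l < h r\<close> guarantees a further
  preimage inside.\<close>

definition gap :: "real \<Rightarrow> real \<Rightarrow> bool" where
  "gap l r \<longleftrightarrow> clear_right l \<and> clear_left r \<and> h l < h r \<and> r \<le> l + 1"

lemma gap_root: "gap b (a + 1)"
proof -
  have "hi 0 = b" "lo 0 = a" using iter_hi[of 0] iter_lo[of 0] by simp_all
  then have "clear_right b" "clear_left (a + 1)"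
    using clear_right_hi[of 0 0] clear_left_lo[of 0 1] by simp_all
  then show ?thesis unfolding gap_def using h_b h_a h_add1[of a] a_less_b by simp
qed

text \<open>The preimage of least order inside the gap is removed. Its order is at most
  \<open>4 * Q n\<close> for the first scale \<open>n\<close> with
  \<open>d n \<le> h r - h l\<close>, whereas the comparison lemmas need the previous scale, whose
  \<open>d\<close> still exceeds \<open>h r - h l\<close>. Bounded growth of \<open>Q\<close>
  bridges the two at the price of the constant \<open>\<kappa> (4 * c)\<close>.\<close>

lemma gap_split:
  assumes sq: "scale_sequence \<rho> Q d" and growth: "\<And>n. Q (Suc n) \<le> c * Q n"
  obtains k where "0 < k" "k \<le> 1"
    "\<And>l r. gap l r \<Longrightarrow> \<exists>u v. l < u \<and> u < v \<and> v < r \<and> gap l u \<and> gap v r \<and>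
        survivors \<inter> {u<..<v} = {} \<and> k * (r - l) \<le> v - u"
proof -
  have sc: "rotation_scale \<rho> (Q n) (d n)" and
    hit: "\<exists>m (p::int). m \<le> 4 * Q n \<and> t < of_int p - real m * \<rho> \<and> of_int p - real m * \<rho> < t + d n" for n t
    using sq unfolding scale_sequence_def by blast+
  have d0: "d \<longlonglongrightarrow> 0" using sq unfolding scale_sequence_def by blast
  have small: "\<exists>N. \<forall>n\<ge>N. d n \<le> w" if "w > 0" for w
    using order_tendstoD(2)[OF d0 that] unfolding eventually_sequentially by (meson less_imp_le)
  obtain N where N: "\<And>n. n \<ge> N \<Longrightarrow> d n \<le> 1 / 20" using small[of "1 / 20"] by auto
  define \<kappa>' where "\<kappa>' = \<kappa> (4 * c)"
  have \<kappa>': "\<kappa>' > 0" unfolding \<kappa>'_def by (rule \<kappa>_pos)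
  \<comment> \<open>\<open>k1\<close> is for short gaps, where each of the two outer parts is at
    most the removed interval divided by \<open>\<kappa>'\<close>. For gaps wide in \<open>h\<close>
    only the orders up to \<open>4 * Q N\<close> occur, and \<open>k2\<close> is the least of these
    finitely many lengths.\<close>
  define k1 where "k1 = \<kappa>' / (2 + \<kappa>')"
  define k2 where "k2 = Min ((\<lambda>m. hi m - lo m) ` {..4 * Q N})"
  define k where "k = min k1 (min k2 1)"
  have k1: "k1 > 0" unfolding k1_def using \<kappa>' by simp
  have "k2 > 0" unfolding k2_def using lo_less_hi by simp
  have k2: "k2 \<le> hi m - lo m" if "m \<le> 4 * Q N" for m
    unfolding k2_def using that by (intro Min_le) auto
  show ?thesis
  proof (rule that[of k])
    show "0 < k" "k \<le> 1" unfolding k_def using k1 \<open>k2 > 0\<close> by auto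
    fix l r assume g: "gap l r"
    then have cl: "clear_right l" and cr: "clear_left r" and hlr: "h l < h r" and len: "r \<le> l + 1"
      unfolding gap_def by auto
    have lr: "l < r" using h_less_imp_less[OF hlr] .
    define P where "P = (\<lambda>m. \<exists>p::int. h l < of_int p - real m * \<rho> \<and> of_int p - real m * \<rho> < h r)"
    define m where "m = (LEAST m. P m)"
    have bound: "P m \<and> m \<le> 4 * Q n" if "d n \<le> h r - h l" for n
    proof -
      obtain m0 where m0: "m0 \<le> 4 * Q n" "P m0"
      proof -
        obtain m0 and p :: int where "m0 \<le> 4 * Q n" "h l < of_int p - real m0 * \<rho>"
            "of_int p - real m0 * \<rho> < h l + d n"
          using hit[of n "h l"] by blast
        moreover from this have "P m0" unfolding P_def using \<open>d n \<le> h r - h l\<close> by (intro exI[of _ p]) auto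
        ultimately show ?thesis using that by blast
      qed
      then have "m \<le> m0" unfolding m_def by (intro Least_le)
      moreover have "P m" unfolding m_def using m0(2) by (rule LeastI)
      ultimately show ?thesis using m0(1) by simp
    qed
    obtain N' where N': "\<And>n. n \<ge> N' \<Longrightarrow> d n \<le> h r - h l" using small[of "h r - h l"] hlr by auto
    obtain p :: int where p: "h l < of_int p - real m * \<rho>" "of_int p - real m * \<rho> < h r"
      using bound[OF N'[OF order_refl]] unfolding P_def by blast
    have first: "\<not> of_int q - real j * \<rho> < h r" if "j < m" "h l < of_int q - real j * \<rho>" for j and q :: int
      using not_less_Least[of j P] that unfolding m_def P_def by blast
    define u v where "u = lo m + of_int p" "v = hi m + of_int p"
    have hu: "h u = of_int p - real m * \<rho>" and hv: "h v = of_int p - real m * \<rho>"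
      unfolding u_v_def by simp_all
    have o: "l < u" "u < v" "v < r"
      using p hu hv lo_less_hi[of m] by (auto intro: h_less_imp_less simp: u_v_def)
    have gs: "gap l u" "gap v r"
      using cl cr p hu hv clear_left_lo[of m p] clear_right_hi[of m p] o len
      unfolding gap_def u_v_def[symmetric] by auto
    have S: "survivors \<inter> {u<..<v} = {}" using not_survivor unfolding u_v_def by auto
    have "k * (r - l) \<le> v - u"
    proof (cases "d N \<le> h r - h l")
      case True
      then have "k2 \<le> v - u" using k2 bound unfolding u_v_def by simp
      moreover have "k * (r - l) \<le> k2 * 1" unfolding k_def using len lr \<open>k2 > 0\<close>
        by (intro mult_mono) auto
      ultimately show ?thesis by simp
    next
      case False
      define n where "n = (LEAST n. n > N \<and> d n \<le> h r - h l)"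
      have "N + N' + 1 > N \<and> d (N + N' + 1) \<le> h r - h l" using N' by simp
      then have n: "n > N" "d n \<le> h r - h l" unfolding n_def by (metis (mono_tags, lifting) LeastI)+
      then obtain n' where n': "n = Suc n'" by (cases n) auto
      have dn': "h r - h l < d n'"
      proof (cases "n' = N")
        case True then show ?thesis using False by simp
      next
        case neq: False
        then show ?thesis
          using not_less_Least[of n' "\<lambda>n. n > N \<and> d n \<le> h r - h l"] n n' unfolding n_def by auto
      qed
      have d20: "d n' \<le> 1 / 20" using N[of n'] n n' by simp
      have "m \<le> 4 * Q n" using bound n(2) by blast
      also have "\<dots> \<le> 4 * (c * Q n')" using growth[of n'] n' by simp
      finally have mQ: "m \<le> (4 * c) * Q n'" by (simp add: mult.assoc)
      have A: "\<kappa>' * (u - l) \<le> v - u"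
        unfolding \<kappa>'_def
      proof (rule preimage_right_of_point[OF sc[of n'] d20 mQ])
        fix j and q :: int assume "j < m" "h l < of_int q - real j * \<rho>"
        then show "\<not> of_int q - real j * \<rho> < h u" using first[of j q] hu p by auto
      next
        fix x j assume "l < x" "h x = h l"
        then show "\<not> flat_hit a b ((f ^^ j) x)" using cl unfolding clear_right_def by blast
      qed (use hu hv p dn' in \<open>simp_all add: u_v_def\<close>)
      have B: "\<kappa>' * (r - v) \<le> v - u"
        unfolding \<kappa>'_def
      proof (rule preimage_left_of_point[OF sc[of n'] d20 mQ])
        fix j and q :: int assume "j < m" "h v < of_int q - real j * \<rho>"
        then show "\<not> of_int q - real j * \<rho> < h r" using first[of j q] hv p by auto
      next
        fix x j assume "x < r" "h x = h r"
        then show "\<not> flat_hit a b ((f ^^ j) x)" using cr unfolding clear_left_def by blast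
      qed (use hu hv p dn' in \<open>simp_all add: u_v_def\<close>)
      have "\<kappa>' * (r - l) = \<kappa>' * (u - l) + \<kappa>' * (r - v) + \<kappa>' * (v - u)" by (simp add: algebra_simps)
      also have "\<dots> \<le> (2 + \<kappa>') * (v - u)" using A B by (simp add: algebra_simps)
      finally have "k1 * (r - l) \<le> v - u" unfolding k1_def using \<kappa>' by (simp add: field_simps)
      moreover have "k * (r - l) \<le> k1 * (r - l)" unfolding k_def using lr by (intro mult_right_mono) auto
      ultimately show ?thesis by simp
    qed
    then show "\<exists>u v. l < u \<and> u < v \<and> v < r \<and> gap l u \<and> gap v r \<and>
        survivors \<inter> {u<..<v} = {} \<and> k * (r - l) \<le> v - u"
      using o gs S by blast
  qed
qed

text \<open>Iterated splitting to depth \<open>D\<close>: both the maximal length and the sum of the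
  s-th powers decrease geometrically. Lists make the sum additive under concatenation, without a
  disjointness condition.\<close>

lemma gap_cover:
  assumes k: "0 < k" "k \<le> 1" and s: "0 < s" "s < 1"
    and split: "\<And>l r. gap l r \<Longrightarrow> \<exists>u v. l < u \<and> u < v \<and> v < r \<and> gap l u \<and> gap v r \<and>
        survivors \<inter> {u<..<v} = {} \<and> k * (r - l) \<le> v - u"
    and g: "gap l r"
  shows "\<exists>xs. (\<forall>x\<in>survivors \<inter> {l..r}. \<exists>(p, q)\<in>set xs. p \<le> x \<and> x \<le> q) \<and>
     (\<forall>(p, q)\<in>set xs. p \<le> q \<and> q - p \<le> (1 - k) ^ D * (r - l)) \<and>
     (\<Sum>(p, q)\<leftarrow>xs. (q - p) powr s) \<le> (s * (1 - k) + 2 * (1 - s)) ^ D * (r - l) powr s"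
  using g
proof (induction D arbitrary: l r)
  case 0
  then have "l \<le> r" using h_less_imp_less[of l r] by (simp add: gap_def)
  then show ?case by (intro exI[of _ "[(l, r)]"]) auto
next
  case (Suc D)
  let ?\<theta> = "s * (1 - k) + 2 * (1 - s)"
  have \<theta>: "?\<theta> \<ge> 0" using k s by simp
  obtain u v where uv: "l < u" "u < v" "v < r" "gap l u" "gap v r"
    "survivors \<inter> {u<..<v} = {}" "k * (r - l) \<le> v - u"
    using split[OF Suc.prems] by blast
  obtain xs where xs: "\<forall>x\<in>survivors \<inter> {l..u}. \<exists>(p, q)\<in>set xs. p \<le> x \<and> x \<le> q"
     "\<forall>(p, q)\<in>set xs. p \<le> q \<and> q - p \<le> (1 - k) ^ D * (u - l)"
     "(\<Sum>(p, q)\<leftarrow>xs. (q - p) powr s) \<le> ?\<theta> ^ D * (u - l) powr s"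
    using Suc.IH[OF uv(4)] by blast
  obtain ys where ys: "\<forall>x\<in>survivors \<inter> {v..r}. \<exists>(p, q)\<in>set ys. p \<le> x \<and> x \<le> q"
     "\<forall>(p, q)\<in>set ys. p \<le> q \<and> q - p \<le> (1 - k) ^ D * (r - v)"
     "(\<Sum>(p, q)\<leftarrow>ys. (q - p) powr s) \<le> ?\<theta> ^ D * (r - v) powr s"
    using Suc.IH[OF uv(5)] by blast
  have tot: "(u - l) + (r - v) \<le> (1 - k) * (r - l)" using uv(7) by (simp add: algebra_simps)
  have le: "(1 - k) ^ D * z \<le> (1 - k) ^ Suc D * (r - l)" if "z \<le> (1 - k) * (r - l)" for z
    using mult_left_mono[OF that, of "(1 - k) ^ D"] k by (simp add: ac_simps)
  show ?case
  proof (intro exI[of _ "xs @ ys"] conjI)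
    show "\<forall>x\<in>survivors \<inter> {l..r}. \<exists>(p, q)\<in>set (xs @ ys). p \<le> x \<and> x \<le> q"
    proof
      fix x assume x: "x \<in> survivors \<inter> {l..r}"
      then have "x \<notin> {u<..<v}" using uv(6) by blast
      then have "x \<in> survivors \<inter> {l..u} \<or> x \<in> survivors \<inter> {v..r}" using x by auto
      then show "\<exists>(p, q)\<in>set (xs @ ys). p \<le> x \<and> x \<le> q"
        unfolding set_append bex_Un using xs(1) ys(1) by blast
    qed
    have "(1 - k) ^ D * (u - l) \<le> (1 - k) ^ Suc D * (r - l)" "(1 - k) ^ D * (r - v) \<le> (1 - k) ^ Suc D * (r - l)"
      using tot uv by (intro le; simp)+
    then show "\<forall>(p, q)\<in>set (xs @ ys). p \<le> q \<and> q - p \<le> (1 - k) ^ Suc D * (r - l)"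
      unfolding set_append ball_Un by (intro conjI pairs_le_weaken[OF xs(2)] pairs_le_weaken[OF ys(2)])
    have "(\<Sum>(p, q)\<leftarrow>xs @ ys. (q - p) powr s) \<le> ?\<theta> ^ D * ((u - l) powr s + (r - v) powr s)"
      using xs(3) ys(3) by (simp add: distrib_left)
    also have "\<dots> \<le> ?\<theta> ^ D * (?\<theta> * (r - l) powr s)"
      using uv tot s \<theta> by (intro mult_left_mono powr_sum_contraction) auto
    finally show "(\<Sum>(p, q)\<leftarrow>xs @ ys. (q - p) powr s) \<le> ?\<theta> ^ Suc D * (r - l) powr s"
      by (simp add: ac_simps)
  qed
qed

lemma survivors_covers:
  assumes sq: "scale_sequence \<rho> Q d" and growth: "\<And>n. Q (Suc n) \<le> c * Q n"
  obtains s where "0 < s" "s < 1"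
    "\<And>e. 0 < e \<Longrightarrow> \<exists>xs. (\<forall>x\<in>survivors \<inter> {b..a+1}. \<exists>(p, q)\<in>set xs. p \<le> x \<and> x \<le> q) \<and>
     (\<forall>(p, q)\<in>set xs. p \<le> q \<and> q - p \<le> e) \<and> (\<Sum>(p, q)\<leftarrow>xs. (q - p) powr s) \<le> e"
proof -
  obtain k where k: "0 < k" "k \<le> 1"
    and split: "\<And>l r. gap l r \<Longrightarrow> \<exists>u v. l < u \<and> u < v \<and> v < r \<and> gap l u \<and> gap v r \<and>
        survivors \<inter> {u<..<v} = {} \<and> k * (r - l) \<le> v - u"
    by (rule gap_split[OF sq growth], rule that)
  \<comment> \<open>This exponent turns the contraction factor into
    \<open>1 - s * k / 2\<close>.\<close>
  define s where "s = 1 / (1 + k / 2)"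
  have s: "0 < s" "s < 1" using k unfolding s_def by (auto simp: divide_simps)
  define \<theta> where "\<theta> = s * (1 - k) + 2 * (1 - s)"
  have "s * (1 + k / 2) = 1" using k unfolding s_def by simp
  then have \<theta>_eq: "\<theta> = 1 - s * k / 2" unfolding \<theta>_def by (simp add: algebra_simps)
  have \<theta>: "0 \<le> \<theta>" "\<theta> < 1"
  proof -
    show "0 \<le> \<theta>" unfolding \<theta>_def using k s by simp
    show "\<theta> < 1" unfolding \<theta>_eq using k s by simp
  qed
  define w where "w = a + 1 - b"
  have w: "0 < w" "w < 1" unfolding w_def using a_less_b b_less by auto
  show ?thesis
  proof (rule that[OF s])
    fix e :: real assume e: "e > 0"
    have "(\<lambda>D. (1 - k) ^ D) \<longlonglongrightarrow> 0" "(\<lambda>D. \<theta> ^ D) \<longlonglongrightarrow> 0"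
      using k \<theta> by (auto intro!: LIMSEQ_realpow_zero)
    then have "\<forall>\<^sub>F D in sequentially. (1 - k) ^ D < e" "\<forall>\<^sub>F D in sequentially. \<theta> ^ D < e"
      using e by (auto intro: order_tendstoD)
    then have "\<forall>\<^sub>F D in sequentially. (1 - k) ^ D < e \<and> \<theta> ^ D < e" by (rule eventually_conj)
    then obtain D where D: "(1 - k) ^ D < e" "\<theta> ^ D < e" by (auto simp: eventually_sequentially)
    obtain xs where xs: "\<forall>x\<in>survivors \<inter> {b..a+1}. \<exists>(p, q)\<in>set xs. p \<le> x \<and> x \<le> q"
     "\<forall>(p, q)\<in>set xs. p \<le> q \<and> q - p \<le> (1 - k) ^ D * w"
     "(\<Sum>(p, q)\<leftarrow>xs. (q - p) powr s) \<le> \<theta> ^ D * w powr s"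
      using gap_cover[OF k s split gap_root, of D] unfolding \<theta>_def w_def by blast
    have "(1 - k) ^ D * w \<le> (1 - k) ^ D * 1" using k w by (intro mult_left_mono) auto
    then have 1: "(1 - k) ^ D * w \<le> e" using D by simp
    have "w powr s \<le> 1" using w s by (intro powr_le1) auto
    then have "\<theta> ^ D * w powr s \<le> \<theta> ^ D * 1" using \<theta> by (intro mult_left_mono) auto
    then have 2: "\<theta> ^ D * w powr s \<le> e" using D by simp
    have "\<forall>(p, q)\<in>set xs. p \<le> q \<and> q - p \<le> e" by (rule pairs_le_weaken[OF xs(2) 1])
    moreover have "(\<Sum>(p, q)\<leftarrow>xs. (q - p) powr s) \<le> e" using xs(3) 2 by simp
    ultimately show "\<exists>xs. (\<forall>x\<in>survivors \<inter> {b..a+1}. \<exists>(p, q)\<in>set xs. p \<le> x \<and> x \<le> q) \<and>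
       (\<forall>(p, q)\<in>set xs. p \<le> q \<and> q - p \<le> e) \<and> (\<Sum>(p, q)\<leftarrow>xs. (q - p) powr s) \<le> e"
      using xs(1) by blast
  qed
qed

end

lemma dist_circ_proj_le: "dist (circ_proj x) (circ_proj y) \<le> 2 * pi * \<bar>x - y\<bar>"
proof -
  define t where "t = 2 * pi * (x - y)"
  have "circ_proj x - circ_proj y = cis (2 * pi * y) * (cis t - 1)"
    unfolding circ_proj_def t_def by (simp add: algebra_simps cis_mult)
  then have "dist (circ_proj x) (circ_proj y) = norm (cis t - 1)"
    by (simp add: dist_norm norm_mult)
  also have "\<dots> = 2 * \<bar>sin (t / 2)\<bar>" unfolding cis_conv_exp by (rule dist_exp_i_1)
  also have "\<dots> \<le> 2 * \<bar>t / 2\<bar>" by (intro mult_left_mono abs_sin_x_le_abs_x) auto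
  finally show ?thesis unfolding t_def by (simp add: abs_mult)
qed

text \<open>\<open>circ_proj\<close> is Lipschitz with constant 2 * pi, so projecting a cover costs
  a factor \<open>(2 * pi) powr s\<close> in the sum. The measure of exponent \<open>s\<close>
  vanishes, which bounds the dimension by \<open>s\<close>.\<close>

lemma hausdorff_dim_less_1:
  fixes A :: "complex set"
  assumes A: "A \<subseteq> circ_proj ` S" and s: "0 < s" "s < 1"
    and cover: "\<And>e. 0 < e \<Longrightarrow> \<exists>xs. (\<forall>x\<in>S. \<exists>(p, q)\<in>set xs. p \<le> x \<and> x \<le> q) \<and>
     (\<forall>(p, q)\<in>set xs. p \<le> q \<and> q - p \<le> e) \<and> (\<Sum>(p, q)\<leftarrow>xs. (q - p) powr s) \<le> e"
  shows "hausdorff_dim A < 1"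
proof -
  have "(INF X\<in>{X :: nat \<Rightarrow> complex set. A \<subseteq> (\<Union>i. X i) \<and> (\<forall>i. bounded (X i) \<and> diameter (X i) \<le> d)}.
        \<Sum>i. diam_pow s (X i)) \<le> 0" (is "?I \<le> 0") if d: "d > 0" for d
  proof (rule ennreal_le_epsilon)
    fix \<epsilon> :: real assume \<epsilon>: "0 < \<epsilon>"
    define e where "e = min (d / (2 * pi)) (\<epsilon> / (2 * pi) powr s)"
    have e: "e > 0" "2 * pi * e \<le> d" "(2 * pi) powr s * e \<le> \<epsilon>"
    proof -
      show "e > 0" unfolding e_def using d \<epsilon> by simp
      have "e \<le> d / (2 * pi)" unfolding e_def by (rule min.cobounded1)
      then show "2 * pi * e \<le> d" by (simp add: pos_le_divide_eq mult.commute)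
      have "e \<le> \<epsilon> / (2 * pi) powr s" unfolding e_def by (rule min.cobounded2)
      then show "(2 * pi) powr s * e \<le> \<epsilon>" by (simp add: pos_le_divide_eq mult.commute)
    qed
    obtain xs where xs: "\<forall>x\<in>S. \<exists>(p, q)\<in>set xs. p \<le> x \<and> x \<le> q"
      "\<forall>(p, q)\<in>set xs. p \<le> q \<and> q - p \<le> e" "(\<Sum>(p, q)\<leftarrow>xs. (q - p) powr s) \<le> e"
      using cover[OF e(1)] by blast
    define Y where "Y = (\<lambda>I :: real \<times> real. circ_proj ` {fst I..snd I})"
    \<comment> \<open>The finite list is padded with empty sets, which contribute 0 by the
      convention in \<open>diam_pow\<close>.\<close>
    define X where "X = (\<lambda>i. if i < length xs then Y (xs ! i) else {})"
    have diamY: "diameter (Y I) \<le> 2 * pi * (snd I - fst I)" if "I \<in> set xs" for I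
    proof (rule diameter_le)
      have "fst I \<le> snd I" using xs(2) that by (auto simp: case_prod_beta)
      then show "Y I \<noteq> {} \<or> 0 \<le> 2 * pi * (snd I - fst I)" by simp
      fix y z assume "y \<in> Y I" "z \<in> Y I"
      then obtain t t' where t: "t \<in> {fst I..snd I}" "t' \<in> {fst I..snd I}" "y = circ_proj t" "z = circ_proj t'"
        unfolding Y_def by blast
      have "norm (y - z) \<le> 2 * pi * \<bar>t - t'\<bar>" using dist_circ_proj_le[of t t'] t by (simp add: dist_norm)
      also have "\<dots> \<le> 2 * pi * (snd I - fst I)" using t by (intro mult_left_mono) auto
      finally show "norm (y - z) \<le> 2 * pi * (snd I - fst I)" .
    qed
    have bY: "bounded (Y I)" for I
    proof -
      have "norm y \<le> 1" if "y \<in> Y I" for y using that unfolding Y_def circ_proj_def by auto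
      then show ?thesis by (rule boundedI)
    qed
    have "A \<subseteq> (\<Union>i. X i)"
    proof
      fix z assume "z \<in> A"
      then obtain x where x: "x \<in> S" "z = circ_proj x" using A by blast
      obtain I where I: "I \<in> set xs" "fst I \<le> x" "x \<le> snd I" using xs(1) x(1) by fastforce
      obtain i where "i < length xs" "xs ! i = I" using I(1) by (auto simp: in_set_conv_nth)
      then show "z \<in> (\<Union>i. X i)" using I x unfolding X_def Y_def by auto
    qed
    moreover have "bounded (X i) \<and> diameter (X i) \<le> d" for i
    proof (cases "i < length xs")
      case True
      then have I: "xs ! i \<in> set xs" by simp
      have "diameter (Y (xs ! i)) \<le> 2 * pi * e"
        using diamY[OF I] xs(2) I by (intro order_trans[OF diamY[OF I]] mult_left_mono) (auto simp: case_prod_beta)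
      then show ?thesis using True bY e unfolding X_def by simp
    qed (use d in \<open>simp add: X_def\<close>)
    ultimately have "?I \<le> (\<Sum>i. diam_pow s (X i))" by (intro INF_lower) auto
    also have "\<dots> = (\<Sum>i<length xs. diam_pow s (X i))"
      by (rule suminf_finite) (auto simp: X_def diam_pow_def)
    also have "\<dots> \<le> (\<Sum>i<length xs. ennreal ((2 * pi) powr s * (snd (xs ! i) - fst (xs ! i)) powr s))"
    proof (rule sum_mono)
      fix i assume i: "i \<in> {..<length xs}"
      then have I: "xs ! i \<in> set xs" by simp
      have ge: "fst (xs ! i) \<le> snd (xs ! i)" using xs(2) I by (auto simp: case_prod_beta)
      have "diameter (X i) powr s \<le> (2 * pi * (snd (xs ! i) - fst (xs ! i))) powr s"
        using diamY[OF I] i s bY by (intro powr_mono2) (auto simp: X_def diameter_ge_0)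
      also have "\<dots> = (2 * pi) powr s * (snd (xs ! i) - fst (xs ! i)) powr s"
        using ge by (intro powr_mult)
      finally show "diam_pow s (X i) \<le> ennreal ((2 * pi) powr s * (snd (xs ! i) - fst (xs ! i)) powr s)"
        using s unfolding diam_pow_def by (auto intro: ennreal_leI)
    qed
    also have "\<dots> = ennreal (\<Sum>i<length xs. (2 * pi) powr s * (snd (xs ! i) - fst (xs ! i)) powr s)"
      by (rule sum_ennreal) auto
    also have "(\<Sum>i<length xs. (2 * pi) powr s * (snd (xs ! i) - fst (xs ! i)) powr s) =
        (2 * pi) powr s * (\<Sum>(p, q)\<leftarrow>xs. (q - p) powr s)"
      by (simp add: sum_list_sum_nth sum_distrib_left case_prod_beta atLeast0LessThan)
    also have "ennreal \<dots> \<le> ennreal \<epsilon>"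
      by (intro ennreal_leI order_trans[OF mult_left_mono[OF xs(3)] e(3)]) simp
    finally show "?I \<le> 0 + ennreal \<epsilon>" by simp
  qed
  then have "hausdorff_measure s A = 0"
    unfolding hausdorff_measure_def by (intro antisym SUP_least) auto
  then have "hausdorff_dim A \<le> ennreal s"
    unfolding hausdorff_dim_def using s by (intro Inf_lower) auto
  also have "\<dots> < 1" using s by (simp add: ennreal_less_one_iff)
  finally show ?thesis .
qed

section \<open>Back to the circle\<close>

lemma circ_proj_in_circle: "circ_proj x \<in> circle"
  by (simp add: circ_proj_def)

lemma circle_lift:
  assumes "z \<in> circle"
  obtains x where "z = circ_proj x" "t \<le> x" "x < t + 1"
proof -
  have "cis (Arg z) = z" using assms cis_Arg[of z] by (force simp: sgn_div_norm)
  then have z: "z = circ_proj (Arg z / (2 * pi))" by (simp add: circ_proj_def)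
  define y where "y = Arg z / (2 * pi)"
  define x where "x = y - of_int \<lfloor>y - t\<rfloor>"
  have "circ_proj x = circ_proj y" unfolding circ_proj_eq_iff x_def
    by (intro exI[of _ "- \<lfloor>y - t\<rfloor>"]) simp
  moreover have "t \<le> x" "x < t + 1" unfolding x_def by linarith+
  ultimately show ?thesis using that z y_def by metis
qed

lemma continuous_on_circ_proj: "continuous_on S circ_proj"
  unfolding circ_proj_def by (intro continuous_intros)

lemma circ_proj_in_arc_iff: "circ_proj x \<in> circ_proj ` {a<..<b} \<longleftrightarrow> flat_hit a b x"
proof
  assume "circ_proj x \<in> circ_proj ` {a<..<b}"
  then obtain y where y: "y \<in> {a<..<b}" "circ_proj x = circ_proj y" by blast
  then obtain n :: int where "x = y + of_int n" unfolding circ_proj_eq_iff by blast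
  then show "flat_hit a b x" using y(1) unfolding flat_hit_def by (intro exI[of _ n]) auto
next
  assume "flat_hit a b x"
  then obtain n :: int where n: "a + of_int n < x" "x < b + of_int n" unfolding flat_hit_def by blast
  have "circ_proj x = circ_proj (x - of_int n)" unfolding circ_proj_eq_iff by (intro exI[of _ n]) simp
  then show "circ_proj x \<in> circ_proj ` {a<..<b}" using n by auto
qed

lemma not_flat_hit_middle: "b \<le> x \<Longrightarrow> x \<le> a + 1 \<Longrightarrow> \<not> flat_hit a b x"
proof
  assume x: "b \<le> x" "x \<le> a + 1" "flat_hit a b x"
  then obtain n :: int where n: "a + of_int n < x" "x < b + of_int n" unfolding flat_hit_def by blast
  then have "(of_int n :: real) < 1" "(0 :: real) < of_int n" using x by linarith+
  then show False by simp
qed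

lemma iter_lift:
  assumes "is_lift f F"
  shows "(F ^^ j) (circ_proj x) = circ_proj ((f ^^ j) x)"
  using assms by (induction j) (auto simp: is_lift_def)

text \<open>On the open arc the values of the lift differ by integers, hence by connectedness not at
  all; the endpoints follow by continuity.\<close>

lemma flat_on_closed_arc:
  assumes f: "is_lift f F" and U: "F ` circ_proj ` {a<..<b} = {c}" and "a < b"
  shows "f a = f b"
proof -
  define m where "m = (a + b) / 2"
  have m: "m \<in> {a<..<b}" using \<open>a < b\<close> unfolding m_def by auto
  have cf: "continuous_on S f" for S using f continuous_on_subset unfolding is_lift_def by blast
  have "f x - f m = f m - f m" if "x \<in> {a<..<b}" for x
  proof (rule integer_valued_constant[of "{a<..<b}" "\<lambda>x. f x - f m"])
    show "continuous_on {a<..<b} (\<lambda>x. f x - f m)" by (intro continuous_intros cf)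
    fix y assume y: "y \<in> {a<..<b}"
    have "circ_proj (f y) = c" "circ_proj (f m) = c"
      using U f y m unfolding is_lift_def by auto
    then obtain n :: int where "f y = f m + of_int n" using circ_proj_eq_iff by metis
    then show "\<exists>n::int. f y - f m = of_int n" by (intro exI[of _ n]) simp
  qed (use that m in auto)
  then have const: "f x = f m" if "x \<in> {a<..<b}" for x using that by simp
  have "f x = f m" if "x \<in> closure {a<..<b}" for x
    by (rule continuous_constant_on_closure[OF cf const that])
  then show ?thesis using \<open>a < b\<close> by (simp add: closure_greaterThanLessThan)
qed

context flat_dynamics
begin

lemma no_periodic_point: "n \<ge> 1 \<Longrightarrow> (f ^^ n) x \<noteq> x + of_int k"
proof
  assume n: "n \<ge> 1" and "(f ^^ n) x = x + of_int k"
  then have "h ((f ^^ n) x) = h (x + of_int k)" by simp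
  then have "real n * \<rho> = of_int k" by simp
  then have "\<rho> = of_int k / real n" using n by (simp add: field_simps)
  then show False using irrational by (auto intro: Rats_divide)
qed

lemma circ_proj_survivor_iff:
  assumes "is_lift f F" "U = circ_proj ` {a<..<b}"
  shows "circ_proj x \<notin> (\<Union>i. (F ^^ i) -` U) \<longleftrightarrow> x \<in> survivors"
  unfolding survivors_def by (simp add: iter_lift[OF assms(1)] assms(2) circ_proj_in_arc_iff)

text \<open>If the orbit of \<open>z\<close> enters \<open>U\<close> at time \<open>i\<close>, then \<open>F\<^sup>i\<^sup>+\<^sup>1\<close> is constant near \<open>z\<close>; a return of
  this neighbourhood to itself would make that constant a periodic point.\<close>

lemma nonwandering_subset:
  assumes f: "is_lift f F" and U: "U = circ_proj ` {a<..<b}" and c: "F ` U = {c}"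
    and F: "F ` circle \<subseteq> circle" "continuous_on circle F"
  shows "nonwandering F \<subseteq> circ_proj ` (survivors \<inter> {b..a+1})"
proof
  fix z assume z: "z \<in> nonwandering F"
  then have zc: "z \<in> circle" unfolding nonwandering_def by blast
  obtain x where x: "z = circ_proj x" "b \<le> x" "x < b + 1" using circle_lift[OF zc, of b] .
  \<comment> \<open>The complement is the continuous image of a compact interval, hence closed; this
    makes \<open>U\<close> relatively open.\<close>
  have "circle - U = circ_proj ` {b..a+1}"
  proof (intro equalityI subsetI)
    fix w assume w: "w \<in> circle - U"
    obtain y where y: "w = circ_proj y" "b \<le> y" "y < b + 1" using circle_lift[of w b] w by blast
    have "circ_proj y \<notin> circ_proj ` {a<..<b}" using w y(1) U by simp
    then have "\<not> flat_hit a b y" unfolding circ_proj_in_arc_iff .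
    then have "\<not> (a + of_int 1 < y \<and> y < b + of_int 1)" unfolding flat_hit_def by blast
    then show "w \<in> circ_proj ` {b..a+1}" using y by auto
  next
    fix w assume "w \<in> circ_proj ` {b..a+1}"
    then obtain y where "w = circ_proj y" "y \<in> {b..a+1}" by blast
    then show "w \<in> circle - U"
      using not_flat_hit_middle[of b y a] circ_proj_in_circle[of y] unfolding U circ_proj_in_arc_iff[symmetric] by auto
  qed
  moreover have "closed (circ_proj ` {b..a+1})"
    by (intro compact_imp_closed compact_continuous_image continuous_on_circ_proj) auto
  ultimately have "closedin (top_of_set circle) (circle - U)"
    by (metis Diff_subset closed_subset)
  moreover have "U \<subseteq> circle" using circ_proj_in_circle unfolding U by auto
  ultimately have oU: "openin (top_of_set circle) U"
    by (simp add: openin_closedin_eq)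
  have it: "continuous_on circle (F ^^ i) \<and> (F ^^ i) ` circle \<subseteq> circle" for i
  proof (induction i)
    case (Suc i)
    then show ?case unfolding funpow.simps image_comp[symmetric] using F
      by (intro conjI continuous_on_compose continuous_on_subset[OF F(2)]) blast+
  qed (simp add: id_def)
  have "\<not> flat_hit a b ((f ^^ i) x)" for i
  proof
    assume hit: "flat_hit a b ((f ^^ i) x)"
    define V where "V = circle \<inter> (F ^^ i) -` U"
    have "openin (top_of_set circle) V"
      unfolding V_def using it[of i] by (intro continuous_openin_preimage[OF _ _ oU]) auto
    moreover have "z \<in> V"
      using hit zc unfolding V_def x(1) by (simp add: iter_lift[OF f] U circ_proj_in_arc_iff)
    ultimately obtain n w where n: "n \<ge> 1" "w \<in> V" "(F ^^ n) w \<in> V"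
      using z unfolding nonwandering_def by blast
    have FV: "(F ^^ Suc i) v = c" if "v \<in> V" for v using that c unfolding V_def by auto
    obtain y where y: "w = circ_proj y" using circle_lift[of w 0] n(2) unfolding V_def by blast
    define s where "s = (f ^^ Suc i) y"
    have cs: "c = circ_proj s" using FV[OF n(2)] unfolding y s_def iter_lift[OF f] by simp
    have "circ_proj ((f ^^ n) s) = (F ^^ n) ((F ^^ Suc i) w)"
      unfolding s_def y iter_lift[OF f] ..
    also have "\<dots> = (F ^^ Suc i) ((F ^^ n) w)" by (simp only: funpow_add[symmetric] o_apply[symmetric, of "F ^^ _" "F ^^ _"] add.commute)
    also have "\<dots> = circ_proj s" using FV[OF n(3)] cs by simp
    finally obtain k :: int where "(f ^^ n) s = s + of_int k" unfolding circ_proj_eq_iff by blast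
    then show False using no_periodic_point[OF n(1)] by blast
  qed
  then have S: "x \<in> survivors" unfolding survivors_def by blast
  then have "\<not> flat_hit a b x" unfolding survivors_def by (metis funpow_0 mem_Collect_eq)
  then have "\<not> (a + of_int 1 < x \<and> x < b + of_int 1)" unfolding flat_hit_def by blast
  then have "x \<le> a + 1" using x by simp
  then show "z \<in> circ_proj ` (survivors \<inter> {b..a+1})" using S x by auto
qed

lemma complement_null:
  assumes f: "is_lift f F" and U: "U = circ_proj ` {a<..<b}"
    and sq: "scale_sequence \<rho> Q d"
  shows "circle - (\<Union>i. (F ^^ i) -` U) \<in> null_sets circle_lebesgue"
proof -
  let ?K = "circle - (\<Union>i. (F ^^ i) -` U)"
  have K: "?K = circ_proj ` (survivors \<inter> {0..1})"
  proof (intro equalityI subsetI)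
    fix z assume z: "z \<in> ?K"
    obtain x where x: "z = circ_proj x" "0 \<le> x" "x < 0 + 1" using circle_lift[of z 0] z by blast
    have "x \<in> survivors" using z unfolding x(1) using circ_proj_survivor_iff[OF f U, of x] by blast
    then show "z \<in> circ_proj ` (survivors \<inter> {0..1})" using x by auto
  next
    fix z assume "z \<in> circ_proj ` (survivors \<inter> {0..1})"
    then obtain x where x: "z = circ_proj x" "x \<in> survivors" by blast
    then show "z \<in> ?K" using circ_proj_survivor_iff[OF f U, of x] circ_proj_in_circle[of x] by blast
  qed
  have "compact (survivors \<inter> {0..1})" by (intro closed_Int_compact closed_survivors) auto
  then have "closed ?K" unfolding K
    by (intro compact_imp_closed compact_continuous_image continuous_on_circ_proj)
  then have Kb: "?K \<in> sets borel" by simp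
  have cm: "circ_proj \<in> borel_measurable borel"
    using continuous_on_circ_proj by (rule borel_measurable_continuous_onI)
  then have m: "circ_proj \<in> measurable (restrict_space lborel {0..<1}) borel"
    by (intro measurable_restrict_space1) simp
  have sub: "circ_proj -` ?K \<inter> {0..<1} \<subseteq> survivors \<inter> {0..1}"
  proof
    fix x assume "x \<in> circ_proj -` ?K \<inter> {0..<1}"
    then show "x \<in> survivors \<inter> {0..1}" using circ_proj_survivor_iff[OF f U, of x] by auto
  qed
  have cS: "survivors \<inter> {0..1} \<in> sets lborel" using closed_survivors by (simp add: borel_closed closed_Int)
  have "emeasure lebesgue (survivors \<inter> {0..1}) = 0"
    using negligible_survivors[OF sq, of 0 1] unfolding negligible_iff_null_sets by auto
  then have null: "emeasure lborel (survivors \<inter> {0..1}) = 0" using cS by simp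
  have "emeasure circle_lebesgue ?K = emeasure (restrict_space lborel {0..<1}) (circ_proj -` ?K \<inter> {0..<1})"
    unfolding circle_lebesgue_def using m Kb by (subst emeasure_distr) (simp_all add: space_restrict_space)
  also have "\<dots> = emeasure lborel (circ_proj -` ?K \<inter> {0..<1})"
    by (rule emeasure_restrict_space) auto
  also have "\<dots> \<le> emeasure lborel (survivors \<inter> {0..1})"
    using sub cS by (rule emeasure_mono)
  finally have "emeasure circle_lebesgue ?K = 0" using null by simp
  then show ?thesis using Kb unfolding circle_lebesgue_def by (intro null_setsI) auto
qed

end

section \<open>Scales of the rotation number and the conclusion\<close>

lemma cf_scale_sequence:
  assumes "r \<notin> \<rat>"
  shows "scale_sequence (r + of_int z) (\<lambda>n. nat (cf_denom r (Suc n))) (cf_error r)"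
  unfolding scale_sequence_def
proof (intro conjI allI)
  show "rotation_scale (r + of_int z) (nat (cf_denom r (Suc n))) (cf_error r n)" for n
    using assms by (rule cf_rotation_scale)
  show "cf_error r \<longlonglongrightarrow> 0" using assms by (rule cf_error_tendsto_0)
  show "\<exists>n. N \<le> nat (cf_denom r (Suc n))" for N
    using cf_denom_ge[OF assms, of "Suc N"] by (intro exI[of _ N]) linarith
  fix n t
  obtain m and p :: int where "m \<le> 4 * nat (cf_denom r (Suc n))"
    "t < of_int p - real m * (r + of_int z)" "of_int p - real m * (r + of_int z) < t + cf_error r n"
    by (rule cf_backward_hit[OF assms])
  then show "\<exists>m (p::int). m \<le> 4 * nat (cf_denom r (Suc n)) \<and> t < of_int p - real m * (r + of_int z) \<and>
      of_int p - real m * (r + of_int z) < t + cf_error r n" by blast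
qed

lemma bounded_type_growth:
  assumes irr: "r \<notin> \<rat>" and bt: "bounded_type r"
  obtains c where "\<And>n. nat (cf_denom r (Suc (Suc n))) \<le> c * nat (cf_denom r (Suc n))"
proof -
  obtain B where B: "\<And>n. n \<ge> 1 \<Longrightarrow> real_of_int (cf_denom r n) / real_of_int (cf_denom r (n - 1)) \<le> B"
    using bt unfolding bounded_type_def by blast
  show ?thesis
  proof (rule that[of "nat \<lceil>B\<rceil>"])
    fix n
    let ?q = "cf_denom r (Suc n)" and ?q' = "cf_denom r (Suc (Suc n))"
    have q: "?q \<ge> 1" using cf_denom_pos[OF irr] .
    have q': "?q' \<ge> 1" using cf_denom_pos[OF irr] .
    have "real_of_int ?q' / real_of_int ?q \<le> B" using B[of "Suc (Suc n)"] by simp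
    then have "real_of_int ?q' \<le> B * real_of_int ?q" using q by (simp add: divide_le_eq del: cf_denom.simps)
    also have "\<dots> \<le> real_of_int \<lceil>B\<rceil> * real_of_int ?q" using q by (intro mult_right_mono) auto
    finally have le: "?q' \<le> \<lceil>B\<rceil> * ?q" by (simp del: cf_denom.simps flip: of_int_mult)
    \<comment> \<open>The sign is what allows \<open>nat\<close> to distribute over the
      product.\<close>
    then have "\<lceil>B\<rceil> \<ge> 0" using q q' by (smt (verit) mult_nonneg_nonneg zero_less_mult_iff mult_neg_pos)
    then show "nat ?q' \<le> nat \<lceil>B\<rceil> * nat ?q" using le q
      by (simp del: cf_denom.simps flip: nat_mult_distrib)
  qed
qed

theorem theorem1:
  fixes F :: "complex \<Rightarrow> complex" and U :: "complex set" and \<nu> :: real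
  assumes "\<nu> > 1"
    and "almost_smooth_flat_spot F U \<nu> \<nu>"
    and "rotation_number F \<notin> \<rat>"
  shows "circle - (\<Union>i. (F ^^ i) -` U) \<in> null_sets circle_lebesgue \<and>
         (bounded_type (rotation_number F) \<longrightarrow> hausdorff_dim (nonwandering F) < 1)"
proof -
  note asm = assms(2)[unfolded almost_smooth_flat_spot_def]
  obtain f where F: "F ` circle \<subseteq> circle" "continuous_on circle F"
    and f: "is_lift f F" "mono f" "\<And>x. f (x + 1) = f x + 1"
    using asm unfolding monotone_degree_one_def by blast
  obtain a b where ab: "lifts_arc a b U" using asm by blast
  then have ab': "a < b" "b < a + 1" "U = circ_proj ` {a<..<b}" unfolding lifts_arc_def by auto
  obtain c where c: "F ` U = {c}" using asm by blast
  have loc: "C2_diffeo_on f {b<..<a + 1} \<and>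
        (\<exists>h e. e > 0 \<and> C2_diffeo_on h {-e<..<e} \<and> (\<forall>\<^sub>F x in at_right b. f x = h ((x - b) powr \<nu>))) \<and>
        (\<exists>h e. e > 0 \<and> C2_diffeo_on h {-e<..<e} \<and> (\<forall>\<^sub>F x in at_left a. f x = h ((a - x) powr \<nu>)))"
    using asm f(1) ab by blast
  obtain hr er where R: "C2_diffeo_on hr {-er<..<er}" "er > 0" "\<forall>\<^sub>F x in at_right b. f x = hr ((x - b) powr \<nu>)"
    using loc by blast
  obtain hl el where L: "C2_diffeo_on hl {-el<..<el}" "el > 0" "\<forall>\<^sub>F x in at_left a. f x = hl ((a - x) powr \<nu>)"
    using loc by blast
  have cont: "continuous_on UNIV f" using f(1) unfolding is_lift_def by blast
  have flat: "f a = f b" using flat_on_closed_arc[OF f(1) _ ab'(1)] c unfolding ab'(3) by blast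
  obtain C where C: "C \<ge> 0" "\<And>\<alpha> \<beta> \<gamma> \<delta>. \<alpha> \<le> \<beta> \<Longrightarrow> b \<le> \<beta> \<Longrightarrow> \<beta> < \<gamma> \<Longrightarrow> \<gamma> \<le> a + 1 \<Longrightarrow> \<gamma> \<le> \<delta> \<Longrightarrow>
     f \<beta> < f \<gamma> \<and> cr (f \<alpha>) (f \<beta>) (f \<gamma>) (f \<delta>) \<le> exp (C * (\<delta> - \<alpha>)) * cr \<alpha> \<beta> \<gamma> \<delta>"
    using cr_one_step[OF less_imp_le[OF assms(1)] cont f(2,3) ab'(1,2) flat conjunct1[OF loc] R L] by blast
  obtain \<rho> where \<rho>: "\<And>n x. \<bar>(f ^^ n) x - x - real n * \<rho>\<bar> \<le> 2"
    by (rule translation_number_bound[OF f(2,3)], rule that)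
  have rot: "rotation_number F = frac \<rho>" by (rule rotation_number_eq[OF f(1,3) \<rho>])
  define r where "r = rotation_number F"
  have r: "r \<notin> \<rat>" using assms(3) unfolding r_def .
  \<comment> \<open>The chosen lift has translation number \<open>\<rho>\<close>, the continued
    fraction is that of its fractional part \<open>r\<close>; the integer parameter \<open>z\<close>
    of the arithmetic lemmas is instantiated with the floor of \<open>\<rho>\<close>.\<close>
  have \<rho>r: "\<rho> = r + of_int \<lfloor>\<rho>\<rfloor>" unfolding r_def rot by (simp add: frac_def)
  have "\<rho> \<notin> \<rat>"
  proof
    assume "\<rho> \<in> \<rat>"
    then have "\<rho> - of_int \<lfloor>\<rho>\<rfloor> \<in> \<rat>" by (intro Rats_diff) auto
    moreover have "\<rho> - of_int \<lfloor>\<rho>\<rfloor> = r" using \<rho>r by linarith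
    ultimately show False using r by simp
  qed
  obtain h where h: "mono h" "\<And>x. h (f x) = h x + \<rho>" "\<And>x. h (x + 1) = h x + 1" "h b = 0"
    by (rule semiconjugacy_exists[OF f(2,3) \<rho>], rule that)
  interpret flat_dynamics f a b C \<rho> h
    by unfold_locales (use cont f ab' flat C h \<open>\<rho> \<notin> \<rat>\<close> in \<open>simp_all\<close>)
  have sq: "scale_sequence \<rho> (\<lambda>n. nat (cf_denom r (Suc n))) (cf_error r)"
    using cf_scale_sequence[OF r, of "\<lfloor>\<rho>\<rfloor>"] \<rho>r by simp
  have "hausdorff_dim (nonwandering F) < 1" if bt: "bounded_type (rotation_number F)"
  proof -
    obtain k where growth: "\<And>n. nat (cf_denom r (Suc (Suc n))) \<le> k * nat (cf_denom r (Suc n))"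
      by (rule bounded_type_growth[OF r bt[folded r_def]], rule that)
    obtain s where s: "0 < s" "s < 1"
      and cover: "\<And>e. 0 < e \<Longrightarrow> \<exists>xs. (\<forall>x\<in>survivors \<inter> {b..a+1}. \<exists>(p, q)\<in>set xs. p \<le> x \<and> x \<le> q) \<and>
        (\<forall>(p, q)\<in>set xs. p \<le> q \<and> q - p \<le> e) \<and> (\<Sum>(p, q)\<leftarrow>xs. (q - p) powr s) \<le> e"
      by (rule survivors_covers[OF sq growth], rule that)
    show ?thesis
      by (rule hausdorff_dim_less_1[OF nonwandering_subset[OF f(1) ab'(3) c F] s cover])
  qed
  then show ?thesis using complement_null[OF f(1) ab'(3) sq] by blast
qed

end
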